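(* Let $\mathcal{T}=(V,E)$ be a rootless directed tree with $\operatorname{Br}(\mathcal{T})=1$, and let $S_{\underline\lambda}$ be a bounded weighted shift on $\mathcal{T}$ with positive weights. (i) If $\mathcal{T}$ has exactly two leaves, then $S_{\underline\lambda}$ is cyclic. (ii) Suppose $\mathcal{T}$ has exactly one leaf; then (up to relabeling) $V=\mathbb{Z}\cup\{1',\dots,k_0'\}$ with $k_0\in\mathbb{N}$ and $E=\{(j-1,j):j\in\mathbb{Z}\}\cup\{(0,1')\}\cup\{((j-1)',j'):1<j\le k_0\}$. Then $S_{\underline\lambda}$ is cyclic if and only if the bilateral weighted shift $W$ on $\ell^2(\mathbb{Z})$, $We_n=\lambda_{n+1}e_{n+1}$, is cyclic. In particular, if $S_{\underline\lambda}$ is a contraction not of class $C_{\cdot0}$, then $S_{\underline\lambda}$ is cyclic. (iii) If $S_{\underline\lambda}$ is a contraction of class $C_{1\cdot}$, then $S_{\underline\lambda}$ has no cyclic vectors. (iv) Let $\widetilde{\mathcal{T}}$ be the directed tree with vertices $\mathbb{Z}\cup\{k':k\in\mathbb{N}\}$ and edges $(j-1,j)$ ($j\in\mathbb{Z}$), $(0,1')$, $((k-1)',k')$ ($k\ge2$). There exists a cyclic bounded weighted shift with positive weights on $\widetilde{\mathcal{T}}$.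
   Context: A directed graph $(V,E)$ with $E\subseteq V\times V$ minus the diagonal is a directed tree if it is connected (as an undirected graph), each vertex has at most one parent (a $u$ with $(u,v)\in E$), and it has no directed circuit. $\operatorname{Chi}(u)=\{v:(u,v)\in E\}$; $\operatorname{par}(v)$ is the parent of $v$; a root is a vertex without parent; a leaf is a vertex without children. The branching index is $\operatorname{Br}(\mathcal{T})=\sum_{u\text{ not a leaf}}(\#\operatorname{Chi}(u)-1)$. Given weights $\underline\lambda=\{\lambda_v:v\in V\text{ not the root}\}$ with $\sup_u\sum_{v\in\operatorname{Chi}(u)}|\lambda_v|^2<\infty$, the weighted shift $S_{\underline\lambda}$ on $\ell^2(V)$ (with orthonormal basis $\{e_u\}$) is $S_{\underline\lambda}e_u=\sum_{v\in\operatorname{Chi}(u)}\lambda_ve_v$. An operator $T$ is cyclic if $\bigvee\{T^nh:n\ge0\}$ is the whole space for some $h$. For a contraction $T$, $\mathcal{H}_0(T)=\{x:\|T^nx\|\to0\}$; $T$ is of class $C_{1\cdot}$ if $\mathcal{H}_0(T)=\{0\}$ and of class $C_{\cdot0}$ if $T^{*n}x\to0$ for all $x$. *)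

theory Defs
  imports "HOL-Analysis.Analysis" "HOL-Library.Extended_Nat"
begin

section \<open>Directed trees\<close>

definition dtree :: "'a set \<Rightarrow> ('a \<times> 'a) set \<Rightarrow> bool" where
  "dtree V E \<longleftrightarrow> E \<subseteq> V \<times> V \<and> (\<forall>v. (v, v) \<notin> E)
     \<and> (\<forall>u\<in>V. \<forall>v\<in>V. (u, v) \<in> (E \<union> E\<inverse>)\<^sup>*)
     \<and> (\<forall>u w v. (u, v) \<in> E \<and> (w, v) \<in> E \<longrightarrow> u = w)
     \<and> (\<forall>v. (v, v) \<notin> E\<^sup>+)"

definition Chi :: "('a \<times> 'a) set \<Rightarrow> 'a \<Rightarrow> 'a set" where
  "Chi E u = {v. (u, v) \<in> E}"

definition has_parent :: "('a \<times> 'a) set \<Rightarrow> 'a \<Rightarrow> bool" where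
  "has_parent E v \<longleftrightarrow> (\<exists>u. (u, v) \<in> E)"

definition par :: "('a \<times> 'a) set \<Rightarrow> 'a \<Rightarrow> 'a" where
  "par E v = (THE u. (u, v) \<in> E)"

definition rootless :: "'a set \<Rightarrow> ('a \<times> 'a) set \<Rightarrow> bool" where
  "rootless V E \<longleftrightarrow> (\<forall>v\<in>V. has_parent E v)"

definition leaves :: "'a set \<Rightarrow> ('a \<times> 'a) set \<Rightarrow> 'a set" where
  "leaves V E = {u \<in> V. Chi E u = {}}"

definition ecard :: "'a set \<Rightarrow> enat" where
  "ecard A = (if finite A then enat (card A) else \<infinity>)"

text \<open>Branching index: sum over non-leaves of (#Chi(u) - 1), as a supremum of finite partial sums
  (an extended natural number).\<close>
definition Br :: "'a set \<Rightarrow> ('a \<times> 'a) set \<Rightarrow> enat" where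
  "Br V E = (SUP F \<in> {F. finite F \<and> F \<subseteq> V - leaves V E}. \<Sum>u\<in>F. ecard (Chi E u) - 1)"

section \<open>Weights\<close>

definition bounded_weights :: "'a set \<Rightarrow> ('a \<times> 'a) set \<Rightarrow> ('a \<Rightarrow> real) \<Rightarrow> bool" where
  "bounded_weights V E lam \<longleftrightarrow> (\<exists>C. \<forall>u\<in>V.
     (\<lambda>v. (lam v)\<^sup>2) summable_on Chi E u \<and> (\<Sum>\<^sub>\<infinity>v\<in>Chi E u. (lam v)\<^sup>2) \<le> C)"

definition positive_weights :: "'a set \<Rightarrow> ('a \<times> 'a) set \<Rightarrow> ('a \<Rightarrow> real) \<Rightarrow> bool" where
  "positive_weights V E lam \<longleftrightarrow> (\<forall>v\<in>V. has_parent E v \<longrightarrow> lam v > 0)"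

section \<open>The Hilbert space l2(V) (complex), concretely\<close>

definition l2 :: "'a set \<Rightarrow> ('a \<Rightarrow> complex) set" where
  "l2 V = {f. (\<forall>x. x \<notin> V \<longrightarrow> f x = 0) \<and> (\<lambda>x. (cmod (f x))\<^sup>2) summable_on V}"

definition l2norm :: "'a set \<Rightarrow> ('a \<Rightarrow> complex) \<Rightarrow> real" where
  "l2norm V f = sqrt (\<Sum>\<^sub>\<infinity>x\<in>V. (cmod (f x))\<^sup>2)"

definition l2inner :: "'a set \<Rightarrow> ('a \<Rightarrow> complex) \<Rightarrow> ('a \<Rightarrow> complex) \<Rightarrow> complex" where
  "l2inner V f g = (\<Sum>\<^sub>\<infinity>x\<in>V. f x * cnj (g x))"

text \<open>Weighted shift: S e_u = sum over v in Chi(u) of lam_v e_v, i.e. (S f)(v) = lam_v f(par v).\<close>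
definition wshift :: "'a set \<Rightarrow> ('a \<times> 'a) set \<Rightarrow> ('a \<Rightarrow> real) \<Rightarrow> ('a \<Rightarrow> complex) \<Rightarrow> ('a \<Rightarrow> complex)" where
  "wshift V E lam f = (\<lambda>v. if v \<in> V \<and> has_parent E v then complex_of_real (lam v) * f (par E v) else 0)"

section \<open>Operator notions\<close>

definition cyclic_vector :: "'a set \<Rightarrow> (('a \<Rightarrow> complex) \<Rightarrow> ('a \<Rightarrow> complex)) \<Rightarrow> ('a \<Rightarrow> complex) \<Rightarrow> bool" where
  "cyclic_vector V T h \<longleftrightarrow> h \<in> l2 V \<and>
     (\<forall>g\<in>l2 V. \<forall>\<epsilon>>0. \<exists>N (c :: nat \<Rightarrow> complex).
        l2norm V (\<lambda>x. g x - (\<Sum>n<N. c n * (T ^^ n) h x)) < \<epsilon>)"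

definition cyclic_op :: "'a set \<Rightarrow> (('a \<Rightarrow> complex) \<Rightarrow> ('a \<Rightarrow> complex)) \<Rightarrow> bool" where
  "cyclic_op V T \<longleftrightarrow> (\<exists>h. cyclic_vector V T h)"

definition contraction_op :: "'a set \<Rightarrow> (('a \<Rightarrow> complex) \<Rightarrow> ('a \<Rightarrow> complex)) \<Rightarrow> bool" where
  "contraction_op V T \<longleftrightarrow> (\<forall>f\<in>l2 V. l2norm V (T f) \<le> l2norm V f)"

definition H0 :: "'a set \<Rightarrow> (('a \<Rightarrow> complex) \<Rightarrow> ('a \<Rightarrow> complex)) \<Rightarrow> ('a \<Rightarrow> complex) set" where
  "H0 V T = {x \<in> l2 V. (\<lambda>n. l2norm V ((T ^^ n) x)) \<longlonglongrightarrow> 0}"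

definition class_C1_dot :: "'a set \<Rightarrow> (('a \<Rightarrow> complex) \<Rightarrow> ('a \<Rightarrow> complex)) \<Rightarrow> bool" where
  "class_C1_dot V T \<longleftrightarrow> H0 V T = {(\<lambda>_. 0)}"

text \<open>Hilbert space adjoint on l2(V) (set to 0 outside l2(V) to make it unique).\<close>
definition adjoint_op :: "'a set \<Rightarrow> (('a \<Rightarrow> complex) \<Rightarrow> ('a \<Rightarrow> complex)) \<Rightarrow> (('a \<Rightarrow> complex) \<Rightarrow> ('a \<Rightarrow> complex))" where
  "adjoint_op V T = (THE A. (\<forall>g. g \<notin> l2 V \<longrightarrow> A g = (\<lambda>_. 0)) \<and>
      (\<forall>g\<in>l2 V. A g \<in> l2 V \<and> (\<forall>f\<in>l2 V. l2inner V (T f) g = l2inner V f (A g))))"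

definition class_C_dot_0 :: "'a set \<Rightarrow> (('a \<Rightarrow> complex) \<Rightarrow> ('a \<Rightarrow> complex)) \<Rightarrow> bool" where
  "class_C_dot_0 V T \<longleftrightarrow> (\<forall>x\<in>l2 V. (\<lambda>n. l2norm V ((adjoint_op V T ^^ n) x)) \<longlonglongrightarrow> 0)"

section \<open>Concrete trees\<close>

definition bilat_E :: "(int \<times> int) set" where
  "bilat_E = {(j - 1, j) | j. True}"

definition oneleaf_V :: "nat \<Rightarrow> (int + nat) set" where
  "oneleaf_V k0 = range Inl \<union> Inr ` {1..k0}"

definition oneleaf_E :: "nat \<Rightarrow> ((int + nat) \<times> (int + nat)) set" where
  "oneleaf_E k0 = {(Inl (j - 1), Inl j) | j. True} \<union> {(Inl 0, Inr 1)}
      \<union> {(Inr (j - 1), Inr j) | j. 1 < j \<and> j \<le> k0}"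

definition tildeT_V :: "(int + nat) set" where
  "tildeT_V = range Inl \<union> Inr ` {1..}"

definition tildeT_E :: "((int + nat) \<times> (int + nat)) set" where
  "tildeT_E = {(Inl (j - 1), Inl j) | j. True} \<union> {(Inl 0, Inr 1)}
      \<union> {(Inr (k - 1), Inr k) | k. 2 \<le> k}"

end

theory Submission
  imports Defs "HOL-Computational_Algebra.Fundamental_Theorem_Algebra"
begin

text \<open>
  A rootless tree of branching index one is a fork: a two-sided or backward chain (the trunk) with a
  side branch attached at the vertex 0, where the side branch is not longer than the forward part of the trunk.
  Rescaling coordinates embeds the trunk shift \<open>W\<close> into the tree shift as an invariant graph
  subspace, complemented by the shift on the side branch.

  If the side branch is finite, its shift is nilpotent, so a cyclic vector of \<open>W\<close> plus the first basis
  vector of the side branch is cyclic, because \<open>W\<close> has dense range; conversely \<open>W\<close> is a quotient of the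
  tree shift. A backward weighted shift is always cyclic. If the tree shift is a contraction that is not of
  class \<open>C\<^sub>\<cdot>\<^sub>0\<close>, the backward weight products stay away from 0, so \<open>W\<close> is a quasiaffine transform
  of the unweighted bilateral shift, which is cyclic.

  In the \<open>C\<^sub>1\<^sub>\<cdot>\<close> case there are no leaves, and rescaling turns the shift into a bilateral plus a
  unilateral shift with orbit vectors \<open>(z\<^sup>n f, z\<^sup>n g)\<close>, which are all orthogonal to \<open>(cnj g, - cnj f)\<close>.

  For the cyclic example, polynomials \<open>q n = 1 + O(z\<^sup>n)\<close> tending to 0 on the unit circle away from 1 are built
  from Fejer kernels, \<open>F\<close> is a continuous function on the circle vanishing fast enough at 1 that
  \<open>q n * F\<close> tends to 0 uniformly, and the weights of the side branch decay fast compared with the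
  coefficients of the \<open>q n\<close>. Then \<open>q n (T)\<close> separates the side branch from the trunk, and
  \<open>1 - q n\<close> being divisible by \<open>z\<close> makes the closed span of \<open>z\<^sup>k F\<close>, \<open>k \<ge> 0\<close>, invariant under
  division by \<open>z\<close>.
\<close>

section \<open>The space l2\<close>

text \<open>The polynomials \<open>q n\<close> cannot be small on the whole circle, since
  \<open>coeff (q n) 0 = 1\<close> is their mean over it. They may therefore be large near 1, and
  \<open>F\<close> is built after them to absorb this. By Jensen's inequality, uniform smallness of
  \<open>q n * F\<close> forces \<open>log F\<close> to be non-integrable, which is Szego's
  criterion for the span of \<open>z^k F\<close>, \<open>k \<ge> 0\<close>, to be invariant under
  division by \<open>z\<close>; the explicit \<open>q n\<close> replace that theory. Flatness of
  \<open>q n\<close> at 0 serves the side branch: besides the constant 1 only coefficients of order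
  at least \<open>n\<close> act there, and these are damped by weights chosen after all
  \<open>q n\<close> are known. The trunk of the cyclic example is unweighted. Hence the same
  construction also yields a cyclic vector of the unweighted bilateral shift, which the statement on
  contractions not of class \<open>C\<^sub>\<cdot>\<^sub>0\<close> relies on. In the
  \<open>C\<^sub>1\<^sub>\<cdot>\<close> case, orthogonality is the commutativity of multiplication:
  the pairing is a coefficient of \<open>g f - f g\<close>. Cyclicity is always tested on closed
  invariant subspaces containing the candidate vector, so limits of orbit combinations can be used
  as new members at once.\<close>

lemma l2_zero_outside: "f \<in> l2 V \<Longrightarrow> x \<notin> V \<Longrightarrow> f x = 0"
  by (simp add: l2_def)

lemma l2norm_nonneg [simp]: "0 \<le> l2norm V f"
  by (simp add: l2norm_def infsum_nonneg)

lemma l2norm_sq: "(l2norm V f)\<^sup>2 = (\<Sum>\<^sub>\<infinity>x\<in>V. (cmod (f x))\<^sup>2)"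
  by (simp add: l2norm_def infsum_nonneg)

lemma L2_set_le_l2norm:
  assumes "f \<in> l2 V" "finite F" "F \<subseteq> V"
  shows "L2_set (\<lambda>x. cmod (f x)) F \<le> l2norm V f"
  unfolding L2_set_def l2norm_def
  by (rule real_sqrt_le_mono, rule finite_sum_le_infsum) (use assms in \<open>auto simp: l2_def\<close>)

text \<open>Membership and norm bounds are reduced to finite subsets, because \<open>L2_set\<close>
  comes with the Minkowski and Cauchy-Schwarz inequalities.\<close>

lemma l2I:
  assumes "\<And>x. x \<notin> V \<Longrightarrow> f x = 0"
    and le: "\<And>F. finite F \<Longrightarrow> F \<subseteq> V \<Longrightarrow> L2_set (\<lambda>x. cmod (f x)) F \<le> B"
  shows "f \<in> l2 V" and "l2norm V f \<le> B"
proof -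
  have B: "0 \<le> B" using le[of "{}"] by simp
  have sum: "(\<Sum>x\<in>F. (cmod (f x))\<^sup>2) \<le> B\<^sup>2" if "finite F" "F \<subseteq> V" for F
    using le[OF that] B by (simp add: L2_set_def real_sqrt_le_iff' sum_nonneg)
  have s: "(\<lambda>x. (cmod (f x))\<^sup>2) summable_on V"
    by (rule nonneg_bdd_above_summable_on) (use sum in \<open>auto intro!: bdd_aboveI[of _ "B\<^sup>2"]\<close>)
  then show "f \<in> l2 V" using assms(1) by (auto simp: l2_def)
  have "(\<Sum>\<^sub>\<infinity>x\<in>V. (cmod (f x))\<^sup>2) \<le> B\<^sup>2"
    by (rule infsum_le_finite_sums[OF s sum])
  then show "l2norm V f \<le> B"
    unfolding l2norm_def using B by (simp add: real_le_lsqrt infsum_nonneg)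
qed

lemma cmod_le_l2norm: "f \<in> l2 V \<Longrightarrow> cmod (f x) \<le> l2norm V f"
  using L2_set_le_l2norm[of f V "{x}"] l2_zero_outside[of f V x] by (cases "x \<in> V") auto

lemma l2norm_eq_0_imp: "f \<in> l2 V \<Longrightarrow> l2norm V f = 0 \<Longrightarrow> f = (\<lambda>_. 0)"
  using cmod_le_l2norm[of f V] by fastforce

lemma l2_zero [simp]: "(\<lambda>_. 0) \<in> l2 V" and l2norm_zero [simp]: "l2norm V (\<lambda>_. 0) = 0"
  by (auto simp: l2_def l2norm_def)

lemma l2_add_scaled:
  assumes "f \<in> l2 V" "g \<in> l2 V"
  shows "(\<lambda>x. f x + a * g x) \<in> l2 V"
    and "l2norm V (\<lambda>x. f x + a * g x) \<le> l2norm V f + cmod a * l2norm V g"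
proof -
  have *: "L2_set (\<lambda>x. cmod (f x + a * g x)) F \<le> l2norm V f + cmod a * l2norm V g"
    if F: "finite F" "F \<subseteq> V" for F
  proof -
    have "L2_set (\<lambda>x. cmod (f x + a * g x)) F \<le> L2_set (\<lambda>x. cmod (f x) + cmod a * cmod (g x)) F"
      by (rule L2_set_mono) (auto intro: order_trans[OF norm_triangle_ineq] simp: norm_mult)
    also have "\<dots> \<le> L2_set (\<lambda>x. cmod (f x)) F + L2_set (\<lambda>x. cmod a * cmod (g x)) F"
      by (rule L2_set_triangle_ineq)
    also have "L2_set (\<lambda>x. cmod a * cmod (g x)) F = cmod a * L2_set (\<lambda>x. cmod (g x)) F"
      by (simp add: L2_set_right_distrib)
    also have "L2_set (\<lambda>x. cmod (f x)) F + cmod a * L2_set (\<lambda>x. cmod (g x)) F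
        \<le> l2norm V f + cmod a * l2norm V g"
      using L2_set_le_l2norm F assms by (intro add_mono mult_left_mono) auto
    finally show ?thesis .
  qed
  show "(\<lambda>x. f x + a * g x) \<in> l2 V"
    by (rule l2I(1)[OF _ *]) (use assms in \<open>auto simp: l2_zero_outside\<close>)
  show "l2norm V (\<lambda>x. f x + a * g x) \<le> l2norm V f + cmod a * l2norm V g"
    by (rule l2I(2)[OF _ *]) (use assms in \<open>auto simp: l2_zero_outside\<close>)
qed

lemma l2_add: "f \<in> l2 V \<Longrightarrow> g \<in> l2 V \<Longrightarrow> (\<lambda>x. f x + g x) \<in> l2 V"
  using l2_add_scaled(1)[of f V g 1] by simp

lemma l2_diff: "f \<in> l2 V \<Longrightarrow> g \<in> l2 V \<Longrightarrow> (\<lambda>x. f x - g x) \<in> l2 V"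
  using l2_add_scaled(1)[of f V g "-1"] by simp

lemma l2_scale: "f \<in> l2 V \<Longrightarrow> (\<lambda>x. a * f x) \<in> l2 V"
  using l2_add_scaled(1)[of "\<lambda>_. 0" V f a] by simp

lemma l2_sum: "(\<And>i. i \<in> A \<Longrightarrow> f i \<in> l2 V) \<Longrightarrow> (\<lambda>x. \<Sum>i\<in>A. c i * f i x) \<in> l2 V"
  by (induction A rule: infinite_finite_induct) (auto intro!: l2_add l2_scale)

lemma l2norm_add_le: "f \<in> l2 V \<Longrightarrow> g \<in> l2 V \<Longrightarrow> l2norm V (\<lambda>x. f x + g x) \<le> l2norm V f + l2norm V g"
  using l2_add_scaled(2)[of f V g 1] by simp

lemma l2norm_scale: "l2norm V (\<lambda>x. a * f x) = cmod a * l2norm V f"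
  by (simp add: l2norm_def norm_mult power_mult_distrib infsum_cmult_right' real_sqrt_mult)

lemma l2norm_sum_le:
  assumes "\<And>i. i \<in> A \<Longrightarrow> f i \<in> l2 V"
  shows "l2norm V (\<lambda>x. \<Sum>i\<in>A. c i * f i x) \<le> (\<Sum>i\<in>A. cmod (c i) * l2norm V (f i))"
  using assms
proof (induction A rule: infinite_finite_induct)
  case (insert i A)
  have "l2norm V (\<lambda>x. c i * f i x + (\<Sum>i\<in>A. c i * f i x))
     \<le> l2norm V (\<lambda>x. c i * f i x) + l2norm V (\<lambda>x. \<Sum>i\<in>A. c i * f i x)"
    using insert by (intro l2norm_add_le l2_scale l2_sum) auto
  with insert show ?case by (simp add: l2norm_scale)
qed auto

definition delta :: "'a \<Rightarrow> 'a \<Rightarrow> complex" where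
  "delta v = (\<lambda>x. if x = v then 1 else 0)"

lemma delta_l2:
  assumes "v \<in> V"
  shows "delta v \<in> l2 V" and "l2norm V (delta v) = 1"
proof -
  have *: "L2_set (\<lambda>x. cmod (delta v x)) F \<le> 1" if "finite F" for F
  proof -
    have "(\<Sum>x\<in>F. (cmod (delta v x))\<^sup>2) = (\<Sum>x\<in>F. if x = v then 1 else 0)"
      by (rule sum.cong) (auto simp: delta_def)
    then show ?thesis using that by (simp add: L2_set_def)
  qed
  show 1: "delta v \<in> l2 V"
    by (rule l2I(1)[OF _ *]) (use assms in \<open>auto simp: delta_def\<close>)
  have "l2norm V (delta v) \<le> 1"
    by (rule l2I(2)[OF _ *]) (use assms in \<open>auto simp: delta_def\<close>)
  then show "l2norm V (delta v) = 1"
    using cmod_le_l2norm[OF 1, of v] by (simp add: delta_def)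
qed

lemma finite_support_approx:
  assumes f: "f \<in> l2 V" and e: "e > 0"
  obtains F where "finite F" "F \<subseteq> V" "l2norm V (\<lambda>x. f x - (\<Sum>v\<in>F. f v * delta v x)) < e"
proof -
  let ?g = "\<lambda>x. (cmod (f x))\<^sup>2"
  have s: "?g summable_on V" using f by (simp add: l2_def)
  have "(sum ?g \<longlongrightarrow> infsum ?g V) (finite_subsets_at_top V)"
    using s by (simp add: infsum_tendsto)
  then have "eventually (\<lambda>F. dist (sum ?g F) (infsum ?g V) < e\<^sup>2) (finite_subsets_at_top V)"
    using e by (intro tendstoD) auto
  then obtain F where F: "finite F" "F \<subseteq> V" "dist (sum ?g F) (infsum ?g V) < e\<^sup>2"
    unfolding eventually_finite_subsets_at_top by blast
  have "(cmod (f x - (\<Sum>v\<in>F. f v * delta v x)))\<^sup>2 = (if x \<in> F then 0 else ?g x)" for x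
    using F(1) by (simp add: delta_def if_distrib[of "\<lambda>z. _ * z"] cong: if_cong)
  then have "(\<Sum>\<^sub>\<infinity>x\<in>V. (cmod (f x - (\<Sum>v\<in>F. f v * delta v x)))\<^sup>2) = infsum ?g (V - F)"
    by (intro infsum_cong_neutral) auto
  also have "\<dots> = infsum ?g V - infsum ?g F"
    by (rule infsum_Diff) (use s F in \<open>auto intro: summable_on_finite\<close>)
  also have "\<dots> < e\<^sup>2" using F by (simp add: dist_real_def)
  finally have "l2norm V (\<lambda>x. f x - (\<Sum>v\<in>F. f v * delta v x)) < e"
    unfolding l2norm_def using e by (simp add: real_less_lsqrt infsum_nonneg)
  with F that show ?thesis by blast
qed

subsection \<open>Inner product\<close>

lemma l2_mult_summable:
  assumes "f \<in> l2 V" "g \<in> l2 V"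
  shows "(\<lambda>x. cmod (f x * g x)) summable_on V"
    and "(\<Sum>\<^sub>\<infinity>x\<in>V. cmod (f x * g x)) \<le> l2norm V f * l2norm V g"
proof -
  have *: "(\<Sum>x\<in>F. cmod (f x * g x)) \<le> l2norm V f * l2norm V g" if F: "finite F" "F \<subseteq> V" for F
  proof -
    have "(\<Sum>x\<in>F. cmod (f x * g x)) = (\<Sum>x\<in>F. \<bar>cmod (f x)\<bar> * \<bar>cmod (g x)\<bar>)"
      by (simp add: norm_mult)
    also have "\<dots> \<le> L2_set (\<lambda>x. cmod (f x)) F * L2_set (\<lambda>x. cmod (g x)) F"
      by (rule L2_set_mult_ineq)
    also have "\<dots> \<le> l2norm V f * l2norm V g"
      using L2_set_le_l2norm F assms by (intro mult_mono) auto
    finally show ?thesis .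
  qed
  show s: "(\<lambda>x. cmod (f x * g x)) summable_on V"
    by (rule nonneg_bdd_above_summable_on) (use * in \<open>auto intro!: bdd_aboveI[of _ "l2norm V f * l2norm V g"]\<close>)
  show "(\<Sum>\<^sub>\<infinity>x\<in>V. cmod (f x * g x)) \<le> l2norm V f * l2norm V g"
    by (rule infsum_le_finite_sums[OF s *])
qed

lemma l2_cnj: "f \<in> l2 V \<Longrightarrow> (\<lambda>x. cnj (f x)) \<in> l2 V" "l2norm V (\<lambda>x. cnj (f x)) = l2norm V f"
  by (auto simp: l2_def l2norm_def)

lemma l2inner_summable:
  "f \<in> l2 V \<Longrightarrow> g \<in> l2 V \<Longrightarrow> (\<lambda>x. f x * cnj (g x)) summable_on V"
  using l2_mult_summable(1)[of f V "\<lambda>x. cnj (g x)"] l2_cnj(1)[of g V]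
  by (simp add: abs_summable_summable)

lemma cmod_l2inner_le:
  assumes "f \<in> l2 V" "g \<in> l2 V"
  shows "cmod (l2inner V f g) \<le> l2norm V f * l2norm V g"
proof -
  have "cmod (l2inner V f g) \<le> (\<Sum>\<^sub>\<infinity>x\<in>V. cmod (f x * cnj (g x)))"
    unfolding l2inner_def
    by (rule norm_infsum_bound) (rule l2_mult_summable(1)[OF assms(1) l2_cnj(1)[OF assms(2)]])
  also have "\<dots> \<le> l2norm V f * l2norm V g"
    using l2_mult_summable(2)[OF assms(1) l2_cnj(1)[OF assms(2)]] by (simp add: l2_cnj(2))
  finally show ?thesis .
qed

lemma l2inner_self:
  assumes "f \<in> l2 V"
  shows "l2inner V f f = complex_of_real ((l2norm V f)\<^sup>2)"
proof -
  have "((\<lambda>x. (cmod (f x))\<^sup>2) has_sum (l2norm V f)\<^sup>2) V"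
    unfolding l2norm_sq using assms by (intro has_sum_infsum) (simp add: l2_def)
  from has_sum_of_real[OF this, where 'a = complex] show ?thesis
    unfolding l2inner_def complex_norm_square[symmetric] by (intro infsumI) simp
qed

lemma l2inner_add_scaled_left:
  assumes "f \<in> l2 V" "g \<in> l2 V" "h \<in> l2 V"
  shows "l2inner V (\<lambda>x. f x + a * g x) h = l2inner V f h + a * l2inner V g h"
proof -
  have "l2inner V (\<lambda>x. f x + a * g x) h = (\<Sum>\<^sub>\<infinity>x\<in>V. f x * cnj (h x) + a * (g x * cnj (h x)))"
    by (simp add: l2inner_def algebra_simps)
  also have "\<dots> = l2inner V f h + a * l2inner V g h"
    unfolding l2inner_def
    by (subst infsum_add) (auto intro!: l2inner_summable assms summable_on_cmult_right simp: infsum_cmult_right')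
  finally show ?thesis .
qed

lemma l2inner_delta:
  assumes "v \<in> V"
  shows "l2inner V f (delta v) = f v" and "l2inner V (delta v) g = cnj (g v)"
proof -
  have "l2inner V f (delta v) = (\<Sum>\<^sub>\<infinity>x\<in>{v}. f x * cnj (delta v x))"
    unfolding l2inner_def by (rule infsum_cong_neutral) (use assms in \<open>auto simp: delta_def\<close>)
  then show "l2inner V f (delta v) = f v" by (simp add: delta_def)
  have "l2inner V (delta v) g = (\<Sum>\<^sub>\<infinity>x\<in>{v}. delta v x * cnj (g x))"
    unfolding l2inner_def by (rule infsum_cong_neutral) (use assms in \<open>auto simp: delta_def\<close>)
  then show "l2inner V (delta v) g = cnj (g v)" by (simp add: delta_def)
qed

section \<open>Bounded operators and cyclic vectors\<close>

text \<open>Additivity and homogeneity are merged into one equation, demanded on \<open>l2 V\<close>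
  only. The bound is strictly positive so that \<open>e / C\<close> can serve as a
  tolerance.\<close>

definition blin :: "'a set \<Rightarrow> 'b set \<Rightarrow> (('a \<Rightarrow> complex) \<Rightarrow> ('b \<Rightarrow> complex)) \<Rightarrow> bool" where
  "blin V W X \<longleftrightarrow> (\<forall>f\<in>l2 V. X f \<in> l2 W)
     \<and> (\<forall>f\<in>l2 V. \<forall>g\<in>l2 V. \<forall>a. X (\<lambda>x. f x + a * g x) = (\<lambda>x. X f x + a * X g x))
     \<and> (\<exists>C>0. \<forall>f\<in>l2 V. l2norm W (X f) \<le> C * l2norm V f)"

lemma blin_l2: "blin V W X \<Longrightarrow> f \<in> l2 V \<Longrightarrow> X f \<in> l2 W"
  by (simp add: blin_def)

lemma blin_add_scaled:
  "blin V W X \<Longrightarrow> f \<in> l2 V \<Longrightarrow> g \<in> l2 V \<Longrightarrow> X (\<lambda>x. f x + a * g x) = (\<lambda>x. X f x + a * X g x)"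
  by (simp add: blin_def)

lemma blin_bound:
  assumes "blin V W X"
  obtains C where "C > 0" "\<And>f. f \<in> l2 V \<Longrightarrow> l2norm W (X f) \<le> C * l2norm V f"
  using assms unfolding blin_def by blast

lemma blin_zero: "blin V W X \<Longrightarrow> X (\<lambda>_. 0) = (\<lambda>_. 0)"
  using blin_add_scaled[of V W X "\<lambda>_. 0" "\<lambda>_. 0" "-1"] by (simp add: fun_eq_iff)

lemma blin_scale: "blin V W X \<Longrightarrow> f \<in> l2 V \<Longrightarrow> X (\<lambda>x. a * f x) = (\<lambda>x. a * X f x)"
  using blin_add_scaled[of V W X "\<lambda>_. 0" f a] blin_zero[of V W X] by simp

lemma blin_add: "blin V W X \<Longrightarrow> f \<in> l2 V \<Longrightarrow> g \<in> l2 V \<Longrightarrow> X (\<lambda>x. f x + g x) = (\<lambda>x. X f x + X g x)"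
  using blin_add_scaled[of V W X f g 1] by simp

lemma blin_diff: "blin V W X \<Longrightarrow> f \<in> l2 V \<Longrightarrow> g \<in> l2 V \<Longrightarrow> X (\<lambda>x. f x - g x) = (\<lambda>x. X f x - X g x)"
  using blin_add_scaled[of V W X f g "-1"] by simp

lemma blin_sum:
  assumes "blin V W X" "\<And>i. i \<in> A \<Longrightarrow> f i \<in> l2 V"
  shows "X (\<lambda>x. \<Sum>i\<in>A. c i * f i x) = (\<lambda>y. \<Sum>i\<in>A. c i * X (f i) y)"
  using assms(2)
proof (induction A rule: infinite_finite_induct)
  case (insert i A)
  have "X (\<lambda>x. c i * f i x + (\<Sum>i\<in>A. c i * f i x))
      = (\<lambda>y. X (\<lambda>x. c i * f i x) y + X (\<lambda>x. \<Sum>i\<in>A. c i * f i x) y)"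
    by (rule blin_add[OF assms(1)]; intro l2_scale l2_sum) (use insert.prems in auto)
  also have "X (\<lambda>x. c i * f i x) = (\<lambda>y. c i * X (f i) y)"
    by (rule blin_scale[OF assms(1)]) (use insert.prems in auto)
  also have "X (\<lambda>x. \<Sum>i\<in>A. c i * f i x) = (\<lambda>y. \<Sum>i\<in>A. c i * X (f i) y)"
    by (rule insert.IH) (use insert.prems in auto)
  finally show ?case using insert.hyps by simp
qed (auto simp: blin_zero[OF assms(1)])

lemma blin_power_l2: "blin V V T \<Longrightarrow> f \<in> l2 V \<Longrightarrow> (T ^^ n) f \<in> l2 V"
  by (induction n) (simp_all add: blin_l2[of V V T])

lemma blin_power_add:
  assumes "blin V V T" "f \<in> l2 V" "g \<in> l2 V"
  shows "(T ^^ n) (\<lambda>x. f x + g x) = (\<lambda>x. (T ^^ n) f x + (T ^^ n) g x)"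
  by (induction n) (auto simp: blin_add[OF assms(1)] blin_power_l2[OF assms(1)] assms)

lemma intertwine_power:
  assumes "blin V V T" "\<And>f. f \<in> l2 V \<Longrightarrow> X (T f) = T' (X f)" "f \<in> l2 V"
  shows "X ((T ^^ n) f) = (T' ^^ n) (X f)"
  by (induction n) (auto simp: assms blin_power_l2[OF assms(1)])

section \<open>Weighted composition operators\<close>

definition wcomp :: "'b set \<Rightarrow> ('b \<Rightarrow> complex) \<Rightarrow> ('b \<Rightarrow> 'a) \<Rightarrow> ('a \<Rightarrow> complex) \<Rightarrow> ('b \<Rightarrow> complex)" where
  "wcomp W m r f = (\<lambda>y. if y \<in> W then m y * f (r y) else 0)"

text \<open>Multiplicity two is what a fork needs: the branching vertex has two children, and
  \<open>lift\<close> reads each trunk coordinate at most twice.\<close>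

definition fibres_le2 :: "'b set \<Rightarrow> ('b \<Rightarrow> 'a) \<Rightarrow> bool" where
  "fibres_le2 W r \<longleftrightarrow> (\<forall>x. finite {y \<in> W. r y = x} \<and> card {y \<in> W. r y = x} \<le> 2)"

lemma fibres_le2_inj: "inj_on r W \<Longrightarrow> fibres_le2 W r"
  unfolding fibres_le2_def
proof
  fix x assume inj: "inj_on r W"
  show "finite {y \<in> W. r y = x} \<and> card {y \<in> W. r y = x} \<le> 2"
  proof (cases "\<exists>y\<in>W. r y = x")
    case True
    then obtain y where "y \<in> W" "r y = x" by blast
    then have "{y \<in> W. r y = x} = {y}" using inj by (auto dest: inj_onD)
    then show ?thesis by simp
  next
    case False
    then have "{y \<in> W. r y = x} = {}" by auto
    then show ?thesis by (metis card.empty finite.emptyI zero_le)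
  qed
qed

text \<open>Tree shifts, the restriction to the trunk, \<open>lift\<close>, diagonal rescalings and
  relabelings are all of the form \<open>wcomp\<close>, so this one estimate makes them
  bounded.\<close>

lemma blin_wcomp:
  assumes m: "\<And>y. y \<in> W \<Longrightarrow> cmod (m y) \<le> C" and r: "r ` W \<subseteq> V" and fib: "fibres_le2 W r"
  shows "blin V W (wcomp W m r)"
proof -
  define D where "D = \<bar>C\<bar> + 1"
  have D: "D > 0" "\<And>y. y \<in> W \<Longrightarrow> cmod (m y) \<le> D" using m by (force simp: D_def)+
  have *: "L2_set (\<lambda>y. cmod (wcomp W m r f y)) F \<le> 2 * D * l2norm V f"
    if f: "f \<in> l2 V" and F: "finite F" "F \<subseteq> W" for f F
  proof -
    have "(\<Sum>y\<in>F. (cmod (wcomp W m r f y))\<^sup>2) \<le> (\<Sum>y\<in>F. D\<^sup>2 * (cmod (f (r y)))\<^sup>2)"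
    proof (rule sum_mono)
      fix y assume "y \<in> F"
      then have "y \<in> W" using F by auto
      then show "(cmod (wcomp W m r f y))\<^sup>2 \<le> D\<^sup>2 * (cmod (f (r y)))\<^sup>2"
        using D(2)[of y] by (auto simp: wcomp_def norm_mult power_mult_distrib intro!: mult_right_mono power_mono)
    qed
    also have "\<dots> = (\<Sum>x\<in>r ` F. \<Sum>y\<in>{y \<in> F. r y = x}. D\<^sup>2 * (cmod (f (r y)))\<^sup>2)"
      by (rule sum.image_gen[OF F(1)])
    also have "\<dots> = (\<Sum>x\<in>r ` F. real (card {y \<in> F. r y = x}) * (D\<^sup>2 * (cmod (f x))\<^sup>2))"
      by (rule sum.cong) auto
    \<comment> \<open>The fibre bound 2 is relaxed to 4 so that the constant is the square of
      \<open>2 * D\<close>.\<close>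
    also have "\<dots> \<le> (\<Sum>x\<in>r ` F. 4 * (D\<^sup>2 * (cmod (f x))\<^sup>2))"
    proof (intro sum_mono mult_right_mono)
      fix x
      have "card {y \<in> F. r y = x} \<le> card {y \<in> W. r y = x}"
        using fib F(2) unfolding fibres_le2_def by (intro card_mono) auto
      also have "\<dots> \<le> 4" using fib unfolding fibres_le2_def by (meson order_trans numeral_le_iff semiring_norm)
      finally show "real (card {y \<in> F. r y = x}) \<le> 4" by simp
    qed auto
    also have "\<dots> = (2 * D)\<^sup>2 * (\<Sum>x\<in>r ` F. (cmod (f x))\<^sup>2)"
      by (simp add: sum_distrib_left power_mult_distrib mult.assoc)
    finally have "L2_set (\<lambda>y. cmod (wcomp W m r f y)) F \<le> sqrt ((2 * D)\<^sup>2 * (\<Sum>x\<in>r ` F. (cmod (f x))\<^sup>2))"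
      unfolding L2_set_def by (rule real_sqrt_le_mono)
    also have "\<dots> = 2 * D * L2_set (\<lambda>x. cmod (f x)) (r ` F)"
      using D(1) by (simp add: L2_set_def real_sqrt_mult)
    also have "\<dots> \<le> 2 * D * l2norm V f"
      using F r D(1) by (intro mult_left_mono L2_set_le_l2norm f) auto
    finally show ?thesis .
  qed
  have z: "wcomp W m r f y = 0" if "y \<notin> W" for f y using that by (simp add: wcomp_def)
  show ?thesis unfolding blin_def
  proof (intro conjI ballI allI exI[of _ "2 * D"])
    show "wcomp W m r f \<in> l2 W" if "f \<in> l2 V" for f
      by (rule l2I(1)[OF z *[OF that]])
    show "l2norm W (wcomp W m r f) \<le> 2 * D * l2norm V f" if "f \<in> l2 V" for f
      by (rule l2I(2)[OF z *[OF that]])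
  qed (use D in \<open>auto simp: wcomp_def algebra_simps fun_eq_iff\<close>)
qed

section \<open>Closed subspaces\<close>

definition csub :: "'a set \<Rightarrow> ('a \<Rightarrow> complex) set \<Rightarrow> bool" where
  "csub V M \<longleftrightarrow> M \<subseteq> l2 V \<and> (\<lambda>_. 0) \<in> M
     \<and> (\<forall>f\<in>M. \<forall>g\<in>M. \<forall>a. (\<lambda>x. f x + a * g x) \<in> M)
     \<and> (\<forall>f\<in>l2 V. (\<forall>e>0. \<exists>g\<in>M. l2norm V (\<lambda>x. f x - g x) < e) \<longrightarrow> f \<in> M)"

lemma csub_zero: "csub V M \<Longrightarrow> (\<lambda>_. 0) \<in> M"
  by (auto simp: csub_def)

lemma csub_add_scaled: "csub V M \<Longrightarrow> f \<in> M \<Longrightarrow> g \<in> M \<Longrightarrow> (\<lambda>x. f x + a * g x) \<in> M"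
  by (auto simp: csub_def)

lemma csub_add: "csub V M \<Longrightarrow> f \<in> M \<Longrightarrow> g \<in> M \<Longrightarrow> (\<lambda>x. f x + g x) \<in> M"
  using csub_add_scaled[of V M f g 1] by simp

lemma csub_diff: "csub V M \<Longrightarrow> f \<in> M \<Longrightarrow> g \<in> M \<Longrightarrow> (\<lambda>x. f x - g x) \<in> M"
  using csub_add_scaled[of V M f g "-1"] by simp

lemma csub_scale: "csub V M \<Longrightarrow> f \<in> M \<Longrightarrow> (\<lambda>x. a * f x) \<in> M"
  using csub_add_scaled[of V M "\<lambda>_. 0" f a] csub_zero[of V M] by simp

lemma csub_sum: "csub V M \<Longrightarrow> (\<And>i. i \<in> A \<Longrightarrow> f i \<in> M) \<Longrightarrow> (\<lambda>x. \<Sum>i\<in>A. c i * f i x) \<in> M"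
  by (induction A rule: infinite_finite_induct) (auto intro!: csub_add csub_scale simp: csub_zero)

lemma csub_closed:
  "csub V M \<Longrightarrow> f \<in> l2 V \<Longrightarrow> (\<And>e. e > 0 \<Longrightarrow> \<exists>g\<in>M. l2norm V (\<lambda>x. f x - g x) < e) \<Longrightarrow> f \<in> M"
  by (auto simp: csub_def)

lemma csub_tendsto:
  assumes "csub V M" "f \<in> l2 V" "\<And>n. g n \<in> M"
    and "(\<lambda>n. l2norm V (\<lambda>x. f x - g n x)) \<longlonglongrightarrow> 0"
  shows "f \<in> M"
proof (rule csub_closed[OF assms(1,2)])
  fix e :: real assume "e > 0"
  with assms(4) have "eventually (\<lambda>n. l2norm V (\<lambda>x. f x - g n x) < e) sequentially"
    by (rule order_tendstoD(2))
  then show "\<exists>g\<in>M. l2norm V (\<lambda>x. f x - g x) < e"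
    using assms(3) by (auto simp: eventually_sequentially)
qed

lemma csub_eq_l2:
  assumes M: "csub V M" and d: "\<And>v. v \<in> V \<Longrightarrow> delta v \<in> M"
  shows "M = l2 V"
proof
  show "M \<subseteq> l2 V" using M by (auto simp: csub_def)
  show "l2 V \<subseteq> M"
  proof
    fix f assume f: "f \<in> l2 V"
    show "f \<in> M"
    proof (rule csub_closed[OF M f])
      fix e :: real assume "e > 0"
      from finite_support_approx[OF f this] obtain F where
        F: "F \<subseteq> V" "l2norm V (\<lambda>x. f x - (\<Sum>v\<in>F. f v * delta v x)) < e" by blast
      then show "\<exists>g\<in>M. l2norm V (\<lambda>x. f x - g x) < e"
        using d by (intro bexI[of _ "\<lambda>x. \<Sum>v\<in>F. f v * delta v x"] csub_sum[OF M]) auto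
    qed
  qed
qed

lemma csub_vimage:
  assumes X: "blin V W X" and M: "csub W M"
  shows "csub V {f \<in> l2 V. X f \<in> M}"
proof -
  from X obtain C where C: "C > 0" "\<And>f. f \<in> l2 V \<Longrightarrow> l2norm W (X f) \<le> C * l2norm V f"
    by (auto elim: blin_bound)
  have "X f \<in> M" if f: "f \<in> l2 V" and
    ap: "\<And>e. e > 0 \<Longrightarrow> \<exists>g. g \<in> l2 V \<and> X g \<in> M \<and> l2norm V (\<lambda>x. f x - g x) < e" for f
  proof (rule csub_closed[OF M])
    show "X f \<in> l2 W" using X f by (rule blin_l2)
    fix e :: real assume "e > 0"
    with ap[of "e / C"] C obtain g where g: "g \<in> l2 V" "X g \<in> M" "l2norm V (\<lambda>x. f x - g x) < e / C"
      by auto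
    have "l2norm W (\<lambda>x. X f x - X g x) = l2norm W (X (\<lambda>x. f x - g x))"
      using blin_diff[OF X f g(1)] by simp
    also have "\<dots> \<le> C * l2norm V (\<lambda>x. f x - g x)"
      using C f g by (intro C l2_diff)
    also have "\<dots> < e" using g C by (simp add: field_simps)
    finally show "\<exists>g\<in>M. l2norm W (\<lambda>x. X f x - g x) < e" using g by blast
  qed
  then show ?thesis
    using M unfolding csub_def
    by (auto simp: blin_zero[OF X] blin_add_scaled[OF X] intro: l2_add_scaled(1))
qed

text \<open>Provides the two obstructions to cyclicity used later: an orbit orthogonal to a fixed
  vector, and an orbit vanishing at a fixed vertex.\<close>

lemma csub_kernel:
  assumes add: "\<And>f g a. f \<in> l2 V \<Longrightarrow> g \<in> l2 V \<Longrightarrow> L (\<lambda>x. f x + a * g x) = L f + a * L g"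
    and bound: "\<And>f. f \<in> l2 V \<Longrightarrow> cmod (L f) \<le> K * l2norm V f"
  shows "csub V {f \<in> l2 V. L f = 0}"
  unfolding csub_def
proof (intro conjI ballI allI impI)
  show "(\<lambda>_. 0) \<in> {f \<in> l2 V. L f = 0}" using bound[of "\<lambda>_. 0"] by simp
  fix f assume f: "f \<in> l2 V" and ap: "\<forall>e>0. \<exists>g\<in>{f \<in> l2 V. L f = 0}. l2norm V (\<lambda>x. f x - g x) < e"
  have "cmod (L f) \<le> 0 + e" if e: "e > 0" for e
  proof -
    have "e / (\<bar>K\<bar> + 1) > 0" using e by (intro divide_pos_pos) auto
    then obtain g where g: "g \<in> l2 V" "L g = 0" "l2norm V (\<lambda>x. f x - g x) < e / (\<bar>K\<bar> + 1)"
      using ap by blast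
    have "L f = L (\<lambda>x. f x - g x)" using add[OF f g(1), of "-1"] g(2) by simp
    then have "cmod (L f) \<le> K * l2norm V (\<lambda>x. f x - g x)" using bound[OF l2_diff[OF f g(1)]] by simp
    also have "\<dots> \<le> (\<bar>K\<bar> + 1) * (e / (\<bar>K\<bar> + 1))"
      using g(3) by (intro mult_mono) auto
    also have "\<dots> = e" by (simp add: add_nonneg_eq_0_iff)
    finally show ?thesis by simp
  qed
  then have "cmod (L f) \<le> 0" by (rule field_le_epsilon)
  then show "f \<in> {f \<in> l2 V. L f = 0}" using f by simp
qed (auto simp: add intro: l2_add_scaled(1))

section \<open>Closed spans of orbits and the invariant subspace criterion for cyclicity\<close>

definition closed_orbit_span :: "'a set \<Rightarrow> (('a \<Rightarrow> complex) \<Rightarrow> ('a \<Rightarrow> complex)) \<Rightarrow> ('a \<Rightarrow> complex) \<Rightarrow> ('a \<Rightarrow> complex) set" where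
  "closed_orbit_span V T h = {g \<in> l2 V. \<forall>\<epsilon>>0. \<exists>N (c :: nat \<Rightarrow> complex).
        l2norm V (\<lambda>x. g x - (\<Sum>n<N. c n * (T ^^ n) h x)) < \<epsilon>}"

lemma cyclic_vector_closed_orbit_span:
  "cyclic_vector V T h \<longleftrightarrow> h \<in> l2 V \<and> closed_orbit_span V T h = l2 V"
  by (auto simp: cyclic_vector_def closed_orbit_span_def)

lemma csub_closed_orbit_span:
  assumes T: "blin V V T" and h: "h \<in> l2 V"
  shows "csub V (closed_orbit_span V T h)"
proof -
  let ?P = "\<lambda>N c x. \<Sum>n<N. c n * (T ^^ n) h x :: complex"
  have Pl2: "?P N c \<in> l2 V" for N :: nat and c by (intro l2_sum blin_power_l2 T h)
  show ?thesis unfolding csub_def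
  proof (intro conjI ballI allI impI)
    show "closed_orbit_span V T h \<subseteq> l2 V" by (auto simp: closed_orbit_span_def)
    show "(\<lambda>_. 0) \<in> closed_orbit_span V T h"
      unfolding closed_orbit_span_def by (auto intro!: exI[of _ 0])
    fix f assume f: "f \<in> l2 V"
      and ap: "\<forall>e>0. \<exists>g\<in>closed_orbit_span V T h. l2norm V (\<lambda>x. f x - g x) < e"
    show "f \<in> closed_orbit_span V T h" unfolding closed_orbit_span_def
    proof (intro CollectI conjI f allI impI)
      fix e :: real assume "e > 0"
      then obtain g where g: "g \<in> closed_orbit_span V T h" "l2norm V (\<lambda>x. f x - g x) < e / 2"
        using ap by (meson half_gt_zero)
      then obtain N c where Nc: "l2norm V (\<lambda>x. g x - ?P N c x) < e / 2"
        unfolding closed_orbit_span_def using \<open>e > 0\<close> half_gt_zero by blast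
      have gl: "g \<in> l2 V" using g by (simp add: closed_orbit_span_def)
      have "l2norm V (\<lambda>x. f x - ?P N c x) = l2norm V (\<lambda>x. (f x - g x) + (g x - ?P N c x))" by simp
      also have "\<dots> \<le> l2norm V (\<lambda>x. f x - g x) + l2norm V (\<lambda>x. g x - ?P N c x)"
        using f gl Pl2 by (intro l2norm_add_le l2_diff)
      also have "\<dots> < e" using g Nc by simp
      finally show "\<exists>N c. l2norm V (\<lambda>x. f x - ?P N c x) < e" by blast
    qed
  next
    fix f g a assume fg: "f \<in> closed_orbit_span V T h" "g \<in> closed_orbit_span V T h"
    then have l: "f \<in> l2 V" "g \<in> l2 V" by (auto simp: closed_orbit_span_def)
    show "(\<lambda>x. f x + a * g x) \<in> closed_orbit_span V T h" unfolding closed_orbit_span_def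
    proof (intro CollectI conjI l2_add_scaled l allI impI)
      fix e :: real assume e: "e > 0"
      define e' where "e' = e / (2 * (1 + cmod a))"
      have pos: "1 + cmod a > 0" by (smt (verit) norm_ge_zero)
      have e': "e' > 0" "(1 + cmod a) * e' < e" using e pos by (auto simp: e'_def field_simps add_pos_nonneg)
      obtain N c where 1: "l2norm V (\<lambda>x. f x - ?P N c x) < e'"
        using fg(1) e'(1) unfolding closed_orbit_span_def by blast
      obtain N' c' where 2: "l2norm V (\<lambda>x. g x - ?P N' c' x) < e'"
        using fg(2) e'(1) unfolding closed_orbit_span_def by blast
      \<comment> \<open>Padding with zeros brings two polynomials of different length to a common
        length.\<close>
      define d where "d n = (if n < N then c n else 0) + a * (if n < N' then c' n else 0)" for n
      have "?P (max N N') d x = ?P N c x + a * ?P N' c' x" for x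
      proof -
        have "?P (max N N') d x = (\<Sum>n<max N N'. if n < N then c n * (T ^^ n) h x else 0)
           + a * (\<Sum>n<max N N'. if n < N' then c' n * (T ^^ n) h x else 0)"
          unfolding d_def sum_distrib_left sum.distrib[symmetric] by (intro sum.cong) (auto simp: algebra_simps)
        also have "(\<Sum>n<max N N'. if n < N then c n * (T ^^ n) h x else 0) = ?P N c x"
          by (rule sum.mono_neutral_cong_right) auto
        also have "(\<Sum>n<max N N'. if n < N' then c' n * (T ^^ n) h x else 0) = ?P N' c' x"
          by (rule sum.mono_neutral_cong_right) auto
        finally show ?thesis .
      qed
      then have "l2norm V (\<lambda>x. f x + a * g x - ?P (max N N') d x)
          = l2norm V (\<lambda>x. (f x - ?P N c x) + a * (g x - ?P N' c' x))"
        by (simp add: algebra_simps)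
      also have "\<dots> \<le> l2norm V (\<lambda>x. f x - ?P N c x) + cmod a * l2norm V (\<lambda>x. g x - ?P N' c' x)"
        using l Pl2 by (intro l2_add_scaled l2_diff)
      also have "\<dots> \<le> e' + cmod a * e'"
        using 1 2 by (intro add_mono mult_left_mono) auto
      also have "\<dots> < e" using e'(2) by (simp add: algebra_simps)
      finally show "\<exists>N c. l2norm V (\<lambda>x. f x + a * g x - ?P N c x) < e" by blast
    qed
  qed
qed

lemma orbit_in_closed_orbit_span:
  assumes "blin V V T" "h \<in> l2 V"
  shows "(T ^^ n) h \<in> closed_orbit_span V T h"
proof -
  have "(\<Sum>k<Suc n. (if k = n then 1 else 0) * (T ^^ k) h x) = (T ^^ n) h x" for x
    by (simp add: if_distrib[of "\<lambda>z. z * _"] cong: if_cong)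
  then show ?thesis unfolding closed_orbit_span_def
    using blin_power_l2[OF assms] 
    by (auto intro!: exI[of _ "Suc n"] exI[of _ "\<lambda>k. if k = n then 1 else 0"] simp del: sum.lessThan_Suc)
qed

lemma closed_orbit_span_least:
  assumes M: "csub V M" and "\<And>n. (T ^^ n) h \<in> M"
  shows "closed_orbit_span V T h \<subseteq> M"
proof
  fix g assume g: "g \<in> closed_orbit_span V T h"
  show "g \<in> M"
  proof (rule csub_closed[OF M])
    show "g \<in> l2 V" using g by (simp add: closed_orbit_span_def)
    fix e :: real assume "e > 0"
    then obtain N c where "l2norm V (\<lambda>x. g x - (\<Sum>n<N. c n * (T ^^ n) h x)) < e"
      using g unfolding closed_orbit_span_def by blast
    moreover have "(\<lambda>x. \<Sum>n<N. c n * (T ^^ n) h x) \<in> M"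
      by (intro csub_sum[OF M] assms)
    ultimately show "\<exists>g'\<in>M. l2norm V (\<lambda>x. g x - g' x) < e"
      by (intro bexI[of _ "\<lambda>x. \<Sum>n<N. c n * (T ^^ n) h x"])
  qed
qed

lemma cyclic_vector_csub_eq:
  assumes "cyclic_vector V T h" "csub V M" "\<And>n. (T ^^ n) h \<in> M"
  shows "M = l2 V"
  using closed_orbit_span_least[OF assms(2,3)] assms(1,2)
  by (auto simp: cyclic_vector_closed_orbit_span csub_def)

text \<open>The closed span of the orbit is itself such a subspace \<open>M\<close>: its preimage
  under \<open>T\<close> is closed and contains the orbit, so the span is invariant. Containing all
  basis vectors, it is everything.\<close>

lemma cyclic_vectorI:
  assumes T: "blin V V T" and h: "h \<in> l2 V"
    and all: "\<And>M v. csub V M \<Longrightarrow> (\<And>f. f \<in> M \<Longrightarrow> T f \<in> M) \<Longrightarrow> h \<in> M \<Longrightarrow> v \<in> V \<Longrightarrow> delta v \<in> M"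
  shows "cyclic_vector V T h"
proof -
  let ?M = "closed_orbit_span V T h"
  have M: "csub V ?M" by (rule csub_closed_orbit_span[OF T h])
  have "?M \<subseteq> {f \<in> l2 V. T f \<in> ?M}"
  proof (rule closed_orbit_span_least[OF csub_vimage[OF T M]])
    fix n show "(T ^^ n) h \<in> {f \<in> l2 V. T f \<in> ?M}"
      using orbit_in_closed_orbit_span[OF T h, of "Suc n"] blin_power_l2[OF T h] by simp
  qed
  then have inv: "T f \<in> ?M" if "f \<in> ?M" for f using that by blast
  have "?M = l2 V"
    by (rule csub_eq_l2[OF M all[OF M inv]]) (use orbit_in_closed_orbit_span[OF T h, of 0] in auto)
  then show ?thesis using h by (simp add: cyclic_vector_closed_orbit_span)
qed

lemma csub_invariant_power:
  assumes "\<And>f. f \<in> M \<Longrightarrow> T f \<in> M" "f \<in> M"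
  shows "(T ^^ n) f \<in> M"
  by (induction n) (auto intro: assms)

text \<open>The preimage of a closed invariant subspace under an intertwining map is closed and
  contains the orbit of \<open>h\<close>, hence is all of \<open>l2 V\<close>; hitting the basis
  vectors gives \<open>X\<close> dense range. Applied to quotient maps, diagonal maps whose inverse
  may be unbounded, relabelings, and \<open>W\<close> itself.\<close>

lemma cyclic_vector_image:
  assumes X: "blin V W X" and T: "blin V V T" and T': "blin W W T'"
    and comm: "\<And>f. f \<in> l2 V \<Longrightarrow> X (T f) = T' (X f)"
    and cyc: "cyclic_vector V T h"
    and ran: "\<And>w. w \<in> W \<Longrightarrow> \<exists>f\<in>l2 V. X f = delta w"
  shows "cyclic_vector W T' (X h)"
proof (rule cyclic_vectorI[OF T'])
  have h: "h \<in> l2 V" using cyc by (simp add: cyclic_vector_def)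
  show "X h \<in> l2 W" using X h by (rule blin_l2)
  fix M w assume M: "csub W M" "\<And>f. f \<in> M \<Longrightarrow> T' f \<in> M" "X h \<in> M" and w: "w \<in> W"
  have "{f \<in> l2 V. X f \<in> M} = l2 V"
  proof (rule cyclic_vector_csub_eq[OF cyc csub_vimage[OF X M(1)]])
    fix n
    have "X ((T ^^ n) h) = (T' ^^ n) (X h)" using intertwine_power[of V T X T' h n] T comm h by blast
    also have "\<dots> \<in> M" using M by (intro csub_invariant_power)
    finally show "(T ^^ n) h \<in> {f \<in> l2 V. X f \<in> M}" using blin_power_l2[OF T h] by simp
  qed
  then have "X f \<in> M" if "f \<in> l2 V" for f using that by (metis (no_types, lifting) mem_Collect_eq)
  then show "delta w \<in> M" using ran[OF w] by metis
qed

section \<open>Shifts on a fork\<close>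

abbreviation pshift :: "'a set \<Rightarrow> ('a \<Rightarrow> 'a) \<Rightarrow> ('a \<Rightarrow> real) \<Rightarrow> ('a \<Rightarrow> complex) \<Rightarrow> ('a \<Rightarrow> complex)" where
  "pshift V p lam \<equiv> wcomp V (\<lambda>v. complex_of_real (lam v)) p"

text \<open>\<open>Inl\<close> is the trunk, \<open>Inr\<close> the side branch. Since the side
  branch starts with \<open>Inr 1\<close>, attached at \<open>Inl 0\<close>, equal numbers mean
  equal distance from the branching vertex.\<close>

fun fpar :: "int + nat \<Rightarrow> int + nat" where
  "fpar (Inl n) = Inl (n - 1)"
| "fpar (Inr j) = (if j \<le> 1 then Inl 0 else Inr (j - 1))"

definition fork_V :: "int set \<Rightarrow> nat set \<Rightarrow> (int + nat) set" where
  "fork_V I J = Inl ` I \<union> Inr ` J"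

lemma fork_V_iff [simp]: "Inl n \<in> fork_V I J \<longleftrightarrow> n \<in> I" "Inr j \<in> fork_V I J \<longleftrightarrow> j \<in> J"
  by (auto simp: fork_V_def)

lemma fibres_le2_fpar:
  assumes "J \<subseteq> {1..}"
  shows "fibres_le2 (fork_V I J) fpar"
  unfolding fibres_le2_def
proof
  fix x
  obtain a b where ab: "{y \<in> fork_V I J. fpar y = x} \<subseteq> {a, b}"
  proof (cases x)
    case (Inl n)
    have "{y \<in> fork_V I J. fpar y = x} \<subseteq> {Inl (n + 1), Inr 1}"
      using assms Inl by (auto simp: fork_V_def split: if_splits)
    then show ?thesis by (rule that)
  next
    case (Inr j)
    have "{y \<in> fork_V I J. fpar y = x} \<subseteq> {Inr (j + 1), Inr (j + 1)}"
      using assms Inr by (auto simp: fork_V_def split: if_splits)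
    then show ?thesis by (rule that)
  qed
  have "card {a, b} \<le> 2" by (simp add: card_insert_if)
  then show "finite {y \<in> fork_V I J. fpar y = x} \<and> card {y \<in> fork_V I J. fpar y = x} \<le> 2"
    using card_mono[OF _ ab] finite_subset[OF ab] by simp
qed

text \<open>\<open>J_I\<close> breaks the symmetry between the two branches: the trunk reaches at
  least as far as the side branch, so that \<open>lift\<close> reads only existing
  coordinates.\<close>

locale fork =
  fixes I :: "int set" and J :: "nat set" and lam :: "int + nat \<Rightarrow> real" and C :: real
  assumes I_down: "n \<in> I \<Longrightarrow> n - 1 \<in> I"
    and J_pos: "J \<subseteq> {1..}" and J_1: "1 \<in> J"
    and J_down: "j \<in> J \<Longrightarrow> 1 < j \<Longrightarrow> j - 1 \<in> J"
    and J_I: "j \<in> J \<Longrightarrow> int j \<in> I"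
    and lam_pos: "v \<in> fork_V I J \<Longrightarrow> 0 < lam v"
    and lam_le: "v \<in> fork_V I J \<Longrightarrow> lam v \<le> C"
begin

definition "T = pshift (fork_V I J) fpar lam"

definition "W = pshift I (\<lambda>n. n - 1) (\<lambda>n. lam (Inl n))"

definition "P = wcomp I (\<lambda>_. 1) (Inl :: int \<Rightarrow> int + nat)"

lemma zero_I: "0 \<in> I"
  using I_down[OF J_I[OF J_1]] by simp

lemma fpar_V: "v \<in> fork_V I J \<Longrightarrow> fpar v \<in> fork_V I J"
  using I_down J_down zero_I by (cases v) auto

lemma blin_T: "blin (fork_V I J) (fork_V I J) T"
  unfolding T_def
  by (rule blin_wcomp[where C = C, OF _ _ fibres_le2_fpar[OF J_pos]])
    (use lam_pos lam_le fpar_V in \<open>auto simp: less_imp_le abs_of_pos\<close>)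

lemma blin_W: "blin I I W"
  unfolding W_def
  by (rule blin_wcomp[where C = C]) (use lam_pos lam_le I_down in \<open>auto simp: less_imp_le abs_of_pos intro!: fibres_le2_inj inj_onI\<close>)

lemma blin_P: "blin (fork_V I J) I P"
  unfolding P_def
  by (rule blin_wcomp[where C = 1]) (auto intro!: fibres_le2_inj)

text \<open>The trunk is closed under taking parents, so the values on it evolve without influence
  from the side branch; \<open>W\<close> is thus a quotient of \<open>T\<close>.\<close>

lemma P_T: "P (T f) = W (P f)"
  using I_down by (auto simp: P_def T_def W_def wcomp_def fun_eq_iff)

lemma cyclic_W_if_cyclic_T:
  assumes "cyclic_vector (fork_V I J) T h"
  shows "cyclic_vector I W (P h)"
proof (rule cyclic_vector_image[OF blin_P blin_T blin_W P_T assms])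
  fix n assume "n \<in> I"
  then have "P (delta (Inl n)) = delta n" "delta (Inl n) \<in> l2 (fork_V I J)"
    by (auto simp: P_def wcomp_def delta_def fun_eq_iff intro!: delta_l2[unfolded delta_def])
  then show "\<exists>f\<in>l2 (fork_V I J). P f = delta n" by blast
qed

lemma W_delta: "n \<in> I \<Longrightarrow> W (delta (n - 1)) = (\<lambda>k. lam (Inl n) * delta n k)"
  by (auto simp: W_def wcomp_def delta_def fun_eq_iff)

lemma T_delta_Inr:
  assumes "1 \<le> j"
  shows "T (delta (Inr j)) = (\<lambda>v. (if Suc j \<in> J then lam (Inr (Suc j)) else 0) * delta (Inr (Suc j)) v)"
proof
  fix v show "T (delta (Inr j)) v = (if Suc j \<in> J then lam (Inr (Suc j)) else 0) * delta (Inr (Suc j)) v"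
    using assms J_pos by (cases v) (auto simp: T_def wcomp_def delta_def)
qed

lemma delta_Inr_in:
  assumes M: "csub (fork_V I J) M" and inv: "\<And>f. f \<in> M \<Longrightarrow> T f \<in> M"
    and 1: "delta (Inr 1) \<in> M" and j: "j \<in> J"
  shows "delta (Inr j) \<in> M"
proof -
  have "1 \<le> j" using j J_pos by auto
  then show ?thesis using j
  proof (induction j rule: nat_induct_at_least)
    case base
    then show ?case using 1 by simp
  next
    case (Suc j)
    have "j \<in> J" using J_down[OF Suc.prems] Suc.hyps by simp
    then have "T (delta (Inr j)) \<in> M" using Suc by (intro inv) auto
    then have "(\<lambda>v. lam (Inr (Suc j)) * delta (Inr (Suc j)) v) \<in> M"
      using Suc.prems by (simp add: T_delta_Inr[OF Suc.hyps])
    from csub_scale[OF M this, of "1 / lam (Inr (Suc j))"] show ?case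
      using lam_pos[of "Inr (Suc j)"] Suc.prems by simp
  qed
qed

text \<open>The indices start at 2 because the first move out of \<open>Inr 1\<close> picks up the
  weight of \<open>Inr 2\<close>. The zero case makes the orbit end when \<open>J\<close> is
  finite.\<close>

lemma T_power_delta_Inr_1:
  "(T ^^ n) (delta (Inr 1))
    = (\<lambda>v. (if Suc n \<in> J then \<Prod>i<n. lam (Inr (i + 2)) else 0) * delta (Inr (Suc n)) v)"
proof (induction n)
  case 0
  then show ?case using J_1 by simp
next
  case (Suc n)
  have d: "delta (Inr (Suc n)) \<in> l2 (fork_V I J)" if "Suc n \<in> J" using that by (intro delta_l2) simp
  show ?case
  proof (cases "Suc n \<in> J")
    case True
    have "(T ^^ Suc n) (delta (Inr 1)) = T (\<lambda>v. (\<Prod>i<n. lam (Inr (i + 2))) * delta (Inr (Suc n)) v)"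
      using True Suc by simp
    also have "\<dots> = (\<lambda>v. (\<Prod>i<n. lam (Inr (i + 2))) * T (delta (Inr (Suc n))) v)"
      using blin_scale[OF blin_T d[OF True], of "complex_of_real (\<Prod>i<n. lam (Inr (i + 2)))"] by simp
    also have "\<dots> = (\<lambda>v. (if Suc (Suc n) \<in> J then \<Prod>i<Suc n. lam (Inr (i + 2)) else 0) * delta (Inr (Suc (Suc n))) v)"
      using T_delta_Inr[of "Suc n"] by (simp add: numeral_2_eq_2 fun_eq_iff)
    finally show ?thesis .
  next
    case False
    moreover from this have "Suc (Suc n) \<notin> J" using J_down[of "Suc (Suc n)"] by auto
    ultimately show ?thesis using Suc blin_zero[OF blin_T] by simp
  qed
qed

text \<open>The range is the graph of a map from the trunk to the side branch: \<open>Inr j\<close>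
  receives \<open>\<beta> j\<close> times the trunk value at the same level. On \<open>l2 I\<close>
  the projection \<open>P\<close> undoes \<open>lift\<close>.\<close>

definition lift :: "(nat \<Rightarrow> real) \<Rightarrow> (int \<Rightarrow> complex) \<Rightarrow> (int + nat \<Rightarrow> complex)" where
  "lift \<beta> = wcomp (fork_V I J) (\<lambda>v. case v of Inl _ \<Rightarrow> 1 | Inr j \<Rightarrow> complex_of_real (\<beta> j))
     (\<lambda>v. case v of Inl n \<Rightarrow> n | Inr j \<Rightarrow> int j)"

lemma blin_lift:
  assumes "\<And>j. j \<in> J \<Longrightarrow> \<bar>\<beta> j\<bar> \<le> K"
  shows "blin I (fork_V I J) (lift \<beta>)"
  unfolding lift_def
proof (rule blin_wcomp[where C = "max 1 K"])
  let ?r = "\<lambda>v. case v of Inl n \<Rightarrow> n | Inr j \<Rightarrow> int j"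
  show "?r ` fork_V I J \<subseteq> I" using J_I by (auto simp: fork_V_def)
  show "fibres_le2 (fork_V I J) ?r" unfolding fibres_le2_def
  proof
    fix n
    have ab: "{y \<in> fork_V I J. ?r y = n} \<subseteq> {Inl n, Inr (nat n)}" by (auto simp: fork_V_def)
    then show "finite {y \<in> fork_V I J. ?r y = n} \<and> card {y \<in> fork_V I J. ?r y = n} \<le> 2"
      using card_mono[OF _ ab] finite_subset[OF ab] by simp
  qed
  fix v assume "v \<in> fork_V I J"
  then show "cmod (case v of Inl _ \<Rightarrow> 1 | Inr j \<Rightarrow> complex_of_real (\<beta> j)) \<le> max 1 K"
    using assms by (cases v) (auto simp: le_max_iff_disj)
qed

text \<open>The recursion for \<open>\<beta>\<close> is the intertwining relation read off at
  \<open>Inr j\<close>; \<open>\<beta> 0 = 1\<close> covers \<open>j = 1\<close>, whose parent lies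
  on the trunk.\<close>

lemma lift_W:
  assumes "\<beta> 0 = 1" "\<And>j. j \<in> J \<Longrightarrow> \<beta> j * lam (Inl (int j)) = lam (Inr j) * \<beta> (j - 1)"
  shows "lift \<beta> (W f) = T (lift \<beta> f)"
proof
  fix v show "lift \<beta> (W f) v = T (lift \<beta> f) v"
  proof (cases v)
    case (Inl n)
    then show ?thesis using I_down by (auto simp: lift_def W_def T_def wcomp_def)
  next
    case (Inr j)
    show ?thesis
    proof (cases "j \<in> J")
      case True
      then have j: "1 \<le> j" "int j \<in> I" using J_pos J_I by auto
      have "lift \<beta> (W f) v = of_real (\<beta> j * lam (Inl (int j))) * f (int j - 1)"
        using True Inr j by (simp add: lift_def W_def wcomp_def)
      also have "\<dots> = of_real (lam (Inr j) * \<beta> (j - 1)) * f (int j - 1)"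
        by (simp only: assms(2)[OF True])
      also have "\<dots> = T (lift \<beta> f) v"
        using True Inr j zero_I assms(1) J_down[OF True]
        by (cases "j = 1") (auto simp: lift_def T_def wcomp_def of_nat_diff)
      finally show ?thesis .
    qed (simp add: Inr lift_def T_def wcomp_def)
  qed
qed

text \<open>\<open>lift \<beta> (delta n)\<close> differs from \<open>delta (Inl n)\<close> by a
  multiple of one side basis vector at most, so the graph and the side branch together span
  everything.\<close>

lemma csub_fill:
  assumes M: "csub (fork_V I J) M" and inv: "\<And>f. f \<in> M \<Longrightarrow> T f \<in> M"
    and 1: "delta (Inr 1) \<in> M" and A: "\<And>f. f \<in> l2 I \<Longrightarrow> lift \<beta> f \<in> M" and v: "v \<in> fork_V I J"
  shows "delta v \<in> M"
proof (cases v)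
  case (Inr j)
  then show ?thesis using v by (auto intro: delta_Inr_in[OF M inv 1])
next
  case (Inl n)
  then have n: "n \<in> I" using v by simp
  have L: "lift \<beta> (delta n) \<in> M" using n by (intro A delta_l2)
  show ?thesis
  proof (cases "n > 0 \<and> nat n \<in> J")
    case True
    have "delta v = (\<lambda>w. lift \<beta> (delta n) w - \<beta> (nat n) * delta (Inr (nat n)) w)"
    proof
      fix w show "delta v w = lift \<beta> (delta n) w - \<beta> (nat n) * delta (Inr (nat n)) w"
        using True n Inl by (cases w) (auto simp: lift_def wcomp_def delta_def)
    qed
    also have "\<dots> \<in> M"
      using True by (intro csub_diff[OF M] csub_scale[OF M] L delta_Inr_in[OF M inv 1]) auto
    finally show ?thesis .
  next
    case False
    have "delta v = lift \<beta> (delta n)"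
    proof
      fix w show "delta v w = lift \<beta> (delta n) w"
        using False n Inl J_pos by (cases w) (auto simp: lift_def wcomp_def delta_def)
    qed
    then show ?thesis using L by simp
  qed
qed

lemma cyclic_T_if_cyclic_W:
  assumes fin: "finite J" and x: "cyclic_vector I W x"
  shows "\<exists>h. cyclic_vector (fork_V I J) T h"
proof -
  \<comment> \<open>The solution of the recursion in \<open>lift_W\<close>. It is bounded because
    \<open>J\<close> is finite.\<close>
  define \<beta> where "\<beta> j = (\<Prod>i=1..j. lam (Inr i) / lam (Inl (int i)))" for j
  have b0: "\<beta> 0 = 1" by (simp add: \<beta>_def)
  have b: "\<beta> j * lam (Inl (int j)) = lam (Inr j) * \<beta> (j - 1)" if j: "j \<in> J" for j
  proof -
    obtain k where k: "j = Suc k" using j J_pos by (cases j) force+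
    have "lam (Inl (int j)) > 0" using j J_I by (intro lam_pos) auto
    then show ?thesis unfolding k \<beta>_def by simp
  qed
  have "\<bar>\<beta> j\<bar> \<le> Max ((\<lambda>j. \<bar>\<beta> j\<bar>) ` J)" if "j \<in> J" for j using fin that by simp
  note A = blin_lift[OF this]
  note AW = lift_W[of \<beta>, OF b0 b]
  have xl: "x \<in> l2 I" using x by (simp add: cyclic_vector_def)
  have d1: "delta (Inr 1) \<in> l2 (fork_V I J)" using J_1 by (intro delta_l2) simp
  \<comment> \<open>\<open>T ^^ q\<close> kills the side component of \<open>h\<close> but keeps its
    graph component.\<close>
  obtain q where q: "j \<le> q" if "j \<in> J" for j using fin by (meson Max_ge)
  have nil: "(T ^^ q) (delta (Inr 1)) = (\<lambda>_. 0)"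
    using q[of "Suc q"] unfolding T_power_delta_Inr_1 by auto
  define h where "h = (\<lambda>v. lift \<beta> x v + delta (Inr 1) v)"
  have Ax: "lift \<beta> x \<in> l2 (fork_V I J)" using A xl by (rule blin_l2)
  have hl: "h \<in> l2 (fork_V I J)" unfolding h_def by (rule l2_add[OF Ax d1])
  \<comment> \<open>\<open>W\<close> reaches a multiple of every basis vector, so it preserves
    cyclicity of vectors; replacing \<open>x\<close> by \<open>(W ^^ q) x\<close> loses
    nothing.\<close>
  have Wx: "cyclic_vector I W ((W ^^ n) x)" for n
  proof (induction n)
    case (Suc n)
    show ?case unfolding funpow.simps o_apply
    proof (rule cyclic_vector_image[OF blin_W blin_W blin_W refl Suc])
      fix n assume n: "n \<in> I"
      have "W (\<lambda>k. (1 / lam (Inl n)) * delta (n - 1) k) = (\<lambda>k. (1 / lam (Inl n)) * W (delta (n - 1)) k)"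
        using blin_scale[OF blin_W delta_l2(1)[OF I_down[OF n]], of "1 / complex_of_real (lam (Inl n))"] by simp
      then have "W (\<lambda>k. (1 / lam (Inl n)) * delta (n - 1) k) = delta n"
        using lam_pos[of "Inl n"] n by (simp add: W_delta[OF n])
      then show "\<exists>f\<in>l2 I. W f = delta n"
        using l2_scale[OF delta_l2(1)[OF I_down[OF n]]] by blast
    qed
  qed (use x in simp)
  have "cyclic_vector (fork_V I J) T h"
  proof (rule cyclic_vectorI[OF blin_T hl])
    fix M v assume M: "csub (fork_V I J) M" "\<And>f. f \<in> M \<Longrightarrow> T f \<in> M" "h \<in> M" and v: "v \<in> fork_V I J"
    have "(T ^^ q) h = (\<lambda>v. (T ^^ q) (lift \<beta> x) v + (T ^^ q) (delta (Inr 1)) v)"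
      unfolding h_def by (rule blin_power_add[OF blin_T Ax d1])
    also have "\<dots> = (T ^^ q) (lift \<beta> x)" unfolding nil by simp
    also have "\<dots> = lift \<beta> ((W ^^ q) x)"
      by (rule intertwine_power[of I W "lift \<beta>" T x, OF blin_W AW xl, symmetric])
    finally have q_in: "lift \<beta> ((W ^^ q) x) \<in> M"
      using csub_invariant_power[of M T h q, OF M(2,3)] by simp
    have "{f \<in> l2 I. lift \<beta> f \<in> M} = l2 I"
    proof (rule cyclic_vector_csub_eq[OF Wx csub_vimage[OF A M(1)]])
      fix n
      have l: "(W ^^ q) x \<in> l2 I" using blin_W xl by (rule blin_power_l2)
      have "lift \<beta> ((W ^^ n) ((W ^^ q) x)) = (T ^^ n) (lift \<beta> ((W ^^ q) x))"
        by (rule intertwine_power[of I W "lift \<beta>" T, OF blin_W AW l])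
      also have "\<dots> \<in> M" by (rule csub_invariant_power[of M T, OF M(2) q_in])
      finally show "(W ^^ n) ((W ^^ q) x) \<in> {f \<in> l2 I. lift \<beta> f \<in> M}"
        using blin_power_l2[OF blin_W l] by simp
    qed
    then have AM: "lift \<beta> f \<in> M" if "f \<in> l2 I" for f
      using that by (metis (no_types, lifting) mem_Collect_eq)
    have "delta (Inr 1) = (\<lambda>v. h v - lift \<beta> x v)" by (simp add: h_def)
    also have "\<dots> \<in> M" by (intro csub_diff[OF M(1)] M(3) AM xl)
    finally have d: "delta (Inr 1) \<in> M" .
    show "delta v \<in> M" by (rule csub_fill[of M \<beta>, OF M(1,2) d AM v])
  qed
  then show ?thesis by blast
qed

end

section \<open>Weighted shifts on chains\<close>

lemma l2_geometric:
  fixes f :: "nat \<Rightarrow> complex"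
  assumes "\<And>m. cmod (f m) \<le> K * (1/2) ^ m"
  shows "f \<in> l2 UNIV" and "l2norm UNIV f \<le> 2 * K"
proof -
  have "0 \<le> K" using assms[of 0] order_trans[OF norm_ge_zero] by fastforce
  have *: "L2_set (\<lambda>x. cmod (f x)) F \<le> 2 * K" if fin: "finite F" for F
  proof -
    obtain N where N: "F \<subseteq> {..<N}" using fin finite_nat_iff_bounded by auto
    have "L2_set (\<lambda>x. cmod (f x)) F \<le> (\<Sum>m\<in>F. cmod (f m))"
      by (rule L2_set_le_sum) auto
    also have "\<dots> \<le> (\<Sum>m\<in>F. K * (1/2) ^ m)" by (rule sum_mono[OF assms])
    also have "\<dots> \<le> (\<Sum>m<N. K * (1/2) ^ m)"
      using N \<open>0 \<le> K\<close> by (intro sum_mono2) auto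
    also have "\<dots> = K * ((1 - (1/2) ^ N) / (1/2))"
      by (simp add: sum_gp_strict flip: sum_distrib_left)
    also have "\<dots> \<le> K * 2"
      using \<open>0 \<le> K\<close> by (intro mult_left_mono) auto
    finally show ?thesis by simp
  qed
  show "f \<in> l2 UNIV" by (rule l2I(1)[OF _ *]) auto
  show "l2norm UNIV f \<le> 2 * K" by (rule l2I(2)[OF _ *]) auto
qed

lemma blin_backward_shift:
  assumes "\<And>m. 0 < w m" "\<And>m. w m \<le> (C :: real)"
  shows "blin UNIV UNIV (pshift UNIV Suc w)"
  by (rule blin_wcomp[where C = C]) (use assms in \<open>auto simp: less_imp_le abs_of_pos intro: fibres_le2_inj\<close>)

text \<open>The entries of \<open>h\<close> decay so fast that each \<open>T^k h\<close> is
  dominated by its first entry. Normalised orbit vectors therefore converge to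
  \<open>delta 0\<close>, and after removal of the first \<open>i\<close> coordinates to
  \<open>delta i\<close>.\<close>

lemma backward_shift_cyclic:
  assumes w: "\<And>m. 0 < w m" "\<And>m. w m \<le> (C :: real)"
  shows "\<exists>h. cyclic_vector UNIV (pshift UNIV Suc w) h"
proof -
  let ?T = "pshift UNIV Suc w"
  note T = blin_backward_shift[of w C, OF w]
  \<comment> \<open>The gauge: as \<open>w m * c (Suc m) = c m\<close>, dividing coordinates by
    \<open>c\<close> turns the operator into the unweighted backward shift.\<close>
  define c where "c m = 1 / (\<Prod>i<m. w i)" for m
  have wp: "(\<Prod>i<m. w i) > 0" for m using w by (simp add: prod_pos)
  have c: "c m > 0" "w m * c (Suc m) = c m" for m
    using wp[of m] w(1)[of m] by (auto simp: c_def)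
  \<comment> \<open>The quotients of consecutive entries of \<open>x\<close>. The sum absorbs every
    factor \<open>c m\<close> with \<open>m \<le> k\<close>, and the power of 2 leaves the geometric
    decay stated in \<open>key\<close>.\<close>
  define d where "d k = 2 ^ k * (1 + (\<Sum>l\<le>k. c l))" for k :: nat
  have d1: "d k \<ge> 1" for k
  proof -
    have "1 * 1 \<le> (2 :: real) ^ k * (1 + (\<Sum>l\<le>k. c l))"
      using c(1) by (intro mult_mono) (auto simp: sum_nonneg less_imp_le)
    then show ?thesis by (simp add: d_def)
  qed
  define x where "x n = (\<Prod>k\<in>{1..n}. 1 / d k)" for n
  have x_pos: "x n > 0" for n unfolding x_def using d1 by (intro prod_pos) (auto intro: less_le_trans[OF zero_less_one])
  have x_Suc: "x (Suc n) = x n / d (Suc n)" for n by (simp add: x_def)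
  have x_dec: "x (n + k) \<le> x n" for n k
  proof (induction k)
    case (Suc k)
    have "x (Suc (n + k)) \<le> x (n + k)"
      unfolding x_Suc using d1[of "Suc (n + k)"] x_pos[of "n + k"] by (simp add: divide_le_eq mult_left_le)
    with Suc show ?case by simp
  qed simp
  have key: "c m * x N \<le> x n * (1/2) ^ N" if "n < N" "m \<le> N" for m n N
  proof -
    obtain k where k: "N = Suc (n + k)" using \<open>n < N\<close> less_imp_Suc_add by blast
    have "c m \<le> 1 + (\<Sum>l\<le>N. c l)"
      using member_le_sum[of m "{..N}" c] c(1) that by (auto simp: less_imp_le add_increasing)
    then have "c m / d N \<le> (1/2) ^ N"
      using d1[of N] unfolding d_def by (simp add: divide_le_eq power_one_over)
    then have "c m * x N \<le> (1/2) ^ N * x (n + k)"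
      using x_pos[of "n + k"] mult_right_mono[of "c m / d N" "(1/2)^N" "x (n + k)"] unfolding k x_Suc by simp
    also have "\<dots> \<le> (1/2) ^ N * x n" using x_dec by (intro mult_left_mono) auto
    finally show ?thesis by (simp add: mult.commute)
  qed
  define h where "h m = complex_of_real (c m * x m)" for m
  have h: "h \<in> l2 UNIV"
  proof (rule l2_geometric(1))
    fix m show "cmod (h m) \<le> 1 * (1/2) ^ m"
    proof (cases m)
      case 0 then show ?thesis by (simp add: h_def c_def x_def)
    next
      case (Suc k)
      then show ?thesis using key[of 0 m m] c(1)[of m] x_pos[of m]
        by (simp add: h_def x_def[of 0] abs_mult abs_of_pos norm_mult)
    qed
  qed
  have Tn: "(?T ^^ n) h m = complex_of_real (c m * x (m + n))" for n m
  proof (induction n arbitrary: m)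
    case (Suc n)
    have "(?T ^^ Suc n) h m = complex_of_real (w m) * (?T ^^ n) h (Suc m)"
      by (simp add: wcomp_def[of _ _ _ "(?T ^^ n) h"])
    also have "\<dots> = complex_of_real (w m * c (Suc m) * x (Suc m + n))"
      unfolding Suc by simp
    finally show ?case using c(2)[of m] by simp
  qed (simp add: h_def)
  have "cyclic_vector UNIV ?T h"
  proof (rule cyclic_vectorI[OF T h])
    fix M i assume M: "csub UNIV M" "\<And>f. f \<in> M \<Longrightarrow> ?T f \<in> M" "h \<in> M"
    show "delta i \<in> M"
    proof (induction i rule: less_induct)
      case (less i)
      \<comment> \<open>The entries of the \<open>k\<close>-th orbit vector are
        \<open>c m * x (m + k)\<close>: those below \<open>i\<close> are subtracted by the induction
        hypothesis, the one at \<open>i\<close> is normalised to 1, and \<open>key\<close> makes the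
        rest tend to 0.\<close>
      define g where "g k = (\<lambda>m. 1 / complex_of_real (c i * x (i + k)) *
          ((?T ^^ k) h m - (\<Sum>l<i. (?T ^^ k) h l * delta l m)))" for k
      have gM: "g k \<in> M" for k
        unfolding g_def using less
        by (intro csub_scale[OF M(1)] csub_diff[OF M(1)] csub_sum[OF M(1)] csub_invariant_power[of M ?T, OF M(2,3)]) auto
      have le: "cmod (delta i m - g k m) \<le> (1 / c i) * (1/2) ^ k * (1/2) ^ m" for k m
      proof -
        have s: "(\<Sum>l<i. (?T ^^ k) h l * delta l m) = (if m < i then (?T ^^ k) h m else 0)"
          by (simp add: delta_def if_distrib[of "\<lambda>z. _ * z"] cong: if_cong)
        have gk: "g k m = 1 / complex_of_real (c i * x (i + k)) * (if m < i then 0 else complex_of_real (c m * x (m + k)))"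
          unfolding g_def s by (simp add: Tn)
        have nz: "c i * x (i + k) > 0" using c x_pos by simp
        consider "m < i" | "m = i" | "m > i" by linarith
        then show ?thesis
        proof cases
          case 3
          then have "cmod (delta i m - g k m) = c m * x (m + k) / (c i * x (i + k))"
            unfolding gk using c(1)[of m] c(1)[of i] x_pos
            by (simp add: delta_def norm_mult norm_divide abs_of_pos)
          also have "\<dots> \<le> x (i + k) * (1/2) ^ (m + k) / (c i * x (i + k))"
            using key[of "i + k" "m + k" m] 3 nz by (intro divide_right_mono) auto
          also have "\<dots> = (1 / c i) * (1/2) ^ k * (1/2) ^ m"
            using x_pos[of "i + k"] by (simp add: power_add)
          finally show ?thesis .
        qed (unfold gk, use nz c(1)[of i] in \<open>auto simp: delta_def\<close>)
      qed
      show ?case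
      proof (rule csub_tendsto[where g = g, OF M(1) _ gM])
        show "delta i \<in> l2 UNIV" by (rule delta_l2) simp
        have le': "norm (l2norm UNIV (\<lambda>m. delta i m - g k m)) \<le> 2 * ((1 / c i) * (1/2) ^ k)" for k
          using l2_geometric(2)[OF le] by simp
        have "(\<lambda>k. 2 * ((1 / c i) * (1/2) ^ k)) \<longlonglongrightarrow> 2 * ((1 / c i) * 0)"
          by (intro tendsto_intros LIMSEQ_realpow_zero) auto
        then have lim: "(\<lambda>k. 2 * ((1 / c i) * (1/2) ^ k)) \<longlonglongrightarrow> 0" by simp
        show "(\<lambda>k. l2norm UNIV (\<lambda>m. delta i m - g k m)) \<longlonglongrightarrow> 0"
          by (rule Lim_null_comparison[OF _ lim]) (rule always_eventually, rule allI, rule le')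
      qed
    qed
  qed
  then show ?thesis by blast
qed

text \<open>Numbering the chain downwards from its leaf \<open>p\<close> turns it into a backward
  weighted shift on the natural numbers.\<close>

lemma backward_chain_cyclic:
  fixes p :: int
  assumes w: "\<And>n. n \<le> p \<Longrightarrow> 0 < w n" "\<And>n. n \<le> p \<Longrightarrow> w n \<le> (C :: real)"
  shows "\<exists>h. cyclic_vector {..p} (pshift {..p} (\<lambda>n. n - 1) w) h"
proof -
  define w' where "w' m = w (p - int m)" for m
  have w': "0 < w' m" "w' m \<le> C" for m using w by (auto simp: w'_def)
  obtain h where h: "cyclic_vector UNIV (pshift UNIV Suc w') h" using backward_shift_cyclic[of w' C] w' by auto
  let ?X = "wcomp {..p} (\<lambda>_. 1) (\<lambda>n. nat (p - n))"
  have "cyclic_vector {..p} (pshift {..p} (\<lambda>n. n - 1) w) (?X h)"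
  proof (rule cyclic_vector_image[OF _ _ _ _ h])
    show "blin UNIV {..p} ?X"
      by (rule blin_wcomp[where C = 1]) (auto intro!: fibres_le2_inj inj_onI)
    show "blin UNIV UNIV (pshift UNIV Suc w')" by (rule blin_backward_shift[of w' C, OF w'])
    show "blin {..p} {..p} (pshift {..p} (\<lambda>n. n - 1) w)"
      by (rule blin_wcomp[where C = C]) (use w in \<open>auto simp: less_imp_le abs_of_pos intro!: fibres_le2_inj inj_onI\<close>)
    show "?X (pshift UNIV Suc w' f) = pshift {..p} (\<lambda>n. n - 1) w (?X f)" for f
    proof
      fix n
      have "nat (p - (n - 1)) = Suc (nat (p - n))" if "n \<le> p" using that by simp
      then show "?X (pshift UNIV Suc w' f) n = pshift {..p} (\<lambda>n. n - 1) w (?X f) n"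
        by (auto simp: wcomp_def w'_def)
    qed
    fix n assume "n \<in> {..p}"
    then have "?X (delta (nat (p - n))) = delta n" by (auto simp: wcomp_def delta_def fun_eq_iff)
    then show "\<exists>f\<in>l2 UNIV. ?X f = delta n" using delta_l2(1)[of "nat (p - n)" UNIV] by blast
  qed
  then show ?thesis by blast
qed

text \<open>Multiplication by \<open>\<gamma>\<close> intertwines the unweighted bilateral shift
  with the weighted one. The product formulas on both half-lines are what later bounds
  \<open>\<gamma>\<close> from above or below.\<close>

lemma bilateral_gauge:
  fixes w :: "int \<Rightarrow> real"
  assumes "\<And>n. 0 < w n"
  obtains \<gamma> :: "int \<Rightarrow> real" where "\<And>n. 0 < \<gamma> n" "\<And>n. \<gamma> n = w n * \<gamma> (n - 1)" "\<gamma> 0 = 1"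
    "\<And>k. \<gamma> (int k) = (\<Prod>i<k. w (1 + int i))" "\<And>k. \<gamma> (- int k) = 1 / (\<Prod>i<k. w (- int i))"
proof -
  define \<gamma> where "\<gamma> n = (if n \<ge> 0 then \<Prod>i<nat n. w (1 + int i) else 1 / (\<Prod>i<nat (-n). w (- int i)))" for n
  have "0 < \<gamma> n" for n using assms by (auto simp: \<gamma>_def intro!: prod_pos divide_pos_pos)
  moreover have "\<gamma> 0 = 1" "\<gamma> (int k) = (\<Prod>i<k. w (1 + int i))" "\<gamma> (- int k) = 1 / (\<Prod>i<k. w (- int i))" for k
    by (auto simp: \<gamma>_def)
  moreover have "\<gamma> n = w n * \<gamma> (n - 1)" for n
  proof (cases "n \<ge> 1")
    case True
    then obtain k where "n = int (Suc k)" by (metis One_nat_def nonneg_int_cases of_nat_le_iff of_nat_1 Suc_le_D zero_le_one order_trans)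
    then show ?thesis by (simp add: \<gamma>_def nat_add_distrib)
  next
    case False
    then obtain k where k: "n = - int k" by (metis nonpos_int_cases int_one_le_iff_zero_less not_less)
    then have n: "n - 1 = - int (Suc k)" by simp
    show ?thesis unfolding n unfolding k calculation(4) using assms[of "- int k"] by simp
  qed
  ultimately show ?thesis using that by blast
qed

text \<open>The gauge is bounded: by 1 on the forward half-line as the weights are at most 1, by
  \<open>1 / \<delta>\<close> on the backward one. So the diagonal map by \<open>\<gamma>\<close>
  transports the cyclic vector of the unweighted shift.\<close>

lemma bilateral_cyclic_if_backward_products:
  fixes w :: "int \<Rightarrow> real"
  assumes w: "\<And>n. 0 < w n" "\<And>n. w n \<le> 1" and \<delta>: "0 < \<delta>" "\<And>k. \<delta> \<le> (\<Prod>i<k. w (- int i))"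
    and U: "cyclic_vector UNIV (pshift UNIV (\<lambda>n :: int. n - 1) (\<lambda>_. 1)) h"
  shows "\<exists>h. cyclic_vector UNIV (pshift UNIV (\<lambda>n. n - 1) w) h"
proof -
  obtain \<gamma> where \<gamma>: "\<And>n. 0 < \<gamma> n" "\<And>n. \<gamma> n = w n * \<gamma> (n - 1)" "\<gamma> 0 = 1"
    "\<And>k. \<gamma> (int k) = (\<Prod>i<k. w (1 + int i))" "\<And>k. \<gamma> (- int k) = 1 / (\<Prod>i<k. w (- int i))"
    using bilateral_gauge[of w] w(1) by blast
  have bd: "\<gamma> n \<le> max 1 (1 / \<delta>)" for n
  proof (cases "n \<ge> 0")
    case True
    then obtain k where "n = int k" by (metis nonneg_int_cases)
    then show ?thesis using w by (auto simp: \<gamma>(4) less_imp_le intro!: prod_le_1 max.coboundedI1)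
  next
    case False
    then obtain k where "n = - int k" by (metis nonpos_int_cases linear)
    moreover have "1 / (\<Prod>i<k. w (- int i)) \<le> 1 / \<delta>" using \<delta> by (intro divide_left_mono) (auto simp: w prod_pos)
    ultimately show ?thesis by (auto simp: \<gamma>(5) intro!: max.coboundedI2)
  qed
  let ?X = "wcomp UNIV (\<lambda>n. complex_of_real (\<gamma> n)) id"
  have X: "blin UNIV UNIV ?X"
    by (rule blin_wcomp[where C = "max 1 (1 / \<delta>)"]) (use bd \<gamma>(1) in \<open>auto simp: abs_of_pos intro: fibres_le2_inj\<close>)
  have "cyclic_vector UNIV (pshift UNIV (\<lambda>n. n - 1) w) (?X h)"
  proof (rule cyclic_vector_image[OF X _ _ _ U])
    show "blin UNIV UNIV (pshift UNIV (\<lambda>n :: int. n - 1) (\<lambda>_. 1))"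
      by (rule blin_wcomp[where C = 1]) (auto intro!: fibres_le2_inj inj_onI)
    show "blin UNIV UNIV (pshift UNIV (\<lambda>n. n - 1) w)"
      by (rule blin_wcomp[where C = 1]) (use w in \<open>auto simp: less_imp_le abs_of_pos intro!: fibres_le2_inj inj_onI\<close>)
    show "?X (pshift UNIV (\<lambda>n. n - 1) (\<lambda>_. 1) f) = pshift UNIV (\<lambda>n. n - 1) w (?X f)" for f
    proof
      fix n
      show "?X (pshift UNIV (\<lambda>n. n - 1) (\<lambda>_. 1) f) n = pshift UNIV (\<lambda>n. n - 1) w (?X f) n"
        using arg_cong[OF \<gamma>(2)[of n], of complex_of_real] by (simp add: wcomp_def)
    qed
    fix n
    have "?X (\<lambda>k. (1 / \<gamma> n) * delta n k) = delta n"
      using \<gamma>(1)[of n] by (auto simp: wcomp_def delta_def fun_eq_iff)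
    then show "\<exists>f\<in>l2 UNIV. ?X f = delta n" using l2_scale[OF delta_l2(1)[of n UNIV]] by blast
  qed
  then show ?thesis by blast
qed

section \<open>Absence of cyclic vectors\<close>

lemma fpar_power_Inl: "(fpar ^^ n) (Inl k) = Inl (k - int n)"
  by (induction n) auto

lemma fpar_power_Inr:
  "1 \<le> j \<Longrightarrow> (fpar ^^ n) (Inr j) = (if n < j then Inr (j - n) else Inl (int j - int n))"
  by (induction n) (auto simp: not_less Suc_diff_Suc of_nat_diff intro!: arg_cong[where f = Inr])

text \<open>Both sums are the coefficient at \<open>-n\<close> of the product of the series of
  \<open>f\<close> and \<open>g\<close>; the substitution of \<open>n - k\<close> for
  \<open>k\<close> exchanges them.\<close>

lemma infsum_two_sided_convolution_antisym:
  fixes f g :: "int \<Rightarrow> complex"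
  assumes f: "f \<in> l2 UNIV" and g: "g \<in> l2 UNIV"
  shows "(\<Sum>\<^sub>\<infinity>k\<in>UNIV. g (- k) * f (k - n) - f (- k) * g (k - n)) = 0"
proof -
  have "fibres_le2 UNIV (uminus :: int \<Rightarrow> int)" "fibres_le2 UNIV (\<lambda>k :: int. k - n)"
    by (auto intro!: fibres_le2_inj inj_onI)
  then have r: "(\<lambda>k. u (- k)) \<in> l2 UNIV" "(\<lambda>k. u (k - n)) \<in> l2 UNIV" if u: "u \<in> l2 UNIV" for u :: "int \<Rightarrow> complex"
    using blin_l2[OF blin_wcomp[where C = 1 and m = "\<lambda>_. 1" and r = uminus] u, of UNIV]
      blin_l2[OF blin_wcomp[where C = 1 and m = "\<lambda>_. 1" and r = "\<lambda>k. k - n"] u, of UNIV]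
    by (auto simp: wcomp_def)
  have s: "(\<lambda>k. u (- k) * v (k - n)) summable_on UNIV"
    if "u \<in> l2 UNIV" "v \<in> l2 UNIV" for u v :: "int \<Rightarrow> complex"
    using l2_mult_summable(1)[OF r(1)[OF that(1)] r(2)[OF that(2)]] by (rule abs_summable_summable)
  have "bij_betw (\<lambda>k. n - k) UNIV (UNIV :: int set)"
    by (rule bij_betwI[where g = "\<lambda>k. n - k"]) auto
  from infsum_reindex_bij_betw[OF this, of "\<lambda>k. f (- k) * g (k - n)"]
  have "(\<Sum>\<^sub>\<infinity>k\<in>UNIV. f (- k) * g (k - n)) = (\<Sum>\<^sub>\<infinity>k\<in>UNIV. g (- k) * f (k - n))"
    by (simp add: mult.commute)
  then show "(\<Sum>\<^sub>\<infinity>k\<in>UNIV. g (- k) * f (k - n) - f (- k) * g (k - n)) = 0"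
    using infsum_add[OF s[OF g f] iffD2[OF summable_on_uminus s[OF f g]]] by (simp add: infsum_uminus)
qed

text \<open>The lower bounds on the forward products make division by the gauge bounded. After this
  rescaling a nonzero vector orthogonal to the orbit is written down, unless \<open>h\<close>
  vanishes at all negative trunk vertices, which also excludes cyclicity.\<close>

lemma not_cyclic_vector_two_sided_fork:
  fixes lam :: "int + nat \<Rightarrow> real"
  defines "V \<equiv> fork_V UNIV {1..}"
  assumes lam: "\<And>v. v \<in> V \<Longrightarrow> 0 < lam v" "\<And>v. v \<in> V \<Longrightarrow> lam v \<le> 1"
    and \<delta>: "0 < \<delta>" "\<And>k. \<delta> \<le> (\<Prod>i<k. lam (Inl (1 + int i)))" "\<And>k. \<delta> \<le> (\<Prod>i<k. lam (Inr (1 + i)))"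
  shows "\<not> cyclic_vector V (pshift V fpar lam) h"
proof
  let ?T = "pshift V fpar lam"
  assume cyc: "cyclic_vector V ?T h"
  then have hl: "h \<in> l2 V" by (simp add: cyclic_vector_def)
  interpret fork UNIV "{1..}" lam 1
    using lam by unfold_locales (auto simp: V_def)
  have T: "blin V V ?T" using blin_T unfolding T_def V_def .
  obtain \<gamma> where \<gamma>: "\<And>n. 0 < \<gamma> n" "\<And>n. \<gamma> n = lam (Inl n) * \<gamma> (n - 1)" "\<gamma> 0 = 1"
    "\<And>k. \<gamma> (int k) = (\<Prod>i<k. lam (Inl (1 + int i)))" "\<And>k. \<gamma> (- int k) = 1 / (\<Prod>i<k. lam (Inl (- int i)))"
    using bilateral_gauge[of "\<lambda>n. lam (Inl n)"] lam(1) unfolding V_def by (metis UNIV_I fork_V_iff(1))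
  \<comment> \<open>The gauge of the fork, normalised at \<open>Inl 0\<close>. In the coordinates
    \<open>x = h / c\<close> the shift becomes plain composition with \<open>fpar\<close>.\<close>
  define c where "c v = (case v of Inl n \<Rightarrow> \<gamma> n | Inr j \<Rightarrow> \<Prod>i<j. lam (Inr (1 + i)))" for v
  have c_rec: "c v = lam v * c (fpar v)" if v: "v \<in> V" for v
  proof (cases v)
    case (Inl n) then show ?thesis using \<gamma>(2)[of n] by (simp add: c_def)
  next
    case (Inr j)
    then obtain i where "j = Suc i" using v by (cases j) (auto simp: V_def)
    then show ?thesis using Inr \<gamma>(3) by (auto simp: c_def)
  qed
  \<comment> \<open>The 1 in the minimum takes care of the negative trunk vertices, where the gauge
    is the inverse of a product of weights at most 1.\<close>
  define \<delta>' where "\<delta>' = min 1 \<delta>"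
  have \<delta>': "\<delta>' > 0" using \<delta> by (simp add: \<delta>'_def)
  have c_ge: "\<delta>' \<le> c v" for v
  proof (cases v)
    case (Inr j) then show ?thesis using \<delta>(3)[of j] by (simp add: c_def \<delta>'_def)
  next
    case (Inl n)
    show ?thesis
    proof (cases "n \<ge> 0")
      case True
      then obtain k where "n = int k" by (metis nonneg_int_cases)
      then show ?thesis using \<delta>(2)[of k] Inl by (simp add: c_def \<delta>'_def \<gamma>(4))
    next
      case False
      then obtain k where k: "n = - int k" by (metis nonpos_int_cases linear)
      have "(\<Prod>i<k. lam (Inl (- int i))) \<le> 1" "0 < (\<Prod>i<k. lam (Inl (- int i)))"
        using lam by (auto intro!: prod_le_1 prod_pos simp: V_def less_imp_le)
      then have "1 \<le> 1 / (\<Prod>i<k. lam (Inl (- int i)))" by simp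
      then show ?thesis using Inl k by (simp add: c_def \<delta>'_def \<gamma>(5))
    qed
  qed
  have c_pos: "c v > 0" for v using c_ge \<delta>' by (rule less_le_trans[rotated])
  have inv_c: "cmod (1 / complex_of_real (c v)) \<le> 1 / \<delta>'" for v
    using c_ge[of v] c_pos[of v] \<delta>' by (simp add: norm_divide frac_le)
  have fpar_V: "(fpar ^^ n) v \<in> V" if "v \<in> V" for n v
    using that fpar_V by (induction n) (auto simp: V_def)
  define x where "x = wcomp V (\<lambda>v. 1 / complex_of_real (c v)) id h"
  have xl: "x \<in> l2 V" unfolding x_def
    by (rule blin_l2[OF blin_wcomp hl], rule inv_c) (auto intro: fibres_le2_inj)
  have hx: "h v = c v * x v" if "v \<in> V" for v
    using that c_pos[of v] by (simp add: x_def wcomp_def)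
  have Tn: "(?T ^^ n) h v = c v * x ((fpar ^^ n) v)" if "v \<in> V" for n v
    using that
  proof (induction n arbitrary: v)
    case (Suc n)
    have "(?T ^^ Suc n) h v = lam v * (?T ^^ n) h (fpar v)"
      using Suc.prems by (simp add: wcomp_def[of _ _ _ "(?T ^^ n) h"])
    also have "\<dots> = complex_of_real (lam v * c (fpar v)) * x ((fpar ^^ Suc n) v)"
      using Suc.IH[of "fpar v"] fpar_V[OF Suc.prems, of 1] by (simp add: funpow_swap1)
    finally show ?case using c_rec[OF Suc.prems] by simp
  qed (simp add: hx)
  define f where "f = wcomp UNIV (\<lambda>_. 1) (Inl :: int \<Rightarrow> int + nat) x"
  have fl: "f \<in> l2 UNIV" unfolding f_def
    by (rule blin_l2[OF blin_wcomp[where C = 1] xl]) (auto simp: V_def intro: fibres_le2_inj)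
  have f: "f k = x (Inl k)" for k by (simp add: f_def wcomp_def)
  \<comment> \<open>The difference of the two branches. It vanishes at \<open>k \<le> 0\<close>,
    where the branches coincide, and so carries the unilateral component; along every path from the
    side branch the value of \<open>x\<close> is \<open>f + g\<close>.\<close>
  define g where "g k = (if k \<ge> 1 then x (Inr (nat k)) - x (Inl k) else 0)" for k :: int
  have gl: "g \<in> l2 UNIV"
  proof -
    have 1: "wcomp UNIV (\<lambda>k :: int. if k \<ge> 1 then 1 else 0) (\<lambda>k. if k \<ge> 1 then Inr (nat k) else Inl k) x \<in> l2 UNIV"
      by (rule blin_l2[OF blin_wcomp[where C = 1] xl])
        (auto simp: V_def intro!: fibres_le2_inj inj_onI split: if_splits)
    have 2: "wcomp UNIV (\<lambda>k :: int. if k \<ge> 1 then 1 else 0) Inl x \<in> l2 UNIV"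
      by (rule blin_l2[OF blin_wcomp[where C = 1] xl]) (auto simp: V_def intro: fibres_le2_inj)
    have "g = (\<lambda>k. wcomp UNIV (\<lambda>k :: int. if k \<ge> 1 then 1 else 0) (\<lambda>k. if k \<ge> 1 then Inr (nat k) else Inl k) x k
        - wcomp UNIV (\<lambda>k :: int. if k \<ge> 1 then 1 else 0) Inl x k)"
      by (auto simp: g_def wcomp_def fun_eq_iff)
    then show ?thesis using l2_diff[OF 1 2] by simp
  qed
  have x_Inr: "x ((fpar ^^ n) (Inr j)) = f (int j - int n) + g (int j - int n)" if "1 \<le> j" for n j
    using that by (auto simp: fpar_power_Inr f g_def nat_diff_distrib' of_nat_diff)
  \<comment> \<open>The vector \<open>(g, - f)\<close>, reflected by \<open>k \<mapsto> - k\<close>,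
    transported back to vertices. The values \<open>f (- k)\<close> at trunk vertices
    \<open>k \<ge> 1\<close> cancel the \<open>f\<close> part of \<open>f + g\<close> on the side
    branch, leaving the antisymmetric convolution sum.\<close>
  define z where "z v = (case v of Inl k \<Rightarrow> if k \<ge> 1 then f (- k) else g (- k)
      | Inr j \<Rightarrow> if j \<ge> 1 then - f (- int j) else 0)" for v
  have zl: "z \<in> l2 V"
  proof -
    let ?r = "\<lambda>v. case v of Inl k \<Rightarrow> - k | Inr j \<Rightarrow> - int j"
    have fib: "fibres_le2 V ?r" unfolding fibres_le2_def
    proof
      fix n
      have ab: "{y \<in> V. ?r y = n} \<subseteq> {Inl (- n), Inr (nat (- n))}" by (auto simp: V_def fork_V_def)
      then show "finite {y \<in> V. ?r y = n} \<and> card {y \<in> V. ?r y = n} \<le> 2"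
        using card_mono[OF _ ab] finite_subset[OF ab] by simp
    qed
    have 1: "wcomp V (\<lambda>v. case v of Inl k \<Rightarrow> if k \<ge> 1 then 1 else 0 | Inr j \<Rightarrow> -1) ?r f \<in> l2 V"
      by (rule blin_l2[OF blin_wcomp[where C = 1, OF _ _ fib] fl]) (auto split: sum.split)
    have 2: "wcomp V (\<lambda>v. case v of Inl k \<Rightarrow> if k \<ge> 1 then 0 else 1 | Inr j \<Rightarrow> 0) ?r g \<in> l2 V"
      by (rule blin_l2[OF blin_wcomp[where C = 1, OF _ _ fib] gl]) (auto split: sum.split)
    have "z = (\<lambda>v. wcomp V (\<lambda>v. case v of Inl k \<Rightarrow> if k \<ge> 1 then 1 else 0 | Inr j \<Rightarrow> -1) ?r f v
       + wcomp V (\<lambda>v. case v of Inl k \<Rightarrow> if k \<ge> 1 then 0 else 1 | Inr j \<Rightarrow> 0) ?r g v)"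
      by (auto simp: z_def wcomp_def V_def fun_eq_iff split: sum.split)
    then show ?thesis using l2_add[OF 1 2] by simp
  qed
  \<comment> \<open>Division by \<open>c\<close> cancels the factor \<open>c v\<close> in
    \<open>Tn\<close>, and the conjugate undoes the one in \<open>l2inner\<close>.\<close>
  define y where "y = wcomp V (\<lambda>v. 1 / complex_of_real (c v)) id (\<lambda>v. cnj (z v))"
  have yl: "y \<in> l2 V" unfolding y_def
    by (rule blin_l2[OF blin_wcomp l2_cnj(1)[OF zl]], rule inv_c) (auto intro: fibres_le2_inj)
  have orth: "l2inner V ((?T ^^ n) h) y = 0" for n
  proof -
    define s where "s v = x ((fpar ^^ n) v) * z v" for v
    have eq: "(?T ^^ n) h v * cnj (y v) = s v" if "v \<in> V" for v
      using that c_pos[of v] by (simp add: Tn y_def wcomp_def s_def)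
    have sum: "s summable_on V"
      using l2inner_summable[OF blin_power_l2[OF T hl] yl, of n]
      by (subst (asm) summable_on_cong[OF eq]) auto
    have V_Un: "V = range Inl \<union> Inr ` {1..}" by (auto simp: V_def fork_V_def)
    have sl: "s summable_on range Inl" and sr: "s summable_on Inr ` {1..}"
      using sum by (auto intro: summable_on_subset_banach simp: V_Un)
    define s1 where "s1 k = s (Inl k)" for k
    define s2 where "s2 k = (if k \<ge> 1 then s (Inr (nat k)) else 0)" for k :: int
    have bl: "bij_betw Inl UNIV (range (Inl :: int \<Rightarrow> int + nat))" by (rule bij_betw_imageI) auto
    have br: "bij_betw (\<lambda>k. Inr (nat k)) {1..} (Inr ` {1 :: nat..} :: (int + nat) set)"
      by (rule bij_betwI[where g = "\<lambda>v. int (projr v)"]) auto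
    have s1: "s1 summable_on UNIV" "infsum s (range Inl) = infsum s1 UNIV"
      using sl summable_on_reindex_bij_betw[OF bl, of s] infsum_reindex_bij_betw[OF bl, of s]
      by (auto simp: s1_def[abs_def])
    have "s2 summable_on UNIV \<longleftrightarrow> (\<lambda>k. s (Inr (nat k))) summable_on {1..}"
      by (rule summable_on_cong_neutral) (auto simp: s2_def)
    moreover have "infsum s2 UNIV = (\<Sum>\<^sub>\<infinity>k\<in>{1..}. s (Inr (nat k)))"
      by (rule infsum_cong_neutral) (auto simp: s2_def)
    ultimately have s2: "s2 summable_on UNIV" "infsum s (Inr ` {1..}) = infsum s2 UNIV"
      using sr summable_on_reindex_bij_betw[OF br, of s] infsum_reindex_bij_betw[OF br, of s] by auto
    have "l2inner V ((?T ^^ n) h) y = infsum s V"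
      unfolding l2inner_def by (rule infsum_cong[OF eq])
    also have "\<dots> = infsum s (range Inl) + infsum s (Inr ` {1..})"
      unfolding V_Un by (rule infsum_Un_disjoint[OF sl sr]) auto
    also have "\<dots> = (\<Sum>\<^sub>\<infinity>k\<in>UNIV. s1 k + s2 k)"
      unfolding s1(2) s2(2) by (rule infsum_add[OF s1(1) s2(1), symmetric])
    also have "\<dots> = (\<Sum>\<^sub>\<infinity>k\<in>UNIV. g (- k) * f (k - int n) - f (- k) * g (k - int n))"
    proof (rule infsum_cong)
      fix k :: int
      show "s1 k + s2 k = g (- k) * f (k - int n) - f (- k) * g (k - int n)"
      proof (cases "k \<ge> 1")
        case True
        then obtain j where j: "k = int j" "1 \<le> j"
          by (metis nonneg_int_cases of_nat_1 of_nat_le_iff order_trans zero_le_one)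
        have e2: "s2 k = - (f (k - int n) + g (k - int n)) * f (- k)"
          using x_Inr[OF j(2), of n] j by (simp add: s2_def s_def z_def algebra_simps)
        have e1: "s1 k = f (k - int n) * f (- k)" "g (- k) = 0"
          using True by (simp_all add: s1_def s_def fpar_power_Inl z_def f g_def)
        show ?thesis unfolding e1 e2 by (simp add: algebra_simps)
      qed (auto simp: s1_def s2_def s_def fpar_power_Inl z_def g_def[of "k - int n"] mult.commute simp flip: f)
    qed
    also have "\<dots> = 0" by (rule infsum_two_sided_convolution_antisym[OF fl gl])
    finally show ?thesis .
  qed
  have "csub V {u \<in> l2 V. l2inner V u y = 0}"
    using cmod_l2inner_le[OF _ yl]
    by (intro csub_kernel[where K = "l2norm V y"] l2inner_add_scaled_left yl) (simp_all add: mult.commute)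
  then have "{u \<in> l2 V. l2inner V u y = 0} = l2 V"
    by (rule cyclic_vector_csub_eq[OF cyc]) (use orth blin_power_l2[OF T hl] in auto)
  then have "y \<in> {u \<in> l2 V. l2inner V u y = 0}" using yl by (rule ssubst)
  then have "l2inner V y y = 0" by simp
  then have "l2norm V y = 0" by (simp add: l2inner_self[OF yl])
  then have "y = (\<lambda>_. 0)" by (rule l2norm_eq_0_imp[OF yl])
  then have "y v = 0" for v by simp
  then have z0: "z v = 0" if "v \<in> V" for v
    using that c_pos[of v] unfolding y_def wcomp_def by (metis complex_cnj_zero_iff divide_eq_0_iff id_apply less_irrefl mult_eq_0_iff of_real_eq_0_iff one_neq_zero)
  \<comment> \<open>With \<open>z = 0\<close>, its values on the side branch say that
    \<open>f\<close> vanishes at all negative integers. Then no orbit vector sees the vertex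
    \<open>Inl (- 1)\<close>.\<close>
  have x0: "x (Inl (- int j)) = 0" if "1 \<le> j" for j
    using z0[of "Inr j"] that by (simp add: z_def V_def f)
  let ?e = "Inl (- 1) :: int + nat"
  have "csub V {u \<in> l2 V. u ?e = 0}"
    by (rule csub_kernel[where K = 1]) (auto intro: cmod_le_l2norm)
  then have "{u \<in> l2 V. u ?e = 0} = l2 V"
  proof (rule cyclic_vector_csub_eq[OF cyc])
    fix n
    have "(?T ^^ n) h ?e = 0"
      using Tn[of ?e n] x0[of "Suc n"] by (simp add: V_def fpar_power_Inl)
    then show "(?T ^^ n) h \<in> {u \<in> l2 V. u ?e = 0}" using blin_power_l2[OF T hl] by simp
  qed
  moreover have "delta ?e \<in> l2 V" by (rule delta_l2) (simp add: V_def)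
  ultimately have "delta ?e \<in> {u \<in> l2 V. u ?e = 0}" by (rule ssubst)
  then show False by (simp add: delta_def)
qed

section \<open>Polynomials that are small on the circle away from 1\<close>

text \<open>Splits the Fejer kernel into its constant and the real part of a polynomial without
  constant term. Where the left side is small, that real part must be strongly negative.\<close>

lemma fejer_identity:
  fixes z :: complex
  assumes z: "cmod z = 1"
  shows "(cmod (\<Sum>k<s. z ^ k))\<^sup>2 = real s + 2 * Re (\<Sum>i<s. \<Sum>k=1..i. z ^ k)"
proof (induction s)
  case (Suc s)
  have zz: "z * cnj z = 1" using z complex_norm_square[of z] by simp
  have "(\<Sum>k<s. z ^ k) * cnj (z ^ s) = (\<Sum>k<s. cnj z ^ (s - k))"
    unfolding sum_distrib_right
  proof (rule sum.cong)
    fix k assume "k \<in> {..<s}"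
    then have "cnj z ^ s = cnj z ^ k * cnj z ^ (s - k)" by (simp flip: power_add)
    then show "z ^ k * cnj (z ^ s) = cnj z ^ (s - k)"
      using zz by (simp add: mult.assoc[symmetric] power_mult_distrib[symmetric])
  qed simp
  also have "\<dots> = (\<Sum>k=1..s. cnj z ^ k)"
    by (rule sum.reindex_bij_witness[where i = "\<lambda>k. s - k" and j = "\<lambda>k. s - k"]) auto
  finally have 1: "Re ((\<Sum>k<s. z ^ k) * cnj (z ^ s)) = Re (\<Sum>k=1..s. z ^ k)"
    by (simp flip: cnj_sum complex_cnj_power)
  have 2: "(cmod (a + b))\<^sup>2 = (cmod a)\<^sup>2 + (cmod b)\<^sup>2 + 2 * Re (a * cnj b)" for a b
    unfolding cmod_power2 by (simp add: power2_eq_square algebra_simps)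
  have 3: "(cmod (z ^ s))\<^sup>2 = 1" using z by (simp add: norm_power)
  show ?case unfolding sum.lessThan_Suc 2 1 3 Suc by simp
qed simp

text \<open>If \<open>w\<close> vanishes at 0 and has real part at least \<open>1/2\<close> on the
  arc, a small step from 1 in the direction \<open>- w\<close> decreases the modulus on the arc and
  keeps the value at 0.\<close>

lemma exists_small_poly_value_1_at_0:
  assumes e: "0 < e"
  obtains r :: "complex poly" and \<rho> :: real where "coeff r 0 = 1" "0 \<le> \<rho>" "\<rho> < 1"
    "\<And>z. cmod z = 1 \<Longrightarrow> e \<le> cmod (z - 1) \<Longrightarrow> cmod (poly r z) \<le> \<rho>"
proof -
  obtain s :: nat where s: "8 / e\<^sup>2 < real s" using reals_Archimedean2 by blast
  then have s0: "s > 0" using e by (metis divide_pos_pos less_numeral_extra(3) of_nat_0_less_iff zero_less_numeral zero_less_power less_trans)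
  \<comment> \<open>By \<open>fejer_identity\<close>, on the circle the real part of
    \<open>w\<close> is 1 minus the squared geometric sum over \<open>s\<close>. That square is at
    most \<open>4 / e^2\<close>, so \<open>s > 8 / e^2\<close> gives real part at least
    \<open>1/2\<close>.\<close>
  define w :: "complex poly" where "w = smult (- 2 / of_nat s) (\<Sum>i<s. \<Sum>k=1..i. monom 1 k)"
  have w: "poly w z = (- 2 / of_nat s) * (\<Sum>i<s. \<Sum>k=1..i. z ^ k)" for z
    by (simp add: w_def poly_sum poly_monom)
  have w0: "coeff w 0 = 0" by (simp add: w_def coeff_sum)
  have Re_w: "1/2 \<le> Re (poly w z)" if z: "cmod z = 1" "e \<le> cmod (z - 1)" for z
  proof -
    have "z \<noteq> 1" using z e by auto
    then have "cmod (\<Sum>k<s. z ^ k) = cmod (1 - z ^ s) / cmod (1 - z)"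
      by (simp add: sum_gp_strict norm_divide)
    also have "\<dots> \<le> 2 / e"
    proof (rule frac_le)
      show "cmod (1 - z ^ s) \<le> 2" using norm_triangle_ineq4[of 1 "z ^ s"] z by (simp add: norm_power)
    qed (use e z in \<open>auto simp: norm_minus_commute\<close>)
    finally have "(cmod (\<Sum>k<s. z ^ k))\<^sup>2 \<le> (2 / e)\<^sup>2" by (rule power_mono) simp
    also have "\<dots> \<le> real s / 2" using s by (simp add: power_divide)
    finally have "real s + 2 * Re (\<Sum>i<s. \<Sum>k=1..i. z ^ k) \<le> real s / 2"
      unfolding fejer_identity[OF z(1)] .
    then have "2 * Re (\<Sum>i<s. \<Sum>k=1..i. z ^ k) \<le> - (real s / 2)" by simp
    then have "(1 / real s) * (real s / 2) \<le> (1 / real s) * (- 2 * Re (\<Sum>i<s. \<Sum>k=1..i. z ^ k))"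
      by (intro mult_left_mono) auto
    moreover have "Re (poly w z) = (1 / real s) * (- 2 * Re (\<Sum>i<s. \<Sum>k=1..i. z ^ k))"
    proof -
      have "poly w z = complex_of_real (- 2 / real s) * (\<Sum>i<s. \<Sum>k=1..i. z ^ k)"
        unfolding w by simp
      then show ?thesis by (simp only: times_complex.sel Re_complex_of_real Im_complex_of_real ) (simp add: algebra_simps)?
    qed
    ultimately show ?thesis using s0 by simp
  qed
  obtain B where B: "B > 0" "\<And>z. cmod z \<le> 1 \<Longrightarrow> cmod (poly w z) \<le> B"
    using poly_bound_exists[of 1 w] by blast
  define B' where "B' = B + 1"
  \<comment> \<open>With this step length the quadratic term is half of the linear gain:
    \<open>1 - d + d^2 * B'^2 = 1 - d / 2\<close>.\<close>
  define d where "d = 1 / (2 * B'\<^sup>2)"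
  have B': "B' \<ge> 1" using B by (simp add: B'_def)
  have d: "0 < d" "d \<le> 1/2" "d * B'\<^sup>2 = 1/2"
    using B' power_mono[of 1 B' 2] by (auto simp: d_def field_simps)
  define r where "r = 1 - smult (complex_of_real d) w"
  show ?thesis
  proof (rule that[of r "sqrt (1 - d / 2)"])
    show "coeff r 0 = 1" by (simp add: r_def w0)
    show "0 \<le> sqrt (1 - d / 2)" "sqrt (1 - d / 2) < 1" using d by auto
    fix z :: complex assume z: "cmod z = 1" "e \<le> cmod (z - 1)"
    have "(cmod (poly r z))\<^sup>2 = 1 - 2 * d * Re (poly w z) + d\<^sup>2 * (cmod (poly w z))\<^sup>2"
      unfolding cmod_power2 by (simp add: r_def power2_eq_square algebra_simps)
    also have "\<dots> \<le> 1 - 2 * d * (1/2) + d\<^sup>2 * B'\<^sup>2"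
    proof -
      have "(cmod (poly w z))\<^sup>2 \<le> B'\<^sup>2" using B(2)[of z] z by (intro power_mono) (auto simp: B'_def)
      then show ?thesis using Re_w[OF z] d by (intro add_mono diff_mono mult_left_mono) auto
    qed
    also have "\<dots> = 1 - d / 2" using d(3) by (simp add: power2_eq_square algebra_simps)
    finally show "cmod (poly r z) \<le> sqrt (1 - d / 2)" by (rule real_le_rsqrt)
  qed
qed

lemma exists_small_poly_flat_at_0:
  assumes n: "1 \<le> n"
  shows "\<exists>q :: complex poly. coeff q 0 = 1 \<and> (\<forall>k. 0 < k \<and> k < n \<longrightarrow> coeff q k = 0)
    \<and> (\<forall>z. cmod z = 1 \<and> 1 / real n \<le> cmod (z - 1) \<longrightarrow> cmod (poly q z) \<le> 1 / real n)"
proof -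
  obtain r :: "complex poly" and \<rho> :: real where r: "coeff r 0 = 1" "0 \<le> \<rho>" "\<rho> < 1"
    "\<And>z. cmod z = 1 \<Longrightarrow> 1 / real n \<le> cmod (z - 1) \<Longrightarrow> cmod (poly r z) \<le> \<rho>"
    using exists_small_poly_value_1_at_0[of "1 / real n"] n by auto
  have "isCont (\<lambda>u :: complex. 1 - (1 - u) ^ n) 0" by (intro continuous_intros)
  then obtain \<eta> where \<eta>: "\<eta> > 0" "\<And>u :: complex. cmod u < \<eta> \<Longrightarrow> cmod (1 - (1 - u) ^ n) < 1 / real n"
    using n unfolding continuous_at_eps_delta by (auto simp: dist_norm dest!: spec[of _ "1 / real n"])
  obtain m where m: "\<rho> ^ m < \<eta>" using real_arch_pow_inv[OF \<eta>(1) r(3)] by blast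
  \<comment> \<open>On the arc \<open>r ^ m\<close> is near 0, hence so is \<open>q\<close>. At 0
    the factor \<open>1 - r ^ m\<close> vanishes, so its \<open>n\<close>-th power has no
    coefficients below order \<open>n\<close>.\<close>
  define q where "q = 1 - (1 - r ^ m) ^ n"
  have "poly (1 - r ^ m) 0 = 0" using r(1) by (simp flip: poly_0_coeff_0)
  then have "[:0, 1:] dvd 1 - r ^ m" using poly_eq_0_iff_dvd[of "1 - r ^ m" 0] by simp
  then have "[:0, 1:] ^ n dvd (1 - r ^ m) ^ n" by (rule dvd_power_same)
  then obtain p where p: "(1 - r ^ m) ^ n = monom 1 n * p"
    by (auto simp: monom_altdef dvd_def)
  have c: "coeff q k = coeff 1 k" if "k < n" for k
    unfolding q_def p using that by (simp add: coeff_monom_mult)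
  have "coeff q 0 = 1" using c[of 0] n by simp
  moreover have "coeff q k = 0" if "0 < k" "k < n" for k using c[of k] that by simp
  moreover have "cmod (poly q z) \<le> 1 / real n" if "cmod z = 1" "1 / real n \<le> cmod (z - 1)" for z
  proof -
    have "cmod (poly r z ^ m) \<le> \<rho> ^ m" using r(4)[OF that] by (simp add: norm_power power_mono)
    then show ?thesis using \<eta>(2)[of "poly r z ^ m"] m by (simp add: q_def)
  qed
  ultimately show ?thesis by blast
qed

text \<open>Far from 1 the smallness of \<open>q n\<close> suffices. Within distance
  \<open>1 / n\<close> of 1 only the terms of \<open>F\<close> with index at least \<open>n\<close>
  survive, and their heights were chosen against the maximum of \<open>q n\<close>.\<close>

lemma exists_multiplier:
  fixes q :: "nat \<Rightarrow> complex poly"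
  assumes q: "\<And>n z. 1 \<le> n \<Longrightarrow> cmod z = 1 \<Longrightarrow> 1 / real n \<le> cmod (z - 1) \<Longrightarrow> cmod (poly (q n) z) \<le> 1 / real n"
  obtains F :: "complex \<Rightarrow> real" where "continuous_on UNIV F" "\<And>z. 0 \<le> F z" "\<And>z. F z \<le> 2"
    "\<And>z. z \<noteq> 1 \<Longrightarrow> 0 < F z"
    "\<And>n z. 1 \<le> n \<Longrightarrow> cmod z = 1 \<Longrightarrow> cmod (poly (q n) z) * F z \<le> 2 / real n + 2 * (1/2) ^ n"
proof -
  have "\<exists>B. B > 0 \<and> (\<forall>z. cmod z \<le> 1 \<longrightarrow> cmod (poly (q n) z) \<le> B)" for n
    using poly_bound_exists[of 1 "q n"] by blast
  then obtain B where B: "\<And>n. B n > 0" "\<And>n z. cmod z \<le> 1 \<Longrightarrow> cmod (poly (q n) z) \<le> B n" by metis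
  \<comment> \<open>The cumulative sum makes the bounds monotone, so a single \<open>M n\<close>
    controls all later terms.\<close>
  define M where "M n = 1 + (\<Sum>k\<le>n. B k)" for n
  have M: "M n \<ge> 1" "B n \<le> M n" for n
    using B(1) member_le_sum[of n "{..n}" B] by (auto simp: M_def sum_nonneg less_imp_le add_increasing)
  have M_mono: "M n \<le> M m" if "n \<le> m" for n m
    unfolding M_def using that B(1) by (intro add_left_mono sum_mono2) (auto simp: less_imp_le)
  \<comment> \<open>A continuous cutoff of height \<open>(1/2)^n / M n\<close>: zero within distance
    \<open>1 / n\<close> of 1, constant beyond distance \<open>2 / n\<close>.\<close>
  define t where "t n z = (1/2) ^ n / M n * min 1 (max 0 (real n * cmod (z - 1) - 1))" for n z
  have t0: "0 \<le> t n z" for n z using M(1)[of n] by (auto simp: t_def)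
  have tM: "t n z \<le> (1/2) ^ n / M n" for n z
  proof -
    have "t n z \<le> (1/2) ^ n / M n * 1" unfolding t_def using M(1)[of n] by (intro mult_left_mono) auto
    then show ?thesis by simp
  qed
  have t1: "t n z \<le> (1/2) ^ n" for n z
    using tM[of n z] M(1)[of n] by (auto intro: order_trans simp: divide_le_eq mult_left_le)
  have sm: "summable (\<lambda>n. (1/2 :: real) ^ n)" by (intro summable_geometric) auto
  have st: "summable (\<lambda>n. t n z)" for z
    by (rule summable_comparison_test'[OF sm, of 0]) (use t0 t1 in auto)
  define F where "F z = (\<Sum>n. t n z)" for z
  show ?thesis
  proof (rule that[of F])
    have "continuous_on UNIV (t n)" for n
      unfolding t_def by (intro continuous_intros) (use M(1)[of n] in auto)
    then have ct: "continuous_on UNIV (\<lambda>z. \<Sum>i<n. t i z)" for n :: nat by (intro continuous_intros) auto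
    have "uniform_limit UNIV (\<lambda>n z. \<Sum>i<n. t i z) (\<lambda>z. \<Sum>i. t i z) sequentially"
      by (rule Weierstrass_m_test[OF _ sm]) (use t0 t1 in auto)
    then show "continuous_on UNIV F" unfolding F_def
      by (rule uniform_limit_theorem[rotated])
        (use ct in \<open>auto intro!: always_eventually\<close>)
    show "0 \<le> F z" for z unfolding F_def by (intro suminf_nonneg st t0)
    show "F z \<le> 2" for z
    proof -
      have "F z \<le> (\<Sum>n. (1/2) ^ n)" unfolding F_def by (intro suminf_le t1 st sm)
      then show ?thesis by (simp add: suminf_geometric)
    qed
    show "0 < F z" if "z \<noteq> 1" for z
    proof -
      have "cmod (z - 1) > 0" using that by simp
      then obtain n where "2 / cmod (z - 1) < real n" using reals_Archimedean2 by blast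
      then have "real n * cmod (z - 1) > 2" using \<open>cmod (z - 1) > 0\<close> by (simp add: field_simps)
      then have "t n z > 0" using M(1)[of n] by (auto simp: t_def)
      then show ?thesis unfolding F_def by (intro suminf_pos2[OF st t0])
    qed
    fix n z assume n: "(1 :: nat) \<le> n" and z: "cmod z = 1"
    show "cmod (poly (q n) z) * F z \<le> 2 / real n + 2 * (1/2) ^ n"
    proof (cases "1 / real n \<le> cmod (z - 1)")
      case True
      have "cmod (poly (q n) z) * F z \<le> (1 / real n) * 2"
        using q[OF n z True] \<open>F z \<le> 2\<close> \<open>0 \<le> F z\<close> by (intro mult_mono) auto
      then show ?thesis by (simp add: add_increasing2)
    next
      case False
      have "t k z = 0" if "k < n" for k
      proof -
        have "real k * cmod (z - 1) \<le> real n * cmod (z - 1)" using that by (intro mult_right_mono) auto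
        also have "\<dots> \<le> 1" using False n by (simp add: field_simps)
        finally show ?thesis by (simp add: t_def)
      qed
      then have "F z = (\<Sum>k. t (k + n) z)"
        unfolding F_def using suminf_split_initial_segment[OF st, of z n] by simp
      also have "\<dots> \<le> (\<Sum>k. (1/2) ^ n / M n * (1/2) ^ k)"
      proof (intro suminf_le summable_mult sm)
        show "summable (\<lambda>k. t (k + n) z)" using st by (subst summable_iff_shift)
        fix k
        have "t (k + n) z \<le> (1/2) ^ (k + n) / M (k + n)" by (rule tM)
        also have "\<dots> \<le> (1/2) ^ (k + n) / M n"
          using M_mono[of n "k + n"] M(1)[of n] by (intro divide_left_mono) auto
        finally show "t (k + n) z \<le> (1/2) ^ n / M n * (1/2) ^ k" by (simp add: power_add mult.commute)
      qed
      also have "\<dots> = (1/2) ^ n / M n * (\<Sum>k. (1/2) ^ k)" by (rule suminf_mult[OF sm])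
      also have "(\<Sum>k. (1/2 :: real) ^ k) = 2" by (simp add: suminf_geometric)
      finally have "cmod (poly (q n) z) * F z \<le> B n * ((1/2) ^ n / M n * 2)"
        using B(2)[of z n] z \<open>0 \<le> F z\<close> by (intro mult_mono) (auto simp: B(1) less_imp_le)
      also have "\<dots> \<le> M n * ((1/2) ^ n / M n * 2)" using M[of n] by (intro mult_right_mono) auto
      also have "\<dots> = 2 * (1/2) ^ n" using M(1)[of n] by simp
      finally show ?thesis by (simp add: add_increasing)
    qed
  qed
qed

section \<open>Fourier coefficients\<close>

definition fourier :: "(complex \<Rightarrow> complex) \<Rightarrow> int \<Rightarrow> complex" where
  "fourier F n = integral {0..2 * pi} (\<lambda>t. F (cis t) * cis (- (of_int n * t))) / (2 * pi)"

lemma fourier_has_integral: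
  assumes "continuous_on (sphere 0 1) F"
  shows "((\<lambda>t. F (cis t) * cis (- (of_int n * t))) has_integral (2 * pi * fourier F n)) {0..2 * pi}"
proof -
  have "continuous_on {0..2 * pi} (\<lambda>t. F (cis t) * cis (- (of_int n * t)))"
    by (intro continuous_intros continuous_on_compose2[OF assms]) auto
  then have "(\<lambda>t. F (cis t) * cis (- (of_int n * t))) integrable_on {0..2 * pi}"
    by (rule integrable_continuous_interval)
  then show ?thesis by (simp add: fourier_def integrable_integral)
qed

lemma fourier_eqI:
  fixes c :: complex
  assumes "((\<lambda>t. F (cis t) * cis (- (of_int n * t))) has_integral (2 * pi * c)) {0..2 * pi}"
  shows "fourier F n = c"
  using integral_unique[OF assms] by (simp add: fourier_def)

lemma fourier_add_scaled:
  assumes "continuous_on (sphere 0 1) F" "continuous_on (sphere 0 1) G"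
  shows "fourier (\<lambda>z. F z + a * G z) = (\<lambda>n. fourier F n + a * fourier G n)"
proof
  fix n show "fourier (\<lambda>z. F z + a * G z) n = fourier F n + a * fourier G n"
    by (rule fourier_eqI)
      (use has_integral_add[OF fourier_has_integral[OF assms(1), of n]
          has_integral_mult_right[OF fourier_has_integral[OF assms(2), of n], of a]]
        in \<open>simp add: algebra_simps\<close>)
qed

lemma fourier_diff:
  assumes "continuous_on (sphere 0 1) F" "continuous_on (sphere 0 1) G"
  shows "fourier (\<lambda>z. F z - G z) = (\<lambda>n. fourier F n - fourier G n)"
  using fourier_add_scaled[OF assms, of "-1"] by simp

lemma fourier_zero: "fourier (\<lambda>_. 0) = (\<lambda>_. 0)"
  by (simp add: fourier_def fun_eq_iff)

lemma fourier_sum: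
  assumes "\<And>i. i \<in> A \<Longrightarrow> continuous_on (sphere 0 1) (G i)"
  shows "fourier (\<lambda>z. \<Sum>i\<in>A. c i * G i z) = (\<lambda>n. \<Sum>i\<in>A. c i * fourier (G i) n)"
  using assms
proof (induction A rule: infinite_finite_induct)
  case (insert i A)
  have "fourier (\<lambda>z. (\<Sum>i\<in>A. c i * G i z) + c i * G i z)
      = (\<lambda>n. fourier (\<lambda>z. \<Sum>i\<in>A. c i * G i z) n + c i * fourier (G i) n)"
    by (rule fourier_add_scaled) (use insert.prems in \<open>auto intro!: continuous_intros\<close>)
  then show ?case using insert by (simp add: add.commute)
qed (simp_all add: fourier_zero)

text \<open>This identifies multiplication by \<open>z\<close> with the unweighted bilateral shift
  of coefficients.\<close>

lemma fourier_shift: "fourier (\<lambda>z. z powi k * F z) n = fourier F (n - k)"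
proof -
  have "cis t powi k * F (cis t) * cis (- (of_int n * t)) = F (cis t) * cis (- (of_int (n - k) * t))" for t
  proof -
    have "cis t powi k * cis (- (of_int n * t)) = cis (- (of_int (n - k) * t))"
      by (simp add: cis_power_int cis_mult algebra_simps)
    then show ?thesis by (metis mult.assoc mult.commute)
  qed
  then show ?thesis unfolding fourier_def by (simp only:)
qed

lemma continuous_on_powi_circle: "continuous_on (sphere 0 1) (\<lambda>z :: complex. z powi k)"
  by (intro continuous_intros) auto

lemma fourier_one: "fourier (\<lambda>_. 1) = delta 0"
proof
  fix n :: int
  show "fourier (\<lambda>_. 1) n = delta 0 n"
  proof (rule fourier_eqI, cases "n = 0")
    case True
    then show "((\<lambda>t. 1 * cis (- (of_int n * t))) has_integral (2 * pi * delta 0 n)) {0..2 * pi}"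
      using has_integral_const_real[of "1 :: complex" 0 "2 * pi"] by (simp add: delta_def scaleR_conv_of_real)
  next
    case False
    let ?c = "- (\<i> * of_int n)"
    have nz: "?c \<noteq> 0" using False by simp
    have "((\<lambda>t. exp (?c * of_real t) / ?c) has_vector_derivative exp (?c * of_real t)) (at t within {0..2 * pi})" for t
    proof (rule has_vector_derivative_real_field)
      show "((\<lambda>z. exp (?c * z) / ?c) has_field_derivative exp (?c * of_real t)) (at (complex_of_real t))"
        using nz by (auto intro!: derivative_eq_intros)
    qed
    then have int: "((\<lambda>t. exp (?c * of_real t)) has_integral
       (exp (?c * of_real (2 * pi)) / ?c - exp (?c * of_real 0) / ?c)) {0..2 * pi}"
      by (intro fundamental_theorem_of_calculus) auto
    have eq: "exp (?c * of_real t) = cis (- (of_int n * t))" for t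
      by (simp add: cis_conv_exp algebra_simps)
    have "cis (- (of_int n * (2 * pi))) = 1"
      using cis_multiple_2pi[of "of_int (- n)"] by (simp add: algebra_simps)
    then show "((\<lambda>t. 1 * cis (- (of_int n * t))) has_integral (2 * pi * delta 0 n)) {0..2 * pi}"
      using int False unfolding eq by (simp add: delta_def)
  qed
qed

lemma fourier_powi: "fourier (\<lambda>z. z powi k) = delta k"
proof
  fix n
  show "fourier (\<lambda>z. z powi k) n = delta k n"
    using fourier_shift[of k "\<lambda>_. 1" n] by (simp add: fourier_one delta_def)
qed

text \<open>Integrate the pointwise inequality expressing that the squared modulus of
  \<open>F - P\<close> is nonnegative, with \<open>P\<close> the partial Fourier sum over
  \<open>N\<close>; both integrals against \<open>cnj P\<close> equal \<open>2 * pi * S\<close>. The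
  bound by the supremum turns uniform estimates on the circle into \<open>l2\<close>
  estimates.\<close>

lemma bessel:
  assumes F: "continuous_on (sphere 0 1) F" and B: "\<And>z. cmod z = 1 \<Longrightarrow> cmod (F z) \<le> B"
  shows "fourier F \<in> l2 UNIV" and "l2norm UNIV (fourier F) \<le> B"
proof -
  have B0: "0 \<le> B" using B[of 1] norm_ge_zero[of "F 1"] by (simp del: norm_ge_zero)
  have *: "L2_set (\<lambda>n. cmod (fourier F n)) N \<le> B" if N: "finite N" for N
  proof -
    define c where "c = fourier F"
    define P where "P z = (\<Sum>n\<in>N. c n * z powi n)" for z
    define S where "S = (\<Sum>n\<in>N. (cmod (c n))\<^sup>2)"
    have P: "continuous_on (sphere 0 1) P"
      unfolding P_def by (intro continuous_intros continuous_on_powi_circle) auto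
    have fP: "fourier P n = (if n \<in> N then c n else 0)" for n
      unfolding P_def using N
      by (subst fourier_sum) (auto simp: continuous_on_powi_circle fourier_powi delta_def if_distrib[of "\<lambda>z. _ * z"] cong: if_cong)
    have cP: "cnj (P (cis t)) = (\<Sum>n\<in>N. cnj (c n) * cis (- (of_int n * t)))" for t
      by (simp add: P_def cis_power_int cis_cnj)
    have I: "((\<lambda>t. G (cis t) * cnj (P (cis t))) has_integral (2 * pi * (\<Sum>n\<in>N. cnj (c n) * fourier G n))) {0..2 * pi}"
      if G: "continuous_on (sphere 0 1) G" for G
    proof -
      have "((\<lambda>t. \<Sum>n\<in>N. cnj (c n) * (G (cis t) * cis (- (of_int n * t))))
          has_integral (\<Sum>n\<in>N. cnj (c n) * (2 * pi * fourier G n))) {0..2 * pi}"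
        by (intro has_integral_sum N has_integral_mult_right fourier_has_integral G)
      then show ?thesis unfolding cP by (simp add: sum_distrib_left algebra_simps)
    qed
    have S1: "(\<Sum>n\<in>N. cnj (c n) * fourier F n) = complex_of_real S"
      unfolding S_def of_real_sum by (rule sum.cong) (auto simp: c_def complex_norm_square mult.commute simp del: of_real_power)
    have S2: "(\<Sum>n\<in>N. cnj (c n) * fourier P n) = complex_of_real S"
      unfolding S1[symmetric] by (rule sum.cong) (auto simp: fP c_def)
    have "((\<lambda>t. Re (2 * (F (cis t) * cnj (P (cis t))) - P (cis t) * cnj (P (cis t))))
        has_integral Re (2 * (2 * pi * complex_of_real S) - 2 * pi * complex_of_real S)) {0..2 * pi}"
      by (intro has_integral_Re has_integral_diff has_integral_mult_right I[OF F, unfolded S1] I[OF P, unfolded S2])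
    moreover have "((\<lambda>t. B\<^sup>2) has_integral (2 * pi * B\<^sup>2)) {0..2 * pi}"
      using has_integral_const_real[of "B\<^sup>2" 0 "2 * pi"] by simp
    moreover have "Re (2 * (F (cis t) * cnj (P (cis t))) - P (cis t) * cnj (P (cis t))) \<le> B\<^sup>2" for t
    proof -
      have "0 \<le> (cmod (F (cis t) - P (cis t)))\<^sup>2" by simp
      also have "\<dots> = (cmod (F (cis t)))\<^sup>2 - Re (2 * (F (cis t) * cnj (P (cis t))) - P (cis t) * cnj (P (cis t)))"
        unfolding cmod_power2 by (simp add: power2_eq_square algebra_simps)
      finally have "Re (2 * (F (cis t) * cnj (P (cis t))) - P (cis t) * cnj (P (cis t))) \<le> (cmod (F (cis t)))\<^sup>2"
        by simp
      also have "\<dots> \<le> B\<^sup>2" using B[of "cis t"] by (intro power_mono) auto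
      finally show ?thesis .
    qed
    ultimately have "Re (2 * (2 * pi * complex_of_real S) - 2 * pi * complex_of_real S) \<le> 2 * pi * B\<^sup>2"
      by (rule has_integral_le)
    then have "S \<le> B\<^sup>2" by simp
    then show ?thesis unfolding L2_set_def S_def c_def using B0 by (rule real_le_lsqrt[rotated])
  qed
  show "fourier F \<in> l2 UNIV" by (rule l2I(1)[OF _ *]) auto
  show "l2norm UNIV (fourier F) \<le> B" by (rule l2I(2)[OF _ *]) auto
qed

section \<open>Laurent polynomials on the circle and density of the multiples of
  \<open>F\<close>\<close>

definition laurent_on_circle :: "(complex \<Rightarrow> complex) \<Rightarrow> bool" where
  "laurent_on_circle g \<longleftrightarrow> (\<exists>p N. \<forall>z. cmod z = 1 \<longrightarrow> g z = poly p z / z ^ N)"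

lemma laurent_on_circle_add:
  assumes "laurent_on_circle f" "laurent_on_circle g"
  shows "laurent_on_circle (\<lambda>z. f z + g z)"
proof -
  obtain p N p' N' where *: "\<And>z. cmod z = 1 \<Longrightarrow> f z = poly p z / z ^ N" "\<And>z. cmod z = 1 \<Longrightarrow> g z = poly p' z / z ^ N'"
    using assms unfolding laurent_on_circle_def by metis
  have "f z + g z = poly (p * monom 1 N' + p' * monom 1 N) z / z ^ (N + N')" if "cmod z = 1" for z
  proof -
    have "z \<noteq> 0" using that by auto
    then show ?thesis using *[OF that] by (simp add: poly_monom power_add field_simps)
  qed
  then show ?thesis unfolding laurent_on_circle_def by blast
qed

lemma laurent_on_circle_mult:
  assumes "laurent_on_circle f" "laurent_on_circle g"
  shows "laurent_on_circle (\<lambda>z. f z * g z)"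
proof -
  obtain p N p' N' where *: "\<And>z. cmod z = 1 \<Longrightarrow> f z = poly p z / z ^ N" "\<And>z. cmod z = 1 \<Longrightarrow> g z = poly p' z / z ^ N'"
    using assms unfolding laurent_on_circle_def by metis
  have "f z * g z = poly (p * p') z / z ^ (N + N')" if "cmod z = 1" for z
    using *[OF that] by (simp add: power_add)
  then show ?thesis unfolding laurent_on_circle_def by blast
qed

lemma laurent_on_circle_const: "laurent_on_circle (\<lambda>_. c)"
  unfolding laurent_on_circle_def by (intro exI[of _ "[:c:]"] exI[of _ 0]) simp

lemma laurent_on_circle_real_polynomial:
  fixes g :: "complex \<Rightarrow> real"
  assumes "real_polynomial_function g"
  shows "laurent_on_circle (\<lambda>z. complex_of_real (g z))"
  using assms
proof (induction rule: real_polynomial_function.induct)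
  case (linear f)
  \<comment> \<open>A real linear \<open>f\<close> is a combination of \<open>Re z\<close> and
    \<open>Im z\<close>, and on the circle \<open>cnj z = 1 / z\<close>, so these are
    \<open>(z + 1 / z) / 2\<close> and \<open>(z - 1 / z) / (2 * \<i>)\<close>.\<close>
  have "complex_of_real (f z) = poly (smult (of_real (f 1) / 2) [:1, 0, 1:] + smult (of_real (f \<i>) / (2 * \<i>)) [:-1, 0, 1:]) z / z ^ 1"
    if z: "cmod z = 1" for z
  proof -
    interpret bounded_linear f by fact
    have "f (Re z *\<^sub>R 1 + Im z *\<^sub>R \<i>) = Re z * f 1 + Im z * f \<i>" by (simp add: add scaleR)
    moreover have "Re z *\<^sub>R 1 + Im z *\<^sub>R \<i> = z" by (simp add: complex_eq_iff)
    ultimately have f: "complex_of_real (f z) = of_real (Re z) * of_real (f 1) + of_real (Im z) * of_real (f \<i>)" by simp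
    have nz: "z \<noteq> 0" using z by auto
    have cz: "z * cnj z = 1" using z complex_norm_square[of z] by simp
    have ri: "complex_of_real (Re z) = (z + cnj z) / 2" "complex_of_real (Im z) = (z - cnj z) / (2 * \<i>)"
      by (auto simp: complex_eq_iff)
    have c: "cnj z = 1 / z" using cz nz by (simp add: field_simps)
    show ?thesis unfolding f ri c using nz by (simp add: field_simps)
  qed
  then show ?case unfolding laurent_on_circle_def by blast
qed (simp_all add: laurent_on_circle_const laurent_on_circle_add laurent_on_circle_mult)

lemma laurent_approx_on_circle:
  assumes Q: "continuous_on (sphere 0 1) Q" and e: "0 < e"
  obtains p N where "\<And>z. cmod z = 1 \<Longrightarrow> cmod (Q z - poly p z / z ^ N) < e"
proof -
  have "continuous_on (sphere 0 1) (\<lambda>z. Re (Q z))" "continuous_on (sphere 0 1) (\<lambda>z. Im (Q z))"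
    by (intro continuous_intros Q)+
  then obtain g h where g: "real_polynomial_function g" "\<And>z. z \<in> sphere 0 1 \<Longrightarrow> \<bar>Re (Q z) - g z\<bar> < e / 2"
    and h: "real_polynomial_function h" "\<And>z. z \<in> sphere 0 1 \<Longrightarrow> \<bar>Im (Q z) - h z\<bar> < e / 2"
    using Stone_Weierstrass_real_polynomial_function[OF compact_sphere _ half_gt_zero[OF e]] by metis
  have "laurent_on_circle (\<lambda>z. complex_of_real (g z) + \<i> * complex_of_real (h z))"
    by (intro laurent_on_circle_add laurent_on_circle_mult laurent_on_circle_const laurent_on_circle_real_polynomial g h)
  then obtain p N where pN: "\<And>z. cmod z = 1 \<Longrightarrow> complex_of_real (g z) + \<i> * complex_of_real (h z) = poly p z / z ^ N"
    unfolding laurent_on_circle_def by blast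
  show ?thesis
  proof (rule that[of p N])
    fix z :: complex assume z: "cmod z = 1"
    have "cmod (Q z - poly p z / z ^ N) \<le> \<bar>Re (Q z) - g z\<bar> + \<bar>Im (Q z) - h z\<bar>"
      unfolding pN[OF z, symmetric] using cmod_le[of "Q z - (complex_of_real (g z) + \<i> * complex_of_real (h z))"] by simp
    also have "\<dots> < e" using g(2)[of z] h(2)[of z] z by simp
    finally show "cmod (Q z - poly p z / z ^ N) < e" .
  qed
qed

text \<open>The averaged monomials have value 1 at the point 1 but small \<open>l2\<close> norm.
  This allows correcting the value at 1 of a function at little cost.\<close>

lemma averaged_deltas:
  assumes "0 < N"
  shows "l2norm UNIV (\<lambda>n. \<Sum>k<N. (1 / complex_of_real (real N)) * delta (m + int k) n) = 1 / sqrt (real N)"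
proof -
  have "(\<Sum>k<N. (1 / complex_of_real (real N)) * delta (m + int k) n) = (if n \<in> {m..<m + int N} then 1 / complex_of_real (real N) else 0)" for n
  proof (cases "n \<in> {m..<m + int N}")
    case True
    then have "(\<Sum>k<N. (1 / complex_of_real (real N)) * delta (m + int k) n)
        = (\<Sum>k<N. if k = nat (n - m) then 1 / complex_of_real (real N) else 0)"
      by (intro sum.cong) (auto simp: delta_def)
    then show ?thesis using True by auto
  next
    case False
    then show ?thesis by (auto simp: delta_def intro!: sum.neutral)
  qed
  then have "(\<Sum>\<^sub>\<infinity>n\<in>UNIV. (cmod (\<Sum>k<N. (1 / complex_of_real (real N)) * delta (m + int k) n))\<^sup>2)
     = (\<Sum>\<^sub>\<infinity>n\<in>{m..<m + int N}. (1 / real N)\<^sup>2)"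
    by (intro infsum_cong_neutral) (auto simp: norm_divide)
  also have "\<dots> = 1 / real N" using assms by (simp add: power2_eq_square)
  finally show ?thesis by (simp add: l2norm_def real_sqrt_divide)
qed

text \<open>\<open>F\<close> may vanish at 1, so uniform approximation by its multiples is possible
  only for functions vanishing there. The monomial \<open>z powi m\<close> is first made to vanish
  at 1 by subtracting an average of monomials, then divided by \<open>F\<close> away from its
  zero.\<close>

lemma fourier_multiplier_dense:
  fixes F :: "complex \<Rightarrow> real"
  assumes F: "continuous_on UNIV F" "\<And>z. 0 \<le> F z" "\<And>z. F z \<le> 2" "\<And>z. z \<noteq> 1 \<Longrightarrow> 0 < F z"
    and M: "csub UNIV M" and all: "\<And>k. fourier (\<lambda>z. z powi k * of_real (F z)) \<in> M"
  shows "M = l2 UNIV"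
proof (rule csub_eq_l2[OF M])
  fix m :: int
  have cF: "continuous_on (sphere 0 1) F" using F(1) by (rule continuous_on_subset) auto
  show "delta m \<in> M"
  proof (rule csub_closed[OF M])
    show "delta m \<in> l2 UNIV" by (rule delta_l2) simp
    fix e :: real assume e: "e > 0"
    obtain N :: nat where N0: "4 / e\<^sup>2 < real N" using reals_Archimedean2 by blast
    have N: "N > 0" using N0 e by (metis divide_pos_pos less_numeral_extra(3) of_nat_0_less_iff zero_less_numeral zero_less_power less_trans)
    have "(2 / e)\<^sup>2 < real N" using N0 by (simp add: power_divide)
    then have "2 / e < sqrt (real N)" using e by (intro real_less_rsqrt) auto
    then have sN: "1 / sqrt (real N) < e / 2" using e N by (simp add: field_simps)
    define D where "D z = (\<Sum>k<N. (1 / complex_of_real (real N)) * z powi (m + int k))" for z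
    define G where "G z = z powi m - D z" for z
    have cD: "continuous_on (sphere 0 1) D"
      unfolding D_def by (intro continuous_intros) auto
    have cG: "continuous_on (sphere 0 1) G"
      unfolding G_def by (intro continuous_on_diff cD continuous_on_powi_circle)
    have "fourier D = (\<lambda>n. \<Sum>k<N. (1 / complex_of_real (real N)) * delta (m + int k) n)"
      unfolding D_def by (subst fourier_sum) (auto simp: fourier_powi continuous_on_powi_circle)
    then have fD: "l2norm UNIV (fourier D) = 1 / sqrt (real N)" by (simp only: averaged_deltas[OF N])
    have fG: "fourier G = (\<lambda>n. delta m n - fourier D n)"
      unfolding G_def by (subst fourier_diff) (auto simp: fourier_powi continuous_on_powi_circle cD)
    have G1: "G 1 = 0" using N by (simp add: G_def D_def)
    define e' where "e' = e / 8"
    have e': "e' > 0" using e by (simp add: e'_def)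
    \<comment> \<open>Where \<open>G\<close> is not small is a compact set avoiding 1, on which
      \<open>F\<close> has a positive minimum.\<close>
    obtain \<eta> where \<eta>: "\<eta> > 0" "\<And>z. cmod z = 1 \<Longrightarrow> F z < \<eta> \<Longrightarrow> cmod (G z) < e'"
    proof -
      define K where "K = {z \<in> sphere 0 1. e' \<le> cmod (G z)}"
      have "closed K" unfolding K_def
        by (intro continuous_closed_preimage_constant continuous_on_closed_Collect_le continuous_intros cG) auto
      moreover have "bounded K" by (rule bounded_subset[of "sphere 0 1"]) (auto simp: K_def)
      ultimately have K: "compact K" by (simp add: compact_eq_bounded_closed)
      show ?thesis
      proof (cases "K = {}")
        case True
        then show ?thesis by (intro that[of 1]) (auto simp: K_def not_le)
      next
        case False
        obtain z0 where z0: "z0 \<in> K" "\<And>z. z \<in> K \<Longrightarrow> F z0 \<le> F z"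
          using continuous_attains_inf[OF K False continuous_on_subset[OF F(1)]] by auto
        have "z0 \<noteq> 1" using z0(1) G1 e' by (auto simp: K_def)
        then have "F z0 > 0" by (rule F(4))
        then show ?thesis using z0(2) by (intro that[of "F z0"]) (force simp: K_def not_le)+
      qed
    qed
    \<comment> \<open>Truncating the denominator keeps the quotient continuous. The identity
      \<open>Q * F = G\<close> fails only where \<open>F < \<eta>\<close>, and there
      \<open>G\<close> is already below \<open>e'\<close>.\<close>
    define Q where "Q z = G z / of_real (max (F z) \<eta>)" for z
    have mx: "max (F z) \<eta> > 0" for z using \<eta>(1) by simp
    have "continuous_on (sphere 0 1) Q"
      unfolding Q_def using mx by (intro continuous_intros cG cF) (auto simp: less_le)
    from laurent_approx_on_circle[OF this e'] obtain p L where
      pL: "\<And>z. cmod z = 1 \<Longrightarrow> cmod (Q z - poly p z / z ^ L) < e'" by blast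
    define H where "H z = (\<Sum>k\<le>degree p. coeff p k * (z powi (int k - int L) * complex_of_real (F z)))" for z
    have cH: "continuous_on (sphere 0 1) (\<lambda>z. z powi k * complex_of_real (F z))" for k
      by (intro continuous_on_mult continuous_on_powi_circle continuous_on_of_real cF)
    have cH': "continuous_on (sphere 0 1) H" unfolding H_def
      by (intro continuous_on_sum continuous_on_mult[OF continuous_on_const] cH)
    have H: "H z = poly p z / z ^ L * of_real (F z)" if "cmod z = 1" for z
    proof -
      have "z \<noteq> 0" using that by auto
      then have "z powi (int k - int L) = z ^ k / z ^ L" for k
        by (simp add: power_int_diff)
      then show ?thesis by (simp add: H_def poly_altdef sum_divide_distrib sum_distrib_right mult.assoc)
    qed
    have HM: "fourier H \<in> M"
      unfolding H_def by (subst fourier_sum[OF cH]) (intro csub_sum[OF M] all)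
    have GH: "cmod (G z - H z) \<le> 3 * e'" if z: "cmod z = 1" for z
    proof -
      have "cmod (G z - Q z * of_real (F z)) \<le> e'"
      proof (cases "F z < \<eta>")
        case True
        have "G z - Q z * of_real (F z) = G z * of_real (1 - F z / \<eta>)"
          using True \<eta>(1) by (simp add: Q_def max_def field_simps)
        then have "cmod (G z - Q z * of_real (F z)) = cmod (G z) * \<bar>1 - F z / \<eta>\<bar>"
          by (simp only: norm_mult norm_of_real)
        also have "\<dots> \<le> cmod (G z) * 1"
          using True F(2)[of z] \<eta>(1) by (intro mult_left_mono) (auto simp: field_simps abs_le_iff)
        finally show ?thesis using \<eta>(2)[OF z True] by simp
      next
        case False
        then show ?thesis using e' \<eta>(1) by (simp add: Q_def max_def)
      qed
      moreover have "cmod (Q z * of_real (F z) - H z) \<le> e' * 2"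
      proof -
        have "Q z * of_real (F z) - H z = (Q z - poly p z / z ^ L) * of_real (F z)"
          using H[OF z] by (simp add: algebra_simps)
        then have "cmod (Q z * of_real (F z) - H z) = cmod (Q z - poly p z / z ^ L) * F z"
          using F(2)[of z] by (simp add: norm_mult)
        also have "\<dots> \<le> e' * 2" using pL[OF z] F(2,3)[of z] e' by (intro mult_mono) auto
        finally show ?thesis .
      qed
      ultimately show ?thesis
        using norm_triangle_ineq[of "G z - Q z * of_real (F z)" "Q z * of_real (F z) - H z"] by simp
    qed
    have GH': "continuous_on (sphere 0 1) (\<lambda>z. G z - H z)" by (intro continuous_on_diff cG cH')
    have Dl: "fourier D \<in> l2 UNIV"
    proof -
      obtain B where "\<And>z. cmod z = 1 \<Longrightarrow> cmod (D z) \<le> B"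
        using compact_imp_bounded[OF compact_continuous_image[OF cD compact_sphere]] unfolding bounded_iff by force
      then show ?thesis by (rule bessel(1)[OF cD])
    qed
    have "l2norm UNIV (\<lambda>n. delta m n - fourier H n) = l2norm UNIV (\<lambda>n. fourier D n + fourier (\<lambda>z. G z - H z) n)"
      unfolding fourier_diff[OF cG cH'] fG by simp
    also have "\<dots> \<le> l2norm UNIV (fourier D) + l2norm UNIV (fourier (\<lambda>z. G z - H z))"
      by (intro l2norm_add_le Dl bessel(1)[OF GH' GH])
    also have "\<dots> \<le> 1 / sqrt (real N) + 3 * e'"
      unfolding fD by (intro add_left_mono bessel(2)[OF GH' GH])
    \<comment> \<open>The budget: \<open>e / 2\<close> for the average, by the choice of
      \<open>N\<close>, and \<open>3 * e / 8\<close> for the approximation of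
      \<open>G\<close>.\<close>
    also have "\<dots> < e" using sN e by (simp add: e'_def)
    finally show "\<exists>g\<in>M. l2norm UNIV (\<lambda>n. delta m n - g n) < e" using HM by blast
  qed
qed

section \<open>A cyclic shift on the fork with two infinite branches\<close>

text \<open>That the trunk weights are 1 is recorded because the trunk then carries the unweighted
  bilateral shift, whose cyclicity is extracted from this example.\<close>

lemma exists_cyclic_two_sided_fork:
  obtains lam h where "\<And>v. 0 < lam v" "\<And>v. lam v \<le> 1" "\<And>n. lam (Inl n) = 1"
    "cyclic_vector (fork_V UNIV {1..}) (pshift (fork_V UNIV {1..}) fpar lam) h"
proof -
  obtain q :: "nat \<Rightarrow> complex poly" where q: "\<And>n. 1 \<le> n \<Longrightarrow> coeff (q n) 0 = 1"
    "\<And>n k. 1 \<le> n \<Longrightarrow> 0 < k \<Longrightarrow> k < n \<Longrightarrow> coeff (q n) k = 0"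
    "\<And>n z. 1 \<le> n \<Longrightarrow> cmod z = 1 \<Longrightarrow> 1 / real n \<le> cmod (z - 1) \<Longrightarrow> cmod (poly (q n) z) \<le> 1 / real n"
    using exists_small_poly_flat_at_0 by metis
  obtain F :: "complex \<Rightarrow> real" where F: "continuous_on UNIV F" "\<And>z. 0 \<le> F z" "\<And>z. F z \<le> 2"
    "\<And>z. z \<noteq> 1 \<Longrightarrow> 0 < F z"
    "\<And>n z. 1 \<le> n \<Longrightarrow> cmod z = 1 \<Longrightarrow> cmod (poly (q n) z) * F z \<le> 2 / real n + 2 * (1/2) ^ n"
    using exists_multiplier[of q] q(3) by blast
  define \<epsilon> where "\<epsilon> n = 2 / real n + 2 * (1/2) ^ n" for n :: nat
  have cF: "continuous_on (sphere 0 1) F" using F(1) by (rule continuous_on_subset) auto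
  define \<Phi> where "\<Phi> k = fourier (\<lambda>z. z powi k * complex_of_real (F z))" for k
  have cPhi: "continuous_on (sphere 0 1) (\<lambda>z. z powi k * complex_of_real (F z))" for k
    by (intro continuous_on_mult continuous_on_powi_circle continuous_on_of_real cF)
  have \<Phi>l: "\<Phi> k \<in> l2 UNIV" for k unfolding \<Phi>_def
    by (rule bessel(1)[OF cPhi, of k 2]) (use F(2,3) in \<open>auto simp: norm_mult norm_power_int\<close>)
  \<comment> \<open>The Fourier coefficients of \<open>z^k * q n * F\<close>; by Bessel they inherit
    the uniform smallness of \<open>q n * F\<close>, for every integer \<open>k\<close>.\<close>
  define R where "R n k = (\<lambda>i. \<Sum>j\<le>degree (q n). coeff (q n) j * \<Phi> (k + int j) i)" for n k
  have Rl: "R n k \<in> l2 UNIV" for n k unfolding R_def by (intro l2_sum \<Phi>l)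
  have R: "l2norm UNIV (R n k) \<le> \<epsilon> n" if n: "1 \<le> n" for n k
  proof -
    define H where "H z = (\<Sum>j\<le>degree (q n). coeff (q n) j * (z powi (k + int j) * complex_of_real (F z)))" for z
    have cH: "continuous_on (sphere 0 1) H" unfolding H_def
      by (intro continuous_on_sum continuous_on_mult[OF continuous_on_const] cPhi)
    have "fourier H = R n k" unfolding H_def R_def \<Phi>_def by (rule fourier_sum[OF cPhi])
    moreover have "cmod (H z) \<le> \<epsilon> n" if z: "cmod z = 1" for z
    proof -
      have "z \<noteq> 0" using z by auto
      then have "H z = z powi k * poly (q n) z * of_real (F z)"
        by (simp add: H_def poly_altdef sum_distrib_left sum_distrib_right power_int_add algebra_simps)
      then show ?thesis using F(5)[OF n z] F(2)[of z] z by (simp add: norm_mult norm_power_int \<epsilon>_def)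
    qed
    ultimately show ?thesis using bessel(2)[OF cH] by metis
  qed
  \<comment> \<open>The weight at \<open>Inr i\<close> beats the coefficient of order
    \<open>i - 1\<close> of each \<open>q n\<close> with \<open>n \<le> i\<close>, and being at most
    \<open>1/2\<close> makes the weight products decay geometrically.\<close>
  define a where "a i = 1 / (2 + (\<Sum>n\<le>i. cmod (coeff (q n) (i - 1))))" for i
  have a_den: "2 + (\<Sum>n\<le>i. cmod (coeff (q n) (i - 1))) \<ge> 2" for i by (simp add: sum_nonneg)
  have a: "0 < a i" "a i \<le> 1/2" for i
    using a_den[of i] unfolding a_def by (auto intro!: divide_pos_pos divide_left_mono simp: divide_le_eq)
  have a_coeff: "cmod (coeff (q n) k) * a (Suc k) \<le> 1" if "n \<le> Suc k" for n k
  proof -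
    have "cmod (coeff (q n) k) \<le> (\<Sum>n\<le>Suc k. cmod (coeff (q n) k))"
      using that by (intro member_le_sum) auto
    then show ?thesis using a_den[of "Suc k"] by (simp add: a_def divide_le_eq)
  qed
  have a1: "a i \<le> 1" for i using a(2)[of i] by simp
  define lam where "lam v = (case v of Inl _ \<Rightarrow> 1 | Inr j \<Rightarrow> a j)" for v :: "int + nat"
  have lam: "0 < lam v" "lam v \<le> 1" for v
    using a(1) a1 by (auto simp: lam_def split: sum.split)
  interpret fork UNIV "{1..}" lam 1 using lam by unfold_locales auto
  let ?V = "fork_V UNIV {1..}"
  \<comment> \<open>The factor of \<open>lift_W\<close> when all trunk weights are 1.\<close>
  define c where "c j = (\<Prod>i<j. a (Suc i))" for j
  have c1: "\<bar>c j\<bar> \<le> 1" for j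
    unfolding c_def using a(1) a1 by (auto simp: abs_prod less_imp_le abs_of_pos intro!: prod_le_1)
  have c_rec: "c j * lam (Inl (int j)) = lam (Inr j) * c (j - 1)" if "j \<in> {1..}" for j
    using that by (cases j) (auto simp: lam_def c_def)
  have A: "blin UNIV ?V (lift c)" by (rule blin_lift[OF c1])
  have AW: "lift c (W f) = T (lift c f)" for f by (rule lift_W[OF _ c_rec]) (simp_all add: c_def)
  obtain CA where CA: "CA > 0" "\<And>f. f \<in> l2 UNIV \<Longrightarrow> l2norm ?V (lift c f) \<le> CA * l2norm UNIV f"
    using blin_bound[OF A] by blast
  have \<Phi>_shift: "\<Phi> k n = fourier (\<lambda>z. complex_of_real (F z)) (n - k)" for k n
    unfolding \<Phi>_def by (rule fourier_shift)
  have W\<Phi>: "W (\<Phi> k) = \<Phi> (k + 1)" for k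
  proof
    fix n
    have "W (\<Phi> k) n = \<Phi> k (n - 1)" by (simp add: W_def wcomp_def lam_def)
    then show "W (\<Phi> k) n = \<Phi> (k + 1) n" by (simp add: \<Phi>_shift algebra_simps)
  qed
  have Wn: "(W ^^ k) (\<Phi> 0) = \<Phi> (int k)" for k
    by (induction k) (auto simp: W\<Phi> add.commute)
  define d where "d k = (\<Prod>i<k. a (i + 2))" for k
  have d0: "0 < d k" for k unfolding d_def using a by (intro prod_pos) auto
  have d: "d k \<le> (1/2) ^ k" for k
  proof -
    have "d k \<le> (\<Prod>i<k. 1/2)" unfolding d_def using a by (intro prod_mono) (auto simp: less_imp_le)
    then show ?thesis by simp
  qed
  have Tn: "(T ^^ k) (delta (Inr 1)) = (\<lambda>v. complex_of_real (d k) * delta (Inr (Suc k)) v)" for k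
    unfolding T_power_delta_Inr_1 by (simp add: d_def lam_def)
  \<comment> \<open>One factor \<open>a (Suc i)\<close> of \<open>d k\<close> absorbs the
    coefficient; the remaining factors give the power of \<open>1/2\<close>, which is why the
    exponent drops by one and the constant 2 appears.\<close>
  have coeff_d: "cmod (coeff (q n) k) * d k \<le> 2 * (1/2) ^ k" if "n \<le> k" "0 < k" for n k
  proof -
    obtain i where i: "k = Suc i" using \<open>0 < k\<close> by (cases k) auto
    have "cmod (coeff (q n) k) * d k = (cmod (coeff (q n) k) * a (Suc k)) * d i"
      by (simp add: i d_def)
    also have "\<dots> \<le> 1 * (1/2) ^ i"
      using that by (intro mult_mono a_coeff d) (auto simp: less_imp_le d0)
    finally show ?thesis by (simp add: i)
  qed
  have d1: "delta (Inr j) \<in> l2 ?V" "l2norm ?V (delta (Inr j)) = 1" if "1 \<le> j" for j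
    using delta_l2[of "Inr j" ?V] that by auto
  define h where "h = (\<lambda>v. lift c (\<Phi> 0) v + delta (Inr 1) v)"
  have A\<Phi>: "lift c (\<Phi> k) \<in> l2 ?V" for k by (rule blin_l2[OF A \<Phi>l])
  have hl: "h \<in> l2 ?V" unfolding h_def by (intro l2_add A\<Phi> d1) auto
  have Th: "(T ^^ k) h = (\<lambda>v. lift c (\<Phi> (int k)) v + complex_of_real (d k) * delta (Inr (Suc k)) v)" for k
  proof -
    have "(T ^^ k) h = (\<lambda>v. (T ^^ k) (lift c (\<Phi> 0)) v + (T ^^ k) (delta (Inr 1)) v)"
      unfolding h_def by (intro blin_power_add[OF blin_T] A\<Phi> d1) auto
    moreover have "(T ^^ k) (lift c (\<Phi> 0)) = lift c (\<Phi> (int k))"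
      using intertwine_power[of UNIV W "lift c" T "\<Phi> 0" k, OF blin_W AW \<Phi>l] by (simp add: Wn)
    ultimately show ?thesis by (simp only: Tn)
  qed
  have "cyclic_vector ?V T h"
  proof (rule cyclic_vectorI[OF blin_T hl])
    fix M v assume M: "csub ?V M" "\<And>f. f \<in> M \<Longrightarrow> T f \<in> M" "h \<in> M" and v: "v \<in> ?V"
    \<comment> \<open>This is \<open>q n (T) h\<close>. Its graph part is
      \<open>lift c (R n 0)\<close>, which tends to 0; its side part is \<open>delta (Inr 1)\<close>
      plus terms of order at least \<open>n\<close>, whose sum is bounded by a geometric
      tail.\<close>
    define g where "g n = (\<lambda>v. \<Sum>j\<le>degree (q n). coeff (q n) j * (T ^^ j) h v)" for n
    have gM: "g n \<in> M" for n
      unfolding g_def by (intro csub_sum[OF M(1)] csub_invariant_power[of M T, OF M(2,3)])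
    have g: "l2norm ?V (\<lambda>v. delta (Inr 1) v - g n v) \<le> CA * \<epsilon> n + 4 * (1/2) ^ n" if n: "1 \<le> n" for n
    proof -
      define D where "D = degree (q n)"
      define Z :: "int + nat \<Rightarrow> complex" where "Z = (\<lambda>v. \<Sum>j\<in>{n..D}. (coeff (q n) j * of_real (d j)) * delta (Inr (Suc j)) v)"
      have "g n v = lift c (R n 0) v + (\<Sum>j\<le>D. coeff (q n) j * of_real (d j) * delta (Inr (Suc j)) v)" for v
        unfolding g_def Th R_def blin_sum[OF A \<Phi>l] by (simp add: D_def algebra_simps sum.distrib)
      moreover have "(\<Sum>j\<le>D. coeff (q n) j * of_real (d j) * delta (Inr (Suc j)) v) = delta (Inr 1) v + Z v" for v
      proof -
        have "(\<Sum>j\<le>D. coeff (q n) j * of_real (d j) * delta (Inr (Suc j)) v)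
            = (\<Sum>j\<in>insert 0 {n..D}. coeff (q n) j * of_real (d j) * delta (Inr (Suc j)) v)"
          using q(2)[OF n] by (intro sum.mono_neutral_right) auto
        also have "\<dots> = delta (Inr 1) v + Z v"
          using n q(1)[OF n] by (subst sum.insert) (auto simp: Z_def d_def)
        finally show ?thesis .
      qed
      ultimately have "(\<lambda>v. delta (Inr 1) v - g n v) = (\<lambda>v. (-1) * (lift c (R n 0) v + Z v))"
        by (simp add: fun_eq_iff)
      then have "l2norm ?V (\<lambda>v. delta (Inr 1) v - g n v) = l2norm ?V (\<lambda>v. lift c (R n 0) v + Z v)"
        by (simp only: l2norm_scale) simp
      also have "\<dots> \<le> l2norm ?V (lift c (R n 0)) + l2norm ?V Z"
        unfolding Z_def by (intro l2norm_add_le blin_l2[OF A] Rl l2_sum d1) auto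
      also have "\<dots> \<le> CA * \<epsilon> n + 4 * (1/2) ^ n"
      proof (rule add_mono)
        have "l2norm ?V (lift c (R n 0)) \<le> CA * l2norm UNIV (R n 0)" by (intro CA Rl)
        also have "\<dots> \<le> CA * \<epsilon> n" using CA R[OF n] by (intro mult_left_mono) auto
        finally show "l2norm ?V (lift c (R n 0)) \<le> CA * \<epsilon> n" .
        have "l2norm ?V Z \<le> (\<Sum>j\<in>{n..D}. cmod (coeff (q n) j * of_real (d j)) * l2norm ?V (delta (Inr (Suc j))))"
          unfolding Z_def by (intro l2norm_sum_le d1) auto
        also have "\<dots> \<le> (\<Sum>j\<in>{n..D}. 2 * (1/2) ^ j)"
        proof (rule sum_mono)
          fix j assume j: "j \<in> {n..D}"
          then show "cmod (coeff (q n) j * of_real (d j)) * l2norm ?V (delta (Inr (Suc j))) \<le> 2 * (1/2) ^ j"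
            using coeff_d[of n j] n d0[of j] d1(2)[of "Suc j"] by (simp add: norm_mult)
        qed
        also have "\<dots> = 2 * (\<Sum>j\<in>{n..D}. (1/2) ^ j)" by (simp add: sum_distrib_left)
        also have "\<dots> \<le> 4 * (1/2) ^ n" by (simp add: sum_gp)
        finally show "l2norm ?V Z \<le> 4 * (1/2) ^ n" .
      qed
      finally show ?thesis .
    qed
    have "(\<lambda>n. \<epsilon> n) \<longlonglongrightarrow> 2 * 0 + 2 * 0"
    proof -
      have "(\<lambda>n. 2 * (1 / real n) + 2 * (1/2) ^ n) \<longlonglongrightarrow> 2 * 0 + 2 * (0 :: real)"
        by (intro tendsto_intros lim_1_over_n LIMSEQ_realpow_zero) auto
      then show ?thesis by (simp add: \<epsilon>_def[abs_def])
    qed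
    then have \<epsilon>: "\<epsilon> \<longlonglongrightarrow> 0" by simp
    have "(\<lambda>n. CA * \<epsilon> n + 4 * (1/2) ^ n) \<longlonglongrightarrow> CA * 0 + 4 * 0"
      by (intro tendsto_intros \<epsilon> LIMSEQ_realpow_zero) auto
    \<comment> \<open>The index is shifted because nothing is known about
      \<open>q 0\<close>.\<close>
    then have lim: "(\<lambda>n. CA * \<epsilon> (Suc n) + 4 * (1/2) ^ Suc n) \<longlonglongrightarrow> 0"
      using LIMSEQ_Suc by fastforce
    have d_in: "delta (Inr 1) \<in> M"
    proof (rule csub_tendsto[where g = "\<lambda>n. g (Suc n)", OF M(1) _ gM])
      show "delta (Inr 1) \<in> l2 ?V" by (intro d1) simp
      have le: "norm (l2norm ?V (\<lambda>v. delta (Inr 1) v - g (Suc n) v)) \<le> CA * \<epsilon> (Suc n) + 4 * (1/2) ^ Suc n" for n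
        using g[of "Suc n"] by simp
      show "(\<lambda>n. l2norm ?V (\<lambda>v. delta (Inr 1) v - g (Suc n) v)) \<longlonglongrightarrow> 0"
        by (rule Lim_null_comparison[OF _ lim]) (rule always_eventually, rule allI, rule le)
    qed
    define M' where "M' = {f \<in> l2 UNIV. lift c f \<in> M}"
    have M': "csub UNIV M'" unfolding M'_def by (rule csub_vimage[OF A M(1)])
    have WM': "W f \<in> M'" if "f \<in> M'" for f
      using that AW M(2) blin_l2[OF blin_W] by (auto simp: M'_def)
    have step: "\<Phi> (k - 1) \<in> M'" if k: "\<Phi> k \<in> M'" for k
    proof -
      have up: "\<Phi> (k + int i) \<in> M'" for i
      proof (induction i)
        case (Suc i)
        then show ?case using WM'[OF Suc] by (simp add: W\<Phi> algebra_simps)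
      qed (use k in simp)
      \<comment> \<open>Since \<open>coeff (q n) 0 = 1\<close>, the function
        \<open>z^(k-1) * (1 - q n) * F\<close> involves only \<open>z^k F\<close> and higher
        multiples, which are in \<open>M'\<close>. It differs from \<open>z^(k-1) F\<close> by
        \<open>R n (k - 1)\<close>.\<close>
      define u where "u n = (\<lambda>i. \<Sum>j\<in>{1..degree (q n)}. (- coeff (q n) j) * \<Phi> (k - 1 + int j) i)" for n
      have uM: "u n \<in> M'" for n unfolding u_def
      proof (rule csub_sum[OF M'])
        fix j assume "j \<in> {1..degree (q n)}"
        then show "\<Phi> (k - 1 + int j) \<in> M'" using up[of "j - 1"] by (simp add: of_nat_diff algebra_simps)
      qed
      have Ru: "(\<lambda>i. \<Phi> (k - 1) i - u n i) = R n (k - 1)" if n: "1 \<le> n" for n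
      proof
        fix i
        have s: "{..degree (q n)} = insert 0 {1..degree (q n)}" by auto
        show "\<Phi> (k - 1) i - u n i = R n (k - 1) i"
          unfolding R_def s using q(1)[OF n] by (subst sum.insert) (auto simp: u_def sum_negf)
      qed
      show ?thesis
      proof (rule csub_tendsto[where g = "\<lambda>n. u (Suc n)", OF M' \<Phi>l uM])
        have le: "norm (l2norm UNIV (\<lambda>i. \<Phi> (k - 1) i - u (Suc n) i)) \<le> \<epsilon> (Suc n)" for n
          using R[of "Suc n" "k - 1"] by (simp add: Ru)
        show "(\<lambda>n. l2norm UNIV (\<lambda>i. \<Phi> (k - 1) i - u (Suc n) i)) \<longlonglongrightarrow> 0"
          by (rule Lim_null_comparison[OF _ LIMSEQ_Suc[OF \<epsilon>]]) (rule always_eventually, rule allI, rule le)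
      qed
    qed
    have "lift c (\<Phi> 0) = (\<lambda>v. h v - delta (Inr 1) v)" by (simp add: h_def)
    also have "\<dots> \<in> M" by (rule csub_diff[OF M(1,3) d_in])
    finally have base: "\<Phi> 0 \<in> M'" using \<Phi>l by (simp add: M'_def)
    have all: "\<Phi> k \<in> M'" for k
    proof (induction k rule: int_induct[where k = 0])
      case base show ?case by fact
    next
      case (step1 i) then show ?case using WM'[of "\<Phi> i"] by (simp add: W\<Phi>)
    next
      case (step2 i) then show ?case by (intro step)
    qed
    have "M' = l2 UNIV"
      by (rule fourier_multiplier_dense[OF F(1-4) M' all[unfolded \<Phi>_def]])
    then have AM: "lift c f \<in> M" if "f \<in> l2 UNIV" for f using that by (auto simp: M'_def)
    show "delta v \<in> M" by (rule csub_fill[of M c, OF M(1,2) d_in AM v])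
  qed
  moreover have "lam (Inl n) = 1" for n by (simp add: lam_def)
  ultimately show ?thesis by (intro that[OF lam]) (auto simp only: T_def)
qed

section \<open>Rootless trees of branching index one\<close>

text \<open>Every finite partial sum is at most 1. Sums over one vertex bound the number of children
  by 2, sums over two exclude a second branching, and without any branching all sums would be
  0.\<close>

lemma Br_1_obtains_branching:
  assumes Br: "Br V E = 1"
  obtains u0 a b where "u0 \<in> V" "a \<noteq> b" "Chi E u0 = {a, b}"
    "\<And>u x y. u \<in> V \<Longrightarrow> u \<noteq> u0 \<Longrightarrow> x \<in> Chi E u \<Longrightarrow> y \<in> Chi E u \<Longrightarrow> x = y"
proof -
  let ?N = "V - leaves V E" and ?f = "\<lambda>u. ecard (Chi E u) - 1"
  have "(\<Sum>u\<in>F. ?f u) \<le> Br V E" if "finite F" "F \<subseteq> ?N" for F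
    unfolding Br_def by (rule SUP_upper) (use that in auto)
  then have le: "(\<Sum>u\<in>F. ?f u) \<le> 1" if "finite F" "F \<subseteq> ?N" for F
    using that Br by metis
  have fin: "finite (Chi E u) \<and> card (Chi E u) \<le> 2" if "u \<in> ?N" for u
  proof -
    have "?f u \<le> 1" using le[of "{u}"] that by simp
    then show ?thesis by (cases "finite (Chi E u)") (auto simp: ecard_def one_enat_def)
  qed
  have pos: "card (Chi E u) \<ge> 1" if "u \<in> ?N" for u
    using that fin[OF that] by (auto simp: leaves_def Suc_le_eq card_gt_0_iff)
  have f: "?f u = enat (card (Chi E u) - 1)" if "u \<in> ?N" for u
    using fin[OF that] by (simp add: ecard_def one_enat_def)
  have "\<exists>u\<in>?N. card (Chi E u) = 2"
  proof (rule ccontr)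
    assume no: "\<not> ?thesis"
    have "?f u = 0" if "u \<in> ?N" for u
    proof -
      have "card (Chi E u) = 1" using no that fin[OF that] pos[OF that] by (metis One_nat_def Suc_1 le_Suc_eq le_antisym)
      then show ?thesis using f[OF that] by (simp add: zero_enat_def)
    qed
    then have "(\<Sum>u\<in>F. ?f u) = 0" if "F \<subseteq> ?N" for F using that by (intro sum.neutral) auto
    then have "Br V E \<le> 0" unfolding Br_def by (intro SUP_least) auto
    then show False using Br by simp
  qed
  then obtain u0 where u0: "u0 \<in> ?N" "card (Chi E u0) = 2" by blast
  then obtain a b where ab: "Chi E u0 = {a, b}" "a \<noteq> b" by (auto simp: card_2_iff)
  have "x = y" if u: "u \<in> V" "u \<noteq> u0" and xy: "x \<in> Chi E u" "y \<in> Chi E u" for u x y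
  proof -
    have uN: "u \<in> ?N" using u xy by (auto simp: leaves_def)
    have "?f u0 + ?f u \<le> 1" using le[of "{u0, u}"] u uN u0 by simp
    then have "card (Chi E u) - 1 = 0"
      unfolding f[OF uN] f[OF u0(1)] using u0(2) by (simp add: one_enat_def)
    then have "card (Chi E u) = 1" using pos[OF uN] by simp
    then show ?thesis using xy by (auto simp: card_1_singleton_iff)
  qed
  with ab u0(1) that show ?thesis by blast
qed

text \<open>The children \<open>a\<close> and \<open>b\<close> play different roles:
  \<open>a\<close> starts the continuation of the trunk, \<open>b\<close> the side branch. The
  locale is therefore interpreted in both orders.\<close>

locale branched_tree =
  fixes V :: "'a set" and E :: "('a \<times> 'a) set" and u0 a b :: 'a
  assumes tree: "dtree V E" and rootless: "rootless V E"
    and u0: "u0 \<in> V" and ab: "a \<noteq> b" "Chi E u0 = {a, b}"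
    and unique_child: "u \<in> V \<Longrightarrow> u \<noteq> u0 \<Longrightarrow> (u, x) \<in> E \<Longrightarrow> (u, y) \<in> E \<Longrightarrow> x = y"
begin

lemma E_V: "(u, v) \<in> E \<Longrightarrow> u \<in> V \<and> v \<in> V"
  using tree unfolding dtree_def by blast

lemma par_eq: "(u, v) \<in> E \<Longrightarrow> par E v = u"
  using tree unfolding dtree_def par_def by (intro the_equality) blast+

lemma par_edge: "v \<in> V \<Longrightarrow> (par E v, v) \<in> E"
  using rootless par_eq unfolding rootless_def has_parent_def by metis

lemma par_V: "v \<in> V \<Longrightarrow> par E v \<in> V"
  using par_edge E_V by blast

lemma par_power_V: "v \<in> V \<Longrightarrow> (par E ^^ n) v \<in> V"
  by (induction n) (auto intro: par_V)

lemma par_power_trancl: "v \<in> V \<Longrightarrow> ((par E ^^ Suc n) v, v) \<in> E\<^sup>+"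
proof (induction n)
  case 0 then show ?case using par_edge by auto
next
  case (Suc n)
  have "((par E ^^ Suc (Suc n)) v, (par E ^^ Suc n) v) \<in> E"
    using par_edge[OF par_power_V[OF Suc.prems, of "Suc n"]] by simp
  then show ?case using Suc by (meson trancl_into_trancl2)
qed

lemma par_power_inj: "(par E ^^ m) u0 = (par E ^^ n) u0 \<Longrightarrow> m = n"
proof (induction m n rule: linorder_wlog)
  case (le m n)
  show ?case
  proof (rule ccontr)
    assume "m \<noteq> n"
    then obtain k where "n = Suc k + m" using le(1) by (metis add.commute le_neq_implies_less less_imp_Suc_add add_Suc_right)
    then have "(par E ^^ Suc k) ((par E ^^ m) u0) = (par E ^^ m) u0"
      using le(2) funpow_add[of "Suc k" m "par E"] by (metis comp_apply)
    then have "((par E ^^ m) u0, (par E ^^ m) u0) \<in> E\<^sup>+"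
      using par_power_trancl[OF par_power_V[OF u0, of m], of k] by simp
    then show False using tree unfolding dtree_def by blast
  qed
qed auto

definition child :: "'a \<Rightarrow> 'a" where "child u = (SOME v. (u, v) \<in> E)"

lemma child: "Chi E u \<noteq> {} \<Longrightarrow> (u, child u) \<in> E"
  unfolding child_def Chi_def by (rule someI_ex) auto

text \<open>The numbers of steps that can be made from \<open>c\<close> without passing a leaf. As
  an initial segment of the naturals it treats finite and infinite chains alike.\<close>

definition len :: "'a \<Rightarrow> nat set" where
  "len c = {m. \<forall>i<m. Chi E ((child ^^ i) c) \<noteq> {}}"

lemma len_0: "0 \<in> len c" and len_down: "m \<in> len c \<Longrightarrow> n \<le> m \<Longrightarrow> n \<in> len c"
  by (auto simp: len_def)

lemma len_Suc: "Suc m \<in> len c \<longleftrightarrow> m \<in> len c \<and> Chi E ((child ^^ m) c) \<noteq> {}"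
  by (auto simp: len_def less_Suc_eq)

lemma len_cases: "len c = UNIV \<or> (\<exists>m. len c = {..m})"
proof (cases "len c = UNIV")
  case False
  then obtain n where n: "n \<notin> len c" by auto
  define m where "m = (LEAST n. n \<notin> len c)"
  have m: "m \<notin> len c" "\<And>k. k < m \<Longrightarrow> k \<in> len c"
    unfolding m_def by (rule LeastI[of _ n], rule n) (use not_less_Least in blast)
  then obtain k where "m = Suc k" using len_0[of c] by (cases m) auto
  then have "len c = {..k}" using m len_down by (auto simp: less_Suc_eq_le) (meson not_less_eq_eq)
  then show ?thesis by blast
qed simp

text \<open>The exponents are shifted by one because \<open>a\<close> and \<open>b\<close> sit at
  level 1, as \<open>Inl 1\<close> and \<open>Inr 1\<close>; nonpositive trunk numbers are the
  ancestors of \<open>u0\<close>.\<close>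

definition emb :: "int + nat \<Rightarrow> 'a" where
  "emb x = (case x of Inl n \<Rightarrow> if n \<le> 0 then (par E ^^ nat (- n)) u0 else (child ^^ nat (n - 1)) a
     | Inr j \<Rightarrow> (child ^^ (j - 1)) b)"

definition "trunk = {n. n \<le> 0 \<or> nat (n - 1) \<in> len a}"

definition "side = {j. 1 \<le> j \<and> j - 1 \<in> len b}"

lemma side_1: "1 \<in> side" and trunk_le_1: "n \<le> 1 \<Longrightarrow> n \<in> trunk"
  using len_0 by (auto simp: side_def trunk_def)

lemma fpar_in:
  assumes "x \<in> fork_V trunk side"
  shows "fpar x \<in> fork_V trunk side"
proof (cases x)
  case (Inl n)
  have "nat (n - 1 - 1) \<le> nat (n - 1)" by (rule nat_mono) simp
  then show ?thesis using Inl assms len_down[of "nat (n - 1)" a "nat (n - 1 - 1)"] by (auto simp: trunk_def)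
next
  case (Inr j)
  then show ?thesis using assms len_down[of "j - 1" b "j - 1 - 1"] trunk_le_1[of 0] by (auto simp: side_def)
qed

lemma emb_edge:
  assumes "x \<in> fork_V trunk side"
  shows "(emb (fpar x), emb x) \<in> E"
proof (cases x)
  case (Inl n)
  consider "n \<le> 0" | "n = 1" | "n \<ge> 2" by linarith
  then show ?thesis
  proof cases
    case 1
    then have "nat (- (n - 1)) = Suc (nat (- n))" by simp
    then show ?thesis using 1 par_edge[OF par_power_V[OF u0, of "nat (- n)"]] Inl by (simp add: emb_def)
  next
    case 2
    then show ?thesis using ab Inl by (auto simp: emb_def Chi_def)
  next
    case 3
    then obtain k where k: "n = int k + 2" by (metis add.commute le_add_diff_inverse2 nonneg_int_cases diff_ge_0_iff_ge add_diff_cancel_left')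
    have "nat (n - 1) = Suc k" "nat (n - 1 - 1) = k" using k by auto
    moreover have "Suc k \<in> len a" using assms Inl k 3 calculation by (auto simp: trunk_def)
    ultimately show ?thesis using 3 Inl child[of "(child ^^ k) a"] by (auto simp: emb_def len_Suc)
  qed
next
  case (Inr j)
  then have j: "1 \<le> j" "j - 1 \<in> len b" using assms by (auto simp: side_def)
  show ?thesis
  proof (cases "j = 1")
    case True
    then show ?thesis using ab Inr by (auto simp: emb_def Chi_def)
  next
    case False
    then have "j = Suc (Suc (j - 2))" using j by simp
    then obtain k where k: "j = Suc (Suc k)" by blast
    then have "((child ^^ k) b, child ((child ^^ k) b)) \<in> E"
      using j by (intro child) (simp add: len_Suc)
    then show ?thesis by (simp add: emb_def Inr k)
  qed
qed

lemma emb_V: "x \<in> fork_V trunk side \<Longrightarrow> emb x \<in> V"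
  using emb_edge E_V by blast

lemma par_emb: "x \<in> fork_V trunk side \<Longrightarrow> par E (emb x) = emb (fpar x)"
  using emb_edge par_eq by blast

lemma par_power_emb:
  assumes "x \<in> fork_V trunk side"
  shows "(par E ^^ n) (emb x) = emb ((fpar ^^ n) x)" and "(fpar ^^ n) x \<in> fork_V trunk side"
proof -
  show *: "(fpar ^^ n) x \<in> fork_V trunk side" for n by (induction n) (auto intro: fpar_in assms)
  show "(par E ^^ n) (emb x) = emb ((fpar ^^ n) x)" by (induction n) (auto simp: par_emb *)
qed

definition level :: "int + nat \<Rightarrow> int" where
  "level x = (case x of Inl n \<Rightarrow> n | Inr j \<Rightarrow> int j)"

lemma fpar_power_level:
  assumes "x \<in> fork_V trunk side" "level x \<le> int N"
  shows "(fpar ^^ N) x = Inl (level x - int N)"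
  using assms by (cases x) (auto simp: level_def fpar_power_Inl fpar_power_Inr side_def)

text \<open>Going back far enough moves both vertices to the ancestors of \<open>u0\<close>, which
  are pairwise different as there is no circuit.\<close>

lemma level_eq:
  assumes x: "x \<in> fork_V trunk side" and y: "y \<in> fork_V trunk side" and eq: "emb x = emb y"
  shows "level x = level y"
proof -
  define N where "N = nat (max \<bar>level x\<bar> \<bar>level y\<bar>)"
  have N: "level x \<le> int N" "level y \<le> int N" by (auto simp: N_def)
  have "emb (Inl (level x - int N)) = emb (Inl (level y - int N))"
    using par_power_emb(1)[OF x, of N] par_power_emb(1)[OF y, of N] eq
      fpar_power_level[OF x N(1)] fpar_power_level[OF y N(2)] by simp
  then have "nat (- (level x - int N)) = nat (- (level y - int N))"
    using N by (intro par_power_inj) (simp add: emb_def)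
  then show ?thesis using N by auto
qed

lemma inj_emb: "inj_on emb (fork_V trunk side)"
proof (rule inj_onI)
  \<comment> \<open>Vertices of equal level on different branches: \<open>j - 1\<close> steps back
    lead to \<open>a\<close> and \<open>b\<close>, which differ.\<close>
  have aux: False if "int j \<in> trunk" "j \<in> side" "emb (Inl (int j)) = emb (Inr j)" for j
  proof -
    have j: "1 \<le> j" using that by (auto simp: side_def)
    have "emb ((fpar ^^ (j - 1)) (Inl (int j))) = emb ((fpar ^^ (j - 1)) (Inr j))"
      using par_power_emb(1)[of "Inl (int j)" "j - 1"] par_power_emb(1)[of "Inr j" "j - 1"] that by simp
    then have "emb (Inl 1) = emb (Inr 1)"
      using j by (simp add: fpar_power_Inl fpar_power_Inr of_nat_diff)
    then show False using ab by (simp add: emb_def)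
  qed
  fix x y assume xy: "x \<in> fork_V trunk side" "y \<in> fork_V trunk side" "emb x = emb y"
  have "level x = level y" by (rule level_eq[OF xy])
  then show "x = y" using xy aux[of "nat (level x)"]
    by (cases x; cases y) (auto simp: level_def)
qed

text \<open>The image contains \<open>u0\<close> and is closed under passing along an edge in either
  direction, so by connectedness it contains every vertex.\<close>

lemma emb_surj: "V \<subseteq> emb ` fork_V trunk side"
proof
  fix v assume "v \<in> V"
  then have "(u0, v) \<in> (E \<union> E\<inverse>)\<^sup>*" using tree u0 unfolding dtree_def by blast
  then show "v \<in> emb ` fork_V trunk side"
  proof (induction rule: rtrancl_induct)
    case base
    have "u0 = emb (Inl 0)" by (simp add: emb_def)
    then show ?case using trunk_le_1[of 0] by auto
  next
    case (step y z)
    then obtain x where x: "x \<in> fork_V trunk side" "y = emb x" by blast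
    show ?case
    proof (cases "(z, y) \<in> E")
      case True
      then have "z = emb (fpar x)" using par_emb[OF x(1)] par_eq x by auto
      then show ?thesis using fpar_in[OF x(1)] by blast
    next
      case False
      then have yz: "(y, z) \<in> E" using step by auto
      show ?thesis
      proof (cases "x = Inl 0")
        case True
        then have "z \<in> {a, b}" using yz x ab by (auto simp: emb_def Chi_def)
        moreover have "a = emb (Inl 1)" "b = emb (Inr 1)" by (auto simp: emb_def)
        ultimately show ?thesis using side_1 trunk_le_1[of 1] by auto
      next
        case False
        have "emb (Inl 0) = u0" by (simp add: emb_def)
        then have "y \<noteq> u0" using False x inj_onD[OF inj_emb, of x "Inl 0"] trunk_le_1[of 0] by auto
        have ne: "Chi E y \<noteq> {}" using yz by (auto simp: Chi_def)
        obtain x' where x': "x' \<in> fork_V trunk side" "fpar x' = x"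
        proof (cases x)
          case (Inl n)
          have "n + 1 \<in> trunk"
          proof (cases "n \<ge> 1")
            case True
            then have "Suc (nat (n - 1)) \<in> len a" using x Inl ne by (auto simp: len_Suc emb_def trunk_def)
            moreover have "Suc (nat (n - 1)) = nat (n + 1 - 1)" using True by simp
            ultimately show ?thesis by (simp add: trunk_def)
          qed (use trunk_le_1[of "n + 1"] in auto)
          then show ?thesis using Inl by (intro that[of "Inl (n + 1)"]) auto
        next
          case (Inr j)
          then have "1 \<le> j" "Suc (j - 1) \<in> len b" using x ne len_Suc[of "j - 1" b] by (auto simp: emb_def side_def)
          then show ?thesis using Inr by (intro that[of "Inr (Suc j)"]) (auto simp: side_def)
        qed
        then have "(y, emb x') \<in> E" using emb_edge[OF x'(1)] x by simp
        then have "z = emb x'" using unique_child[OF _ \<open>y \<noteq> u0\<close> yz] yz E_V by blast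
        then show ?thesis using x' by blast
      qed
    qed
  qed
qed

lemma bij_emb: "bij_betw emb (fork_V trunk side) V"
  using inj_emb emb_surj emb_V by (auto simp: bij_betw_def)

lemma emb_edge_iff:
  assumes "x \<in> fork_V trunk side" "y \<in> fork_V trunk side"
  shows "(emb x, emb y) \<in> E \<longleftrightarrow> fpar y = x"
proof
  assume "(emb x, emb y) \<in> E"
  then have "emb (fpar y) = emb x" using par_eq par_emb[OF assms(2)] by simp
  then show "fpar y = x" using inj_emb fpar_in[OF assms(2)] assms(1) by (auto dest: inj_onD)
qed (use emb_edge[OF assms(2)] in auto)

lemma trunk_cases: "trunk = UNIV \<and> len a = UNIV \<or> (\<exists>m. trunk = {..int m + 1} \<and> len a = {..m})"
  using len_cases[of a]
proof
  assume "\<exists>m. len a = {..m}"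
  then obtain m where m: "len a = {..m}" by blast
  have "trunk = {..int m + 1}" unfolding trunk_def m by auto
  with m show ?thesis by blast
qed (auto simp: trunk_def)

lemma side_cases: "side = {1..} \<and> len b = UNIV \<or> (\<exists>m. side = {1..Suc m} \<and> len b = {..m})"
  using len_cases[of b]
proof
  assume "\<exists>m. len b = {..m}"
  then obtain m where m: "len b = {..m}" by blast
  have "side = {1..Suc m}" unfolding side_def m by auto
  with m show ?thesis by blast
qed (auto simp: side_def)

text \<open>The assumption rules out a finite trunk with an infinite side branch and orders the
  lengths when both are finite.\<close>

lemma fork_shape:
  assumes "len b \<subseteq> len a"
  shows "trunk = UNIV \<and> side = {1..} \<or> (\<exists>q\<ge>1. trunk = UNIV \<and> side = {1..q})
    \<or> (\<exists>p q. 1 \<le> q \<and> int q \<le> p \<and> trunk = {..p} \<and> side = {1..q})"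
  using trunk_cases side_cases
proof (elim disjE conjE exE)
  fix m k assume "trunk = {..int m + 1}" "len a = {..m}" "side = {1..Suc k}" "len b = {..k}"
  then show ?thesis using assms by (intro disjI2 exI[of _ "int m + 1"] exI[of _ "Suc k"]) auto
next
  fix m assume "len a = {..m}" "len b = UNIV"
  then show ?thesis using assms by auto
qed auto

end

lemma branching_one_is_fork:
  assumes "dtree V E" "rootless V E" "Br V E = 1"
  obtains I J \<psi> where "bij_betw \<psi> (fork_V I J) V"
    "\<And>x. x \<in> fork_V I J \<Longrightarrow> fpar x \<in> fork_V I J"
    "\<And>x y. x \<in> fork_V I J \<Longrightarrow> y \<in> fork_V I J \<Longrightarrow> (\<psi> x, \<psi> y) \<in> E \<longleftrightarrow> fpar y = x"
    "I = UNIV \<and> J = {1..} \<or> (\<exists>q\<ge>1. I = UNIV \<and> J = {1..q})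
    \<or> (\<exists>p q. 1 \<le> q \<and> int q \<le> p \<and> I = {..p} \<and> J = {1..q})"
proof -
  obtain u0 a b where *: "u0 \<in> V" "a \<noteq> b" "Chi E u0 = {a, b}"
    "\<And>u x y. u \<in> V \<Longrightarrow> u \<noteq> u0 \<Longrightarrow> x \<in> Chi E u \<Longrightarrow> y \<in> Chi E u \<Longrightarrow> x = y"
    using Br_1_obtains_branching[OF assms(3)] by blast
  interpret A: branched_tree V E u0 a b
    using assms * by unfold_locales (auto simp: Chi_def)
  interpret B: branched_tree V E u0 b a
    using assms * by unfold_locales (auto simp: Chi_def)
  \<comment> \<open>Initial segments are comparable, so one of the two orders of the children makes
    the side branch the shorter one.\<close>
  have "A.len b \<subseteq> A.len a \<or> A.len a \<subseteq> A.len b"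
    using A.len_cases[of a] A.len_cases[of b] by (auto; fastforce)
  then show ?thesis
  proof
    assume "A.len b \<subseteq> A.len a"
    from that[OF A.bij_emb A.fpar_in A.emb_edge_iff A.fork_shape[OF this]] show ?thesis by blast
  next
    assume "A.len a \<subseteq> A.len b"
    from that[OF B.bij_emb B.fpar_in B.emb_edge_iff B.fork_shape[OF this]] show ?thesis by blast
  qed
qed

section \<open>Transfer along relabelings\<close>

lemma wshift_eq_pshift:
  assumes "\<And>v. v \<in> V \<Longrightarrow> has_parent E v" "\<And>v. v \<in> V \<Longrightarrow> par E v = p v"
  shows "wshift V E lam = pshift V p lam"
  using assms by (auto simp: wshift_def wcomp_def fun_eq_iff)

lemma wshift_eq_pshift_of_edges:
  assumes "E = {(p v, v) | v. v \<in> V}"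
  shows "wshift V E lam = pshift V p lam"
  by (rule wshift_eq_pshift) (auto simp: assms has_parent_def par_def)

lemma l2norm_relabel:
  assumes "bij_betw \<psi> V' V"
  shows "l2norm V' (wcomp V' (\<lambda>_. 1) \<psi> f) = l2norm V f"
proof -
  have "(\<Sum>\<^sub>\<infinity>x\<in>V'. (cmod (wcomp V' (\<lambda>_. 1) \<psi> f x))\<^sup>2) = (\<Sum>\<^sub>\<infinity>x\<in>V'. (cmod (f (\<psi> x)))\<^sup>2)"
    by (rule infsum_cong) (simp add: wcomp_def)
  also have "\<dots> = (\<Sum>\<^sub>\<infinity>x\<in>V. (cmod (f x))\<^sup>2)" by (rule infsum_reindex_bij_betw[OF assms])
  finally show ?thesis by (simp add: l2norm_def)
qed

lemma blin_relabel:
  assumes "bij_betw \<psi> V' V"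
  shows "blin V V' (wcomp V' (\<lambda>_. 1) \<psi>)"
  by (rule blin_wcomp[where C = 1]) (use assms in \<open>auto simp: bij_betw_def intro: fibres_le2_inj\<close>)

lemma relabel_pshift:
  assumes "\<psi> ` V' \<subseteq> V" "\<And>x. x \<in> V' \<Longrightarrow> p' x \<in> V' \<and> p (\<psi> x) = \<psi> (p' x)"
    and "\<And>x. x \<in> V' \<Longrightarrow> lam' x = lam (\<psi> x)"
  shows "wcomp V' (\<lambda>_. 1) \<psi> (pshift V p lam f) = pshift V' p' lam' (wcomp V' (\<lambda>_. 1) \<psi> f)"
  using assms by (auto simp: wcomp_def fun_eq_iff)

lemma relabel_delta:
  assumes "bij_betw \<psi> V' V" "x \<in> V'"
  shows "wcomp V' (\<lambda>_. 1) \<psi> (delta (\<psi> x)) = delta x"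
  using assms by (auto simp: wcomp_def delta_def fun_eq_iff bij_betw_def dest: inj_onD)

lemma cyclic_op_relabel:
  assumes bij: "bij_betw \<psi> V' V" and p: "\<And>x. x \<in> V' \<Longrightarrow> p' x \<in> V' \<and> p (\<psi> x) = \<psi> (p' x)"
    and lam: "\<And>x. x \<in> V' \<Longrightarrow> lam' x = lam (\<psi> x)"
    and T: "blin V V (pshift V p lam)" and T': "blin V' V' (pshift V' p' lam')"
    and cyc: "cyclic_op V (pshift V p lam)"
  shows "cyclic_op V' (pshift V' p' lam')"
proof -
  let ?X = "wcomp V' (\<lambda>_. 1) \<psi>"
  obtain h where h: "cyclic_vector V (pshift V p lam) h" using cyc by (auto simp: cyclic_op_def)
  have sub: "\<psi> ` V' \<subseteq> V" using bij by (simp add: bij_betw_def)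
  have "cyclic_vector V' (pshift V' p' lam') (?X h)"
  proof (rule cyclic_vector_image[OF blin_relabel[OF bij] T T' _ h])
    show "?X (pshift V p lam f) = pshift V' p' lam' (?X f)" for f
      by (rule relabel_pshift) (use sub p lam in auto)
    fix x assume x: "x \<in> V'"
    then have "delta (\<psi> x) \<in> l2 V" using sub by (intro delta_l2) auto
    then show "\<exists>f\<in>l2 V. ?X f = delta x" using relabel_delta[OF bij x] by blast
  qed
  then show ?thesis by (auto simp: cyclic_op_def)
qed

section \<open>The adjoint\<close>

locale parent_shift =
  fixes V :: "'a set" and p :: "'a \<Rightarrow> 'a" and lam :: "'a \<Rightarrow> real" and C :: real
  assumes p_V: "v \<in> V \<Longrightarrow> p v \<in> V" and fib: "fibres_le2 V p"
    and lam_pos: "v \<in> V \<Longrightarrow> 0 < lam v" and lam_le: "v \<in> V \<Longrightarrow> lam v \<le> C"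
begin

abbreviation "S \<equiv> pshift V p lam"

lemma blin_S: "blin V V S"
  by (rule blin_wcomp[where C = C, OF _ _ fib]) (use lam_pos lam_le p_V in \<open>auto simp: less_imp_le abs_of_pos\<close>)

text \<open>The fibres of \<open>p\<close> are finite, so the adjoint at \<open>u\<close> is an
  honest finite sum over the children of \<open>u\<close>.\<close>

definition adj :: "('a \<Rightarrow> complex) \<Rightarrow> ('a \<Rightarrow> complex)" where
  "adj g = (\<lambda>u. if u \<in> V then \<Sum>v | v \<in> V \<and> p v = u. complex_of_real (lam v) * g v else 0)"

lemma fin: "finite {v \<in> V. p v = u}"
  using fib by (simp add: fibres_le2_def)

lemma adj_l2:
  assumes g: "g \<in> l2 V"
  shows "adj g \<in> l2 V"
proof (rule l2I(1))
  show "adj g x = 0" if "x \<notin> V" for x using that by (simp add: adj_def)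
  \<comment> \<open>Cauchy-Schwarz over a fibre of at most two vertices costs the factor 2 under the
    square.\<close>
  define D where "D = sqrt 2 * \<bar>C\<bar>"
  have D: "D\<^sup>2 = 2 * C\<^sup>2" by (simp add: D_def power_mult_distrib)
  fix F assume F: "finite F" "F \<subseteq> V"
  let ?fib = "\<lambda>u. {v \<in> V. p v = u}"
  have 1: "(cmod (adj g u))\<^sup>2 \<le> (\<Sum>v\<in>?fib u. D\<^sup>2 * (cmod (g v))\<^sup>2)" if "u \<in> F" for u
  proof -
    have "cmod (adj g u) \<le> (\<Sum>v\<in>?fib u. cmod (lam v * g v))"
      using that F by (auto simp: adj_def intro: norm_sum)
    then have "(cmod (adj g u))\<^sup>2 \<le> (\<Sum>v\<in>?fib u. cmod (lam v * g v))\<^sup>2" by (rule power_mono) simp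
    also have "\<dots> \<le> (\<Sum>v\<in>?fib u. 1\<^sup>2) * (\<Sum>v\<in>?fib u. (cmod (lam v * g v))\<^sup>2)"
      using Cauchy_Schwarz_ineq_sum[of "\<lambda>_. 1" "\<lambda>v. cmod (lam v * g v)" "?fib u"] by simp
    also have "\<dots> \<le> 2 * (\<Sum>v\<in>?fib u. (cmod (lam v * g v))\<^sup>2)"
      using fib by (intro mult_right_mono sum_nonneg) (auto simp: fibres_le2_def)
    also have "\<dots> \<le> 2 * (\<Sum>v\<in>?fib u. C\<^sup>2 * (cmod (g v))\<^sup>2)"
    proof (intro mult_left_mono sum_mono)
      fix v assume v: "v \<in> ?fib u"
      then have "(lam v)\<^sup>2 \<le> C\<^sup>2" using lam_pos[of v] lam_le[of v] by (intro power_mono) auto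
      then show "(cmod (lam v * g v))\<^sup>2 \<le> C\<^sup>2 * (cmod (g v))\<^sup>2"
        by (simp add: norm_mult power_mult_distrib mult_right_mono)
    qed simp
    finally show ?thesis unfolding D by (simp add: sum_distrib_left mult.assoc)
  qed
  have "(\<Sum>u\<in>F. (cmod (adj g u))\<^sup>2) \<le> (\<Sum>u\<in>F. \<Sum>v\<in>?fib u. D\<^sup>2 * (cmod (g v))\<^sup>2)"
    by (rule sum_mono[OF 1])
  also have "\<dots> = (\<Sum>v\<in>(\<Union>u\<in>F. ?fib u). D\<^sup>2 * (cmod (g v))\<^sup>2)"
    by (rule sum.UNION_disjoint[symmetric]) (use F fin in auto)
  also have "\<dots> = D\<^sup>2 * (\<Sum>v\<in>(\<Union>u\<in>F. ?fib u). (cmod (g v))\<^sup>2)" by (simp add: sum_distrib_left)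
  finally have "L2_set (\<lambda>x. cmod (adj g x)) F \<le> sqrt (D\<^sup>2 * (\<Sum>v\<in>(\<Union>u\<in>F. ?fib u). (cmod (g v))\<^sup>2))"
    unfolding L2_set_def by (rule real_sqrt_le_mono)
  also have "\<dots> = D * L2_set (\<lambda>x. cmod (g x)) (\<Union>u\<in>F. ?fib u)"
    by (simp add: real_sqrt_mult L2_set_def D_def)
  also have "\<dots> \<le> D * l2norm V g"
    using F fin by (intro mult_left_mono L2_set_le_l2norm g) (auto simp: D_def)
  finally show "L2_set (\<lambda>x. cmod (adj g x)) F \<le> D * l2norm V g" .
qed

text \<open>Regroup the absolutely convergent sum over all vertices according to their
  parents.\<close>

lemma l2inner_adj:
  assumes f: "f \<in> l2 V" and g: "g \<in> l2 V"
  shows "l2inner V (S f) g = l2inner V f (adj g)"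
proof -
  let ?fib = "\<lambda>u. {v \<in> V. p v = u}"
  let ?h = "\<lambda>v. S f v * cnj (g v)"
  have bij: "bij_betw snd (Sigma V ?fib) V"
    by (rule bij_betwI[where g = "\<lambda>v. (p v, v)"]) (auto simp: p_V)
  have "?h summable_on V" by (rule l2inner_summable[OF blin_l2[OF blin_S f] g])
  then have s: "(\<lambda>x. ?h (snd x)) summable_on Sigma V ?fib"
    using summable_on_reindex_bij_betw[OF bij, of ?h] by simp
  have "l2inner V (S f) g = infsum (\<lambda>x. ?h (snd x)) (Sigma V ?fib)"
    unfolding l2inner_def using infsum_reindex_bij_betw[OF bij, of ?h] by simp
  also have "\<dots> = (\<Sum>\<^sub>\<infinity>u\<in>V. \<Sum>\<^sub>\<infinity>v\<in>?fib u. ?h v)"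
    using infsum_Sigma_banach[OF s] by simp
  also have "\<dots> = (\<Sum>\<^sub>\<infinity>u\<in>V. f u * cnj (adj g u))"
  proof (rule infsum_cong)
    fix u assume u: "u \<in> V"
    have "(\<Sum>\<^sub>\<infinity>v\<in>?fib u. ?h v) = (\<Sum>v\<in>?fib u. ?h v)" by (simp add: fin)
    also have "\<dots> = (\<Sum>v\<in>?fib u. f u * cnj (lam v * g v))"
      by (rule sum.cong) (auto simp: wcomp_def)
    also have "\<dots> = f u * cnj (adj g u)" using u by (simp add: adj_def sum_distrib_left)
    finally show "(\<Sum>\<^sub>\<infinity>v\<in>?fib u. ?h v) = f u * cnj (adj g u)" .
  qed
  finally show ?thesis by (simp add: l2inner_def)
qed

text \<open>\<open>adjoint_op\<close> is a definite description, so uniqueness has to be shown as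
  well: testing with \<open>delta u\<close> determines each value.\<close>

lemma adjoint_op_eq: "adjoint_op V S = (\<lambda>g. if g \<in> l2 V then adj g else (\<lambda>_. 0))"
  unfolding adjoint_op_def
proof (rule the_equality)
  fix A :: "('a \<Rightarrow> complex) \<Rightarrow> ('a \<Rightarrow> complex)"
  assume A: "(\<forall>g. g \<notin> l2 V \<longrightarrow> A g = (\<lambda>_. 0)) \<and>
      (\<forall>g\<in>l2 V. A g \<in> l2 V \<and> (\<forall>f\<in>l2 V. l2inner V (S f) g = l2inner V f (A g)))"
  show "A = (\<lambda>g. if g \<in> l2 V then adj g else (\<lambda>_. 0))"
  proof
    fix g show "A g = (if g \<in> l2 V then adj g else (\<lambda>_. 0))"
    proof (cases "g \<in> l2 V")
      case True
      have "A g u = adj g u" for u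
      proof (cases "u \<in> V")
        case u: True
        have "l2inner V (delta u) (A g) = l2inner V (delta u) (adj g)"
          using A True l2inner_adj[OF delta_l2(1)[OF u] True] delta_l2(1)[OF u] by metis
        then show ?thesis using u by (simp add: l2inner_delta)
      next
        case False
        then show ?thesis using A True adj_l2[OF True] by (metis l2_zero_outside)
      qed
      then show ?thesis using True by auto
    qed (use A in auto)
  qed
qed (auto simp: adj_l2 l2inner_adj)

lemma adjoint_op_power: "g \<in> l2 V \<Longrightarrow> (adjoint_op V S ^^ n) g = (adj ^^ n) g \<and> (adj ^^ n) g \<in> l2 V"
  by (induction n) (auto simp: adjoint_op_eq adj_l2)

lemma adj_add_scaled: "adj (\<lambda>x. f x + a * g x) = (\<lambda>x. adj f x + a * adj g x)"
  by (auto simp: adj_def fun_eq_iff sum.distrib sum_distrib_left algebra_simps)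

lemma adj_delta:
  assumes v: "v \<in> V"
  shows "adj (delta v) = (\<lambda>u. lam v * delta (p v) u)"
proof
  fix u
  have "(\<Sum>w | w \<in> V \<and> p w = u. lam w * delta v w) = (\<Sum>w | w \<in> V \<and> p w = u. if w = v then complex_of_real (lam v) else 0)"
    by (rule sum.cong) (auto simp: delta_def)
  also have "\<dots> = lam v * delta (p v) u"
    using fin[of u] v by (auto simp: delta_def)
  finally show "adj (delta v) u = lam v * delta (p v) u"
    using p_V[OF v] by (auto simp: adj_def delta_def)
qed

text \<open>The square of the norm of \<open>adj g\<close> is the inner product of
  \<open>S (adj g)\<close> with \<open>g\<close>; Cauchy-Schwarz and cancellation give the
  bound.\<close>

lemma adj_contraction:
  assumes con: "contraction_op V S" and g: "g \<in> l2 V"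
  shows "l2norm V (adj g) \<le> l2norm V g"
proof -
  let ?a = "adj g"
  have "complex_of_real ((l2norm V ?a)\<^sup>2) = l2inner V (S ?a) g"
    using l2inner_self[OF adj_l2[OF g]] l2inner_adj[OF adj_l2[OF g] g] by simp
  then have "(l2norm V ?a)\<^sup>2 = cmod (l2inner V (S ?a) g)"
    by (metis abs_of_nonneg norm_of_real zero_le_power2)
  also have "\<dots> \<le> l2norm V (S ?a) * l2norm V g"
    by (intro cmod_l2inner_le blin_l2[OF blin_S] adj_l2 g)
  also have "\<dots> \<le> l2norm V ?a * l2norm V g"
    using con adj_l2[OF g] by (intro mult_right_mono) (auto simp: contraction_op_def)
  finally have "l2norm V ?a * l2norm V ?a \<le> l2norm V ?a * l2norm V g" by (simp add: power2_eq_square)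
  then show ?thesis by (cases "l2norm V ?a = 0") (auto simp: mult_le_cancel_left_pos less_le)
qed

lemma blin_adj: "contraction_op V S \<Longrightarrow> blin V V adj"
  unfolding blin_def by (intro conjI exI[of _ 1]) (auto simp: adj_l2 adj_add_scaled adj_contraction)

lemma adj_power_delta:
  assumes "contraction_op V S" "v \<in> V"
  shows "(adj ^^ n) (delta v) = (\<lambda>u. complex_of_real (\<Prod>i<n. lam ((p ^^ i) v)) * delta ((p ^^ n) v) u)"
proof (induction n)
  case (Suc n)
  have pV: "(p ^^ n) v \<in> V" using assms(2) p_V by (induction n) auto
  have "(adj ^^ Suc n) (delta v) = adj (\<lambda>u. complex_of_real (\<Prod>i<n. lam ((p ^^ i) v)) * delta ((p ^^ n) v) u)"
    using Suc by simp
  also have "\<dots> = (\<lambda>u. complex_of_real (\<Prod>i<n. lam ((p ^^ i) v)) * adj (delta ((p ^^ n) v)) u)"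
    by (rule blin_scale[OF blin_adj[OF assms(1)] delta_l2(1)[OF pV]])
  also have "\<dots> = (\<lambda>u. complex_of_real (\<Prod>i<Suc n. lam ((p ^^ i) v)) * delta ((p ^^ Suc n) v) u)"
    unfolding adj_delta[OF pV] by (simp add: mult.assoc)
  finally show ?case .
qed simp

text \<open>Since \<open>adj\<close> is a contraction, the vectors with adjoint orbit tending to 0
  form a closed subspace. The norms of the adjoint orbit of \<open>delta v\<close> are the weight
  products along the ancestors of \<open>v\<close>, so if all these tended to 0 the subspace would
  be everything.\<close>

lemma not_C_dot_0_imp:
  assumes con: "contraction_op V S" and not: "\<not> class_C_dot_0 V S"
  shows "\<exists>v\<in>V. \<not> (\<lambda>n. \<Prod>i<n. lam ((p ^^ i) v)) \<longlonglongrightarrow> 0"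
proof (rule ccontr)
  note adj = blin_adj[OF con]
  assume "\<not> ?thesis"
  then have lim: "(\<lambda>n. \<Prod>i<n. lam ((p ^^ i) v)) \<longlonglongrightarrow> 0" if "v \<in> V" for v using that by blast
  have pV: "(p ^^ n) v \<in> V" if "v \<in> V" for n v using that p_V by (induction n) auto
  let ?M = "{g \<in> l2 V. (\<lambda>n. l2norm V ((adj ^^ n) g)) \<longlonglongrightarrow> 0}"
  have le: "l2norm V ((adj ^^ n) g) \<le> l2norm V g" if "g \<in> l2 V" for n g
    using that
  proof (induction n)
    case (Suc n)
    have "l2norm V ((adj ^^ Suc n) g) \<le> l2norm V ((adj ^^ n) g)"
      using adj_contraction[OF con blin_power_l2[OF adj Suc.prems, of n]] by simp
    then show ?case using Suc by simp
  qed simp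
  have pow: "(adj ^^ n) (\<lambda>x. f x + a * g x) = (\<lambda>x. (adj ^^ n) f x + a * (adj ^^ n) g x)" for n f g a
    by (induction n) (auto simp: adj_add_scaled)
  have "csub V ?M" unfolding csub_def
  proof (intro conjI ballI allI impI)
    show "(\<lambda>_. 0) \<in> ?M"
    proof -
      have "(adj ^^ n) (\<lambda>_. 0) = (\<lambda>_. 0)" for n
        by (induction n) (auto simp: blin_zero[OF adj])
      then show ?thesis by simp
    qed
    fix f g a assume fg: "f \<in> ?M" "g \<in> ?M"
    have b: "norm (l2norm V ((adj ^^ n) (\<lambda>x. f x + a * g x))) \<le> l2norm V ((adj ^^ n) f) + cmod a * l2norm V ((adj ^^ n) g)" for n
      unfolding pow using fg l2_add_scaled(2)[OF blin_power_l2[OF adj, of f n] blin_power_l2[OF adj, of g n]] by simp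
    have "(\<lambda>n. l2norm V ((adj ^^ n) f) + cmod a * l2norm V ((adj ^^ n) g)) \<longlonglongrightarrow> 0 + cmod a * 0"
      using fg by (intro tendsto_intros) auto
    then have l: "(\<lambda>n. l2norm V ((adj ^^ n) f) + cmod a * l2norm V ((adj ^^ n) g)) \<longlonglongrightarrow> 0" by simp
    have "(\<lambda>n. l2norm V ((adj ^^ n) (\<lambda>x. f x + a * g x))) \<longlonglongrightarrow> 0"
      by (rule Lim_null_comparison[OF _ l]) (rule always_eventually, rule allI, rule b)
    then show "(\<lambda>x. f x + a * g x) \<in> ?M" using fg by (auto intro: l2_add_scaled(1))
  next
    fix f assume f: "f \<in> l2 V" and ap: "\<forall>e>0. \<exists>g\<in>?M. l2norm V (\<lambda>x. f x - g x) < e"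
    have "(\<lambda>n. l2norm V ((adj ^^ n) f)) \<longlonglongrightarrow> 0"
    proof (rule LIMSEQ_I)
      fix e :: real assume e: "e > 0"
      then obtain g where g: "g \<in> l2 V" "(\<lambda>n. l2norm V ((adj ^^ n) g)) \<longlonglongrightarrow> 0" "l2norm V (\<lambda>x. f x - g x) < e / 2"
        using ap by (auto dest: spec[of _ "e / 2"])
      obtain N where N: "\<And>n. n \<ge> N \<Longrightarrow> l2norm V ((adj ^^ n) g) < e / 2"
        using LIMSEQ_D[OF g(2), of "e / 2"] e by auto
      have "l2norm V ((adj ^^ n) f) < e" if "n \<ge> N" for n
      proof -
        have fg: "(\<lambda>x. f x - g x) \<in> l2 V" by (rule l2_diff[OF f g(1)])
        have "(adj ^^ n) f = (\<lambda>x. (adj ^^ n) (\<lambda>x. f x - g x) x + (adj ^^ n) g x)"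
          using pow[of n "\<lambda>x. f x - g x" 1 g] by simp
        then have "l2norm V ((adj ^^ n) f) \<le> l2norm V ((adj ^^ n) (\<lambda>x. f x - g x)) + l2norm V ((adj ^^ n) g)"
          using l2norm_add_le[OF blin_power_l2[OF adj fg, of n] blin_power_l2[OF adj g(1), of n]] by simp
        also have "\<dots> < e" using le[OF fg, of n] g(3) N[OF that] by simp
        finally show ?thesis .
      qed
      then show "\<exists>N. \<forall>n\<ge>N. norm (l2norm V ((adj ^^ n) f) - 0) < e" by auto
    qed
    then show "f \<in> ?M" using f by simp
  qed auto
  then have "?M = l2 V"
  proof (rule csub_eq_l2)
    fix v assume v: "v \<in> V"
    have "l2norm V ((adj ^^ n) (delta v)) = (\<Prod>i<n. lam ((p ^^ i) v))" for n
      unfolding adj_power_delta[OF con v] l2norm_scale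
      using delta_l2(2)[OF pV[OF v, of n]] prod_nonneg[of "{..<n}" "\<lambda>i. lam ((p ^^ i) v)"] lam_pos[OF pV[OF v]]
      by (simp add: less_imp_le del: of_real_prod)
    then show "delta v \<in> ?M" using lim[OF v] delta_l2(1)[OF v] by simp
  qed
  moreover have "(adjoint_op V S ^^ n) x = (adj ^^ n) x" if "x \<in> l2 V" for n x
    using adjoint_op_power[OF that] by simp
  ultimately have "class_C_dot_0 V S" unfolding class_C_dot_0_def by auto
  then show False using not by blast
qed

end

text \<open>The products decrease, so their nonzero limit is the bound.\<close>

lemma decreasing_products_bounded_below:
  fixes w :: "nat \<Rightarrow> real"
  assumes w: "\<And>i. 0 < w i" "\<And>i. w i \<le> 1" and lim: "\<not> (\<lambda>n. \<Prod>i<n. w i) \<longlonglongrightarrow> 0"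
  obtains \<delta> where "0 < \<delta>" "\<And>n. \<delta> \<le> (\<Prod>i<n. w i)"
proof -
  have pos: "0 < (\<Prod>i<n. w i)" for n using w by (intro prod_pos) auto
  have dec: "decseq (\<lambda>n. \<Prod>i<n. w i)"
    unfolding decseq_Suc_iff using w pos by (auto simp: mult_left_le less_imp_le)
  obtain L where L: "(\<lambda>n. \<Prod>i<n. w i) \<longlonglongrightarrow> L" "\<And>n. L \<le> (\<Prod>i<n. w i)"
    using decseq_convergent[OF dec, of 0] pos less_imp_le by blast
  have "0 \<le> L" by (rule LIMSEQ_le_const[OF L(1)]) (use pos less_imp_le in blast)
  moreover have "L \<noteq> 0" using L(1) lim by auto
  ultimately show ?thesis using L(2) that[of L] by auto
qed

section \<open>Shifts on forks and on trees of branching index one\<close>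

lemma contraction_weights_le_1:
  assumes con: "contraction_op V (pshift V p lam)" and "v \<in> V" "p v \<in> V" "0 < lam v"
    and blin: "blin V V (pshift V p lam)"
  shows "lam v \<le> 1"
proof -
  have d: "delta (p v) \<in> l2 V" "l2norm V (delta (p v)) = 1" using delta_l2[OF assms(3)] by auto
  have "lam v = cmod (pshift V p lam (delta (p v)) v)"
    using assms by (simp add: wcomp_def delta_def)
  also have "\<dots> \<le> l2norm V (pshift V p lam (delta (p v)))"
    by (rule cmod_le_l2norm[OF blin_l2[OF blin d(1)]])
  also have "\<dots> \<le> 1" using con d unfolding contraction_op_def by metis
  finally show ?thesis .
qed

context fork
begin

lemma T_power_delta_Inl_1:
  assumes I: "I = UNIV"
  shows "(T ^^ n) (delta (Inl 1)) = (\<lambda>v. complex_of_real (\<Prod>i<n. lam (Inl (2 + int i))) * delta (Inl (1 + int n)) v)"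
proof (induction n)
  case (Suc n)
  have d: "delta (Inl (1 + int n)) \<in> l2 (fork_V I J)" by (rule delta_l2) (simp add: I)
  have T1: "T (delta (Inl (1 + int n))) = (\<lambda>v. lam (Inl (2 + int n)) * delta (Inl (2 + int n)) v)"
  proof
    fix v show "T (delta (Inl (1 + int n))) v = lam (Inl (2 + int n)) * delta (Inl (2 + int n)) v"
      unfolding T_def by (cases v) (auto simp: wcomp_def delta_def I)
  qed
  have "(T ^^ Suc n) (delta (Inl 1)) = T (\<lambda>v. complex_of_real (\<Prod>i<n. lam (Inl (2 + int i))) * delta (Inl (1 + int n)) v)"
    using Suc by simp
  also have "\<dots> = (\<lambda>v. complex_of_real (\<Prod>i<n. lam (Inl (2 + int i))) * T (delta (Inl (1 + int n))) v)"
    by (rule blin_scale[OF blin_T d])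
  also have "\<dots> = (\<lambda>v. complex_of_real (\<Prod>i<Suc n. lam (Inl (2 + int i))) * delta (Inl (1 + int (Suc n))) v)"
    unfolding T1 by (simp add: mult.assoc)
  finally show ?case .
qed simp

text \<open>A finite side branch ends in a leaf whose basis vector is annihilated by
  \<open>T\<close>, against \<open>stable\<close>. In the leafless case the orbit norms of
  \<open>Inl 1\<close> and \<open>Inr 1\<close> are weight products; not tending to 0, they supply
  the lower bounds for the orthogonality argument.\<close>

lemma not_cyclic_T_if_stable_trivial:
  assumes shape: "I = UNIV \<and> J = {1..} \<or> (\<exists>q\<ge>1. J = {1..q})"
    and le1: "\<And>v. v \<in> fork_V I J \<Longrightarrow> lam v \<le> 1"
    and stable: "\<And>x. x \<in> l2 (fork_V I J) \<Longrightarrow> (\<lambda>n. l2norm (fork_V I J) ((T ^^ n) x)) \<longlonglongrightarrow> 0 \<Longrightarrow> x = (\<lambda>_. 0)"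
  shows "\<not> cyclic_vector (fork_V I J) T h"
proof -
  have delta_ne: "delta v \<noteq> (\<lambda>_. 0)" for v :: "int + nat" by (auto simp: delta_def fun_eq_iff)
  from shape show ?thesis
  proof (elim disjE exE conjE)
    fix q assume q: "1 \<le> q" "J = {1..q}"
    have "T (delta (Inr q)) = (\<lambda>_. 0)" using T_delta_Inr[OF q(1)] q by simp
    then have "(T ^^ Suc n) (delta (Inr q)) = (\<lambda>_. 0)" for n
      by (induction n) (auto simp: blin_zero[OF blin_T])
    then have "(\<lambda>n. l2norm (fork_V I J) ((T ^^ Suc n) (delta (Inr q)))) \<longlonglongrightarrow> 0"
      by (simp only: l2norm_zero tendsto_const)
    then have "(\<lambda>n. l2norm (fork_V I J) ((T ^^ n) (delta (Inr q)))) \<longlonglongrightarrow> 0" by (rule LIMSEQ_imp_Suc)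
    moreover have "delta (Inr q) \<in> l2 (fork_V I J)" using q by (intro delta_l2) auto
    ultimately show ?thesis using stable delta_ne by blast
  next
    assume IJ: "I = UNIV" "J = {1..}"
    have lam0: "0 < lam (Inl n)" "lam (Inl n) \<le> 1" for n using lam_pos le1 IJ by auto
    have lam1: "0 < lam (Inr (Suc j))" "lam (Inr (Suc j)) \<le> 1" for j using lam_pos le1 IJ by auto
    \<comment> \<open>The orbit starts at the first vertex of a branch and so misses the weight
      \<open>w 0\<close> of that vertex; it is put back as a factor, and the minimum with 1 covers
      the empty product.\<close>
    have bd: "\<exists>\<delta>>0. \<forall>k. \<delta> \<le> (\<Prod>i<k. w i)"
      if w: "\<And>i. 0 < w i" "\<And>i. w i \<le> 1" and v: "v \<in> fork_V I J" and v': "\<And>n. v' n \<in> fork_V I J"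
        and eq: "\<And>n. (T ^^ n) (delta v) = (\<lambda>u. complex_of_real (\<Prod>i<n. w (Suc i)) * delta (v' n) u)"
      for w :: "nat \<Rightarrow> real" and v v'
    proof -
      have pos: "0 < (\<Prod>i<n. w (Suc i))" for n using w by (intro prod_pos) auto
      have "l2norm (fork_V I J) ((T ^^ n) (delta v)) = (\<Prod>i<n. w (Suc i))" for n
        unfolding eq l2norm_scale using delta_l2(2)[OF v'[of n]] pos[of n] by (simp del: of_real_prod)
      then have "\<not> (\<lambda>n. \<Prod>i<n. w (Suc i)) \<longlonglongrightarrow> 0"
        using stable[OF delta_l2(1)[OF v]] delta_ne by auto
      then obtain \<delta> where \<delta>: "0 < \<delta>" "\<And>n. \<delta> \<le> (\<Prod>i<n. w (Suc i))"
        using decreasing_products_bounded_below[of "\<lambda>i. w (Suc i)"] w by blast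
      have "min 1 (w 0 * \<delta>) \<le> (\<Prod>i<k. w i)" for k
      proof (cases k)
        case (Suc m)
        have "w 0 * \<delta> \<le> w 0 * (\<Prod>i<m. w (Suc i))" using \<delta> w(1)[of 0] by (intro mult_left_mono) auto
        then show ?thesis unfolding Suc prod.lessThan_Suc_shift by simp
      qed simp
      then show ?thesis using \<delta>(1) w(1)[of 0] by (intro exI[of _ "min 1 (w 0 * \<delta>)"]) auto
    qed
    obtain \<delta>1 where \<delta>1: "0 < \<delta>1" "\<And>k. \<delta>1 \<le> (\<Prod>i<k. lam (Inl (1 + int i)))"
      using bd[of "\<lambda>i. lam (Inl (1 + int i))" "Inl 1" "\<lambda>n. Inl (1 + int n)"] lam0 T_power_delta_Inl_1[OF IJ(1)] IJ
      by (auto simp: algebra_simps)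
    obtain \<delta>2 where \<delta>2: "0 < \<delta>2" "\<And>k. \<delta>2 \<le> (\<Prod>i<k. lam (Inr (1 + i)))"
      using bd[of "\<lambda>i. lam (Inr (1 + i))" "Inr 1" "\<lambda>n. Inr (Suc n)"] lam1 T_power_delta_Inr_1 IJ
      by (auto simp: algebra_simps)
    have "\<not> cyclic_vector (fork_V UNIV {1..}) (pshift (fork_V UNIV {1..}) fpar lam) h"
      by (rule not_cyclic_vector_two_sided_fork[where \<delta> = "min \<delta>1 \<delta>2"])
        (use lam_pos le1 \<delta>1 \<delta>2 IJ in \<open>auto intro: min.coboundedI1 min.coboundedI2\<close>)
    then show ?thesis unfolding T_def unfolding IJ .
  qed
qed

end

text \<open>Projecting the cyclic example to its unweighted trunk preserves cyclicity.\<close>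

lemma bilateral_unweighted_cyclic: "\<exists>h. cyclic_vector UNIV (pshift UNIV (\<lambda>n :: int. n - 1) (\<lambda>_. 1)) h"
proof -
  obtain lam h where lam: "\<And>v. 0 < lam v" "\<And>v. lam v \<le> 1" "\<And>n. lam (Inl n) = 1"
    "cyclic_vector (fork_V UNIV {1..}) (pshift (fork_V UNIV {1..}) fpar lam) h"
    using exists_cyclic_two_sided_fork by blast
  interpret fork UNIV "{1..}" lam 1 using lam by unfold_locales auto
  show ?thesis using cyclic_W_if_cyclic_T[of h, unfolded T_def W_def lam(3), OF lam(4)] by blast
qed

text \<open>The ancestor path of any vertex eventually runs inside the nonpositive trunk. Dropping
  initial factors, all at most 1, only increases the products, and finitely many positive factors
  relate the result to the path from 0.\<close>

lemma bilateral_products_from_vertex: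
  assumes lam: "\<And>v. v \<in> fork_V UNIV J \<Longrightarrow> 0 < lam v" "\<And>v. v \<in> fork_V UNIV J \<Longrightarrow> lam v \<le> (1 :: real)"
    and x: "x \<in> fork_V UNIV J" and J: "J \<subseteq> {1..}" "\<And>v. v \<in> fork_V UNIV J \<Longrightarrow> fpar v \<in> fork_V UNIV J"
    and \<delta>: "0 < \<delta>" "\<And>n. \<delta> \<le> (\<Prod>i<n. lam ((fpar ^^ i) x))"
  shows "\<exists>\<delta>>0. \<forall>n. \<delta> \<le> (\<Prod>i<n. lam (Inl (- int i)))"
proof -
  have fV: "(fpar ^^ i) x \<in> fork_V UNIV J" for i using x J(2) by (induction i) auto
  obtain N k :: nat where Nk: "(fpar ^^ N) x = Inl (- int k)"
  proof (cases x)
    case (Inl n)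
    then have "(fpar ^^ nat \<bar>n\<bar>) x = Inl (- int (nat (\<bar>n\<bar> - n)))" by (simp add: fpar_power_Inl)
    then show ?thesis by (rule that)
  next
    case (Inr j)
    then have "(fpar ^^ j) x = Inl (- int 0)" using x J(1) by (auto simp: fpar_power_Inr)
    then show ?thesis by (rule that)
  qed
  let ?P = "\<Prod>i<k. lam (Inl (- int i))"
  have P: "0 < ?P" using lam by (intro prod_pos) auto
  have tail: "\<delta> \<le> (\<Prod>i<n. lam (Inl (- int k - int i)))" for n
  proof -
    have "\<delta> \<le> (\<Prod>i<N + n. lam ((fpar ^^ i) x))" by (rule \<delta>(2))
    also have "\<dots> = (\<Prod>i<N. lam ((fpar ^^ i) x)) * (\<Prod>i<n. lam ((fpar ^^ (i + N)) x))"
      by (induction n) (auto simp: mult.assoc add.commute)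
    also have "\<dots> \<le> 1 * (\<Prod>i<n. lam ((fpar ^^ (i + N)) x))"
      using lam fV by (intro mult_right_mono prod_le_1 prod_nonneg) (auto simp: less_imp_le)
    finally show ?thesis by (simp add: funpow_add Nk fpar_power_Inl)
  qed
  \<comment> \<open>\<open>?P\<close> supplies the factors from 0 down to the entry point; the
    resulting product over \<open>k + n\<close> factors is at most the one over the first
    \<open>n\<close>.\<close>
  have "?P * \<delta> \<le> (\<Prod>i<n. lam (Inl (- int i)))" for n
  proof -
    have "?P * \<delta> \<le> ?P * (\<Prod>i<n. lam (Inl (- int k - int i)))" using P tail by (intro mult_left_mono) auto
    also have "\<dots> = (\<Prod>i<k + n. lam (Inl (- int i)))"
      by (induction n) (simp_all add: mult.assoc[symmetric])
    also have "\<dots> = (\<Prod>i<n. lam (Inl (- int i))) * (\<Prod>i<k. lam (Inl (- int (n + i))))"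
      by (induction k) (simp_all add: mult.assoc add.commute)
    also have "\<dots> \<le> (\<Prod>i<n. lam (Inl (- int i))) * 1"
      using lam by (intro mult_left_mono prod_le_1 prod_nonneg) (auto simp: less_imp_le)
    finally show ?thesis by simp
  qed
  then show ?thesis using P \<delta>(1) by (intro exI[of _ "?P * \<delta>"]) auto
qed

section \<open>The concrete trees, their shifts and their leaves\<close>

lemma bilat_wshift: "wshift UNIV bilat_E w = pshift UNIV (\<lambda>n. n - 1) w"
  by (rule wshift_eq_pshift_of_edges) (auto simp: bilat_E_def)

lemma tildeT_fork: "tildeT_V = fork_V UNIV {1..}" "tildeT_E = {(fpar v, v) | v. v \<in> tildeT_V}"
proof -
  show 1: "tildeT_V = fork_V UNIV {1..}" by (simp add: tildeT_V_def fork_V_def)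
  show "tildeT_E = {(fpar v, v) | v. v \<in> tildeT_V}"
  proof (intro set_eqI iffI)
    fix e assume "e \<in> tildeT_E"
    then show "e \<in> {(fpar v, v) | v. v \<in> tildeT_V}" unfolding 1 tildeT_E_def by force
  next
    fix e assume "e \<in> {(fpar v, v) | v. v \<in> tildeT_V}"
    then obtain v where "e = (fpar v, v)" "v \<in> fork_V UNIV {1..}" unfolding 1 by blast
    then show "e \<in> tildeT_E" by (cases v) (auto simp: tildeT_E_def)
  qed
qed

lemma oneleaf_fork:
  assumes "1 \<le> k0"
  shows "oneleaf_V k0 = fork_V UNIV {1..k0}" "oneleaf_E k0 = {(fpar v, v) | v. v \<in> oneleaf_V k0}"
proof -
  show 1: "oneleaf_V k0 = fork_V UNIV {1..k0}" by (simp add: oneleaf_V_def fork_V_def)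
  show "oneleaf_E k0 = {(fpar v, v) | v. v \<in> oneleaf_V k0}"
  proof (intro set_eqI iffI)
    fix e assume "e \<in> oneleaf_E k0"
    then show "e \<in> {(fpar v, v) | v. v \<in> oneleaf_V k0}" unfolding 1 oneleaf_E_def using assms by force
  next
    fix e assume "e \<in> {(fpar v, v) | v. v \<in> oneleaf_V k0}"
    then obtain v where "e = (fpar v, v)" "v \<in> fork_V UNIV {1..k0}" unfolding 1 by blast
    then show "e \<in> oneleaf_E k0" by (cases v) (auto simp: oneleaf_E_def)
  qed
qed

lemma exists_cyclic_tildeT:
  "\<exists>mu. bounded_weights tildeT_V tildeT_E mu \<and> positive_weights tildeT_V tildeT_E mu
         \<and> cyclic_op tildeT_V (wshift tildeT_V tildeT_E mu)"
proof -
  obtain lam h where lam: "\<And>v. 0 < lam v" "\<And>v. lam v \<le> 1" "\<And>n. lam (Inl n) = 1"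
    "cyclic_vector (fork_V UNIV {1..}) (pshift (fork_V UNIV {1..}) fpar lam) h"
    using exists_cyclic_two_sided_fork by blast
  have Chi: "Chi tildeT_E u = {v \<in> tildeT_V. fpar v = u}" for u
    by (subst tildeT_fork(2)) (auto simp: Chi_def)
  have fib: "finite {v \<in> tildeT_V. fpar v = u}" "card {v \<in> tildeT_V. fpar v = u} \<le> 2" for u
    using fibres_le2_fpar[of "{1..}" UNIV] by (auto simp: fibres_le2_def tildeT_fork(1))
  have "(\<Sum>v\<in>{v \<in> tildeT_V. fpar v = u}. (lam v)\<^sup>2) \<le> 2" for u
  proof -
    have "(\<Sum>v\<in>{v \<in> tildeT_V. fpar v = u}. (lam v)\<^sup>2) \<le> (\<Sum>v\<in>{v \<in> tildeT_V. fpar v = u}. 1)"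
      using lam by (intro sum_mono power_le_one) (auto simp: less_imp_le)
    then show ?thesis using fib(2)[of u] by simp
  qed
  then have "bounded_weights tildeT_V tildeT_E lam"
    unfolding bounded_weights_def Chi using fib(1) by (intro exI[of _ 2]) (auto intro: summable_on_finite)
  moreover have "positive_weights tildeT_V tildeT_E lam" using lam by (simp add: positive_weights_def)
  moreover have "cyclic_op tildeT_V (wshift tildeT_V tildeT_E lam)"
    unfolding wshift_eq_pshift_of_edges[OF tildeT_fork(2)] using lam(4)
    by (auto simp: tildeT_fork(1) cyclic_op_def)
  ultimately show ?thesis by blast
qed

lemma card_leaves_relabel:
  assumes bij: "bij_betw \<psi> (fork_V I J) V" and E: "E \<subseteq> V \<times> V"
    and edge: "\<And>x y. x \<in> fork_V I J \<Longrightarrow> y \<in> fork_V I J \<Longrightarrow> (\<psi> x, \<psi> y) \<in> E \<longleftrightarrow> fpar y = x"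
  shows "card (leaves V E) = card {x \<in> fork_V I J. \<forall>y\<in>fork_V I J. fpar y \<noteq> x}"
proof -
  have V: "V = \<psi> ` fork_V I J" using bij by (simp add: bij_betw_def)
  have "leaves V E = \<psi> ` {x \<in> fork_V I J. \<forall>y\<in>fork_V I J. fpar y \<noteq> x}"
    using E edge unfolding leaves_def Chi_def V by (auto; blast)
  moreover have "inj_on \<psi> {x \<in> fork_V I J. \<forall>y\<in>fork_V I J. fpar y \<noteq> x}"
    using bij by (auto simp: bij_betw_def intro: inj_on_subset)
  ultimately show ?thesis by (simp add: card_image)
qed

text \<open>The three shapes have no, one and two leaves, so the leaf count alone determines the
  shape.\<close>

lemma childless_fork:
  "{x \<in> fork_V UNIV {1..}. \<forall>y\<in>fork_V UNIV {1..}. fpar y \<noteq> x} = {}"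
  "1 \<le> q \<Longrightarrow> {x \<in> fork_V UNIV {1..q}. \<forall>y\<in>fork_V UNIV {1..q}. fpar y \<noteq> x} = {Inr q}"
  "1 \<le> q \<Longrightarrow> int q \<le> p \<Longrightarrow> {x \<in> fork_V {..p} {1..q}. \<forall>y\<in>fork_V {..p} {1..q}. fpar y \<noteq> x} = {Inl p, Inr q}"
proof -
  show "{x \<in> fork_V UNIV {1..}. \<forall>y\<in>fork_V UNIV {1..}. fpar y \<noteq> x} = {}"
  proof -
    have "\<exists>y\<in>fork_V UNIV {1..}. fpar y = x" if "x \<in> fork_V UNIV {1..}" for x
      using that
    proof (cases x)
      case (Inl n) then show ?thesis by (intro bexI[of _ "Inl (n + 1)"]) auto
    next
      case (Inr j) with that show ?thesis by (intro bexI[of _ "Inr (Suc j)"]) auto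
    qed
    then show ?thesis by blast
  qed
  show "{x \<in> fork_V UNIV {1..q}. \<forall>y\<in>fork_V UNIV {1..q}. fpar y \<noteq> x} = {Inr q}" if q: "1 \<le> q"
  proof (intro set_eqI iffI)
    fix x assume "x \<in> {x \<in> fork_V UNIV {1..q}. \<forall>y\<in>fork_V UNIV {1..q}. fpar y \<noteq> x}"
    then have x: "x \<in> fork_V UNIV {1..q}" "\<And>y. y \<in> fork_V UNIV {1..q} \<Longrightarrow> fpar y \<noteq> x" by auto
    show "x \<in> {Inr q}"
    proof (cases x)
      case (Inl n) then show ?thesis using x(2)[of "Inl (n + 1)"] by simp
    next
      case (Inr j) then show ?thesis using x(1) x(2)[of "Inr (Suc j)"] by (cases "j = q") auto
    qed
  next
    fix x :: "int + nat" assume "x \<in> {Inr q}"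
    then show "x \<in> {x \<in> fork_V UNIV {1..q}. \<forall>y\<in>fork_V UNIV {1..q}. fpar y \<noteq> x}"
      using q by (auto simp: fork_V_def split: if_splits)
  qed
  show "{x \<in> fork_V {..p} {1..q}. \<forall>y\<in>fork_V {..p} {1..q}. fpar y \<noteq> x} = {Inl p, Inr q}"
    if q: "1 \<le> q" and p: "int q \<le> p"
  proof (intro set_eqI iffI)
    fix x assume "x \<in> {x \<in> fork_V {..p} {1..q}. \<forall>y\<in>fork_V {..p} {1..q}. fpar y \<noteq> x}"
    then have x: "x \<in> fork_V {..p} {1..q}" "\<And>y. y \<in> fork_V {..p} {1..q} \<Longrightarrow> fpar y \<noteq> x" by auto
    show "x \<in> {Inl p, Inr q}"
    proof (cases x)
      case (Inl n) then show ?thesis using x(1) x(2)[of "Inl (n + 1)"] by (cases "n = p") auto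
    next
      case (Inr j) then show ?thesis using x(1) x(2)[of "Inr (Suc j)"] by (cases "j = q") auto
    qed
  next
    fix x :: "int + nat" assume "x \<in> {Inl p, Inr q}"
    then show "x \<in> {x \<in> fork_V {..p} {1..q}. \<forall>y\<in>fork_V {..p} {1..q}. fpar y \<noteq> x}"
      using q p by (auto simp: fork_V_def split: if_splits)
  qed
qed

lemma bounded_weights_le:
  assumes bw: "bounded_weights V E lam"
  obtains C where "\<And>u v. u \<in> V \<Longrightarrow> (u, v) \<in> E \<Longrightarrow> lam v \<le> C"
proof -
  obtain C where C: "\<And>u. u \<in> V \<Longrightarrow> (\<lambda>v. (lam v)\<^sup>2) summable_on Chi E u \<and> (\<Sum>\<^sub>\<infinity>v\<in>Chi E u. (lam v)\<^sup>2) \<le> C"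
    using bw unfolding bounded_weights_def by blast
  have "lam v \<le> sqrt C" if uv: "u \<in> V" "(u, v) \<in> E" for u v
  proof -
    have "(\<Sum>x\<in>{v}. (lam x)\<^sup>2) \<le> (\<Sum>\<^sub>\<infinity>v\<in>Chi E u. (lam v)\<^sup>2)"
      using C[OF uv(1)] uv(2) by (intro finite_sum_le_infsum) (auto simp: Chi_def)
    then have "(lam v)\<^sup>2 \<le> C" using C[OF uv(1)] by simp
    then show ?thesis by (rule real_le_rsqrt)
  qed
  then show ?thesis by (rule that)
qed

section \<open>Transfer of the results on forks to the given tree\<close>

locale fork_tree =
  fixes V :: "'a set" and E :: "('a \<times> 'a) set" and lam :: "'a \<Rightarrow> real" and C :: real
    and I :: "int set" and J :: "nat set" and \<psi> :: "int + nat \<Rightarrow> 'a"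
  assumes tree: "dtree V E" and rootless: "rootless V E"
    and weight_pos: "v \<in> V \<Longrightarrow> 0 < lam v" and weight_le: "v \<in> V \<Longrightarrow> lam v \<le> C"
    and bij: "bij_betw \<psi> (fork_V I J) V"
    and edge: "x \<in> fork_V I J \<Longrightarrow> y \<in> fork_V I J \<Longrightarrow> (\<psi> x, \<psi> y) \<in> E \<longleftrightarrow> fpar y = x"
    and fpar_closed: "x \<in> fork_V I J \<Longrightarrow> fpar x \<in> fork_V I J"
    and shape: "I = UNIV \<and> J = {1..} \<or> (\<exists>q\<ge>1. I = UNIV \<and> J = {1..q})
      \<or> (\<exists>p q. 1 \<le> q \<and> int q \<le> p \<and> I = {..p} \<and> J = {1..q})"
begin

lemma \<psi>_V: "x \<in> fork_V I J \<Longrightarrow> \<psi> x \<in> V"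
  using bij by (auto simp: bij_betw_def)

lemma V_\<psi>: "v \<in> V \<Longrightarrow> \<exists>x\<in>fork_V I J. v = \<psi> x"
  using bij by (auto simp: bij_betw_def)

lemma par_\<psi>:
  assumes "x \<in> fork_V I J"
  shows "par E (\<psi> x) = \<psi> (fpar x)"
proof -
  have "(\<psi> (fpar x), \<psi> x) \<in> E" using edge[OF fpar_closed[OF assms] assms] by simp
  then show ?thesis using tree unfolding dtree_def par_def by (intro the_equality) blast+
qed

sublocale fork I J "\<lambda>x. lam (\<psi> x)" C
  using shape by unfold_locales (auto simp: weight_pos weight_le \<psi>_V)

lemma fibres_par: "fibres_le2 V (par E)"
  unfolding fibres_le2_def
proof
  fix u
  show "finite {v \<in> V. par E v = u} \<and> card {v \<in> V. par E v = u} \<le> 2"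
  proof (cases "{v \<in> V. par E v = u} = {}")
    case False
    then obtain y where y: "y \<in> fork_V I J" "par E (\<psi> y) = u" using V_\<psi> by blast
    let ?A = "{x \<in> fork_V I J. fpar x = fpar y}"
    have sub: "{v \<in> V. par E v = u} \<subseteq> \<psi> ` ?A"
    proof
      fix v assume "v \<in> {v \<in> V. par E v = u}"
      then obtain x where x: "x \<in> fork_V I J" "v = \<psi> x" "par E (\<psi> x) = u" using V_\<psi> by blast
      then have "\<psi> (fpar x) = \<psi> (fpar y)" using y par_\<psi> by metis
      then have "fpar x = fpar y"
        using bij fpar_closed[OF x(1)] fpar_closed[OF y(1)] by (auto simp: bij_betw_def dest: inj_onD)
      then show "v \<in> \<psi> ` ?A" using x by blast
    qed
    have A: "finite ?A" "card ?A \<le> 2" using fibres_le2_fpar[OF J_pos, of I] by (auto simp: fibres_le2_def)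
    then have "card (\<psi> ` ?A) \<le> 2" using card_image_le[OF A(1), of \<psi>] by simp
    then show ?thesis using card_mono[OF _ sub] finite_subset[OF sub] A(1) by auto
  qed (simp only: card.empty finite.emptyI, simp)
qed

sublocale P: parent_shift V "par E" lam C
proof
  show "par E v \<in> V" if "v \<in> V" for v using V_\<psi>[OF that] par_\<psi> \<psi>_V fpar_closed by auto
qed (auto simp: fibres_par weight_pos weight_le)

lemma wshift_eq: "wshift V E lam = P.S"
  by (rule wshift_eq_pshift) (use rootless in \<open>auto simp: rootless_def\<close>)

lemma inv_\<psi>:
  assumes "v \<in> V"
  shows "par E v \<in> V \<and> fpar (inv_into (fork_V I J) \<psi> v) = inv_into (fork_V I J) \<psi> (par E v)"
    and "lam v = lam (\<psi> (inv_into (fork_V I J) \<psi> v))"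
proof -
  have inj: "inj_on \<psi> (fork_V I J)" using bij by (simp add: bij_betw_def)
  obtain x where x: "x \<in> fork_V I J" "v = \<psi> x" using V_\<psi>[OF assms] by blast
  show "par E v \<in> V \<and> fpar (inv_into (fork_V I J) \<psi> v) = inv_into (fork_V I J) \<psi> (par E v)"
    using x inj fpar_closed[OF x(1)] \<psi>_V by (auto simp: par_\<psi>)
  show "lam v = lam (\<psi> (inv_into (fork_V I J) \<psi> v))" using x inj by simp
qed

lemma cyclic_iff: "cyclic_op V P.S \<longleftrightarrow> cyclic_op (fork_V I J) T"
proof
  assume "cyclic_op V P.S"
  then show "cyclic_op (fork_V I J) T"
    unfolding T_def
    by (rule cyclic_op_relabel[OF bij _ _ P.blin_S blin_T[unfolded T_def], rotated 2])
      (auto simp: fpar_closed par_\<psi>)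
next
  assume "cyclic_op (fork_V I J) T"
  then show "cyclic_op V P.S"
    unfolding T_def
    by (rule cyclic_op_relabel[OF bij_betw_inv_into[OF bij] _ _ blin_T[unfolded T_def] P.blin_S, rotated 2])
      (erule inv_\<psi>)+
qed

lemma weights_le_1: "contraction_op V P.S \<Longrightarrow> v \<in> V \<Longrightarrow> lam v \<le> 1"
  by (rule contraction_weights_le_1[OF _ _ _ _ P.blin_S]) (auto simp: weight_pos P.p_V)

text \<open>Relabeling is isometric and intertwines the shifts, so triviality of \<open>H0\<close>
  passes to the fork.\<close>

lemma not_cyclic_C1:
  assumes con: "contraction_op V P.S" and C1: "class_C1_dot V P.S"
  shows "\<not> cyclic_op V P.S"
proof -
  let ?\<phi> = "inv_into (fork_V I J) \<psi>"
  let ?X = "wcomp V (\<lambda>_. 1) ?\<phi>"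
  have bij': "bij_betw ?\<phi> V (fork_V I J)" by (rule bij_betw_inv_into[OF bij])
  have comm: "?X (T f) = P.S (?X f)" for f
    unfolding T_def
    by (rule relabel_pshift[OF bij_betw_imp_surj_on[OF bij', THEN equalityD1]]) (erule inv_\<psi>)+
  have stable: "x = (\<lambda>_. 0)"
    if x: "x \<in> l2 (fork_V I J)" and lim: "(\<lambda>n. l2norm (fork_V I J) ((T ^^ n) x)) \<longlonglongrightarrow> 0" for x
  proof -
    have "l2norm V ((P.S ^^ n) (?X x)) = l2norm (fork_V I J) ((T ^^ n) x)" for n
      using intertwine_power[of "fork_V I J" T ?X P.S x n, OF blin_T comm x] l2norm_relabel[OF bij'] by metis
    then have "?X x \<in> H0 V P.S"
      using lim blin_l2[OF blin_relabel[OF bij'] x] by (simp add: H0_def)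
    then have "?X x = (\<lambda>_. 0)" using C1 unfolding class_C1_dot_def by blast
    then have "l2norm (fork_V I J) x = 0" using l2norm_relabel[OF bij', of x] by simp
    then show ?thesis by (rule l2norm_eq_0_imp[OF x])
  qed
  have "\<not> cyclic_vector (fork_V I J) T h" for h
    by (rule not_cyclic_T_if_stable_trivial) (use shape stable weights_le_1[OF con] \<psi>_V in auto)
  then show ?thesis unfolding cyclic_iff by (simp add: cyclic_op_def)
qed

lemma cyclic_T_iff_cyclic_W: "finite J \<Longrightarrow> cyclic_op (fork_V I J) T \<longleftrightarrow> cyclic_op I W"
  using cyclic_T_if_cyclic_W cyclic_W_if_cyclic_T by (auto simp: cyclic_op_def)

lemma cyclic_two_leaves:
  assumes "I = {..p}" "finite J"
  shows "cyclic_op V P.S"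
proof -
  have "\<exists>h. cyclic_vector {..p} (pshift {..p} (\<lambda>n. n - 1) (\<lambda>n. lam (\<psi> (Inl n)))) h"
    by (rule backward_chain_cyclic[of p _ C]) (auto simp: weight_pos weight_le \<psi>_V assms(1))
  then have "cyclic_op I W" unfolding cyclic_op_def W_def unfolding assms(1) .
  then show ?thesis unfolding cyclic_iff cyclic_T_iff_cyclic_W[OF assms(2)] .
qed

text \<open>Failure of the class condition shows up at some vertex; the bound is moved to the
  backward trunk, where it makes \<open>W\<close> cyclic, and the finite side branch lets cyclicity
  pass from \<open>W\<close> to the tree.\<close>

lemma cyclic_one_leaf_not_C_dot_0:
  assumes I: "I = UNIV" and "finite J" and con: "contraction_op V P.S" and not: "\<not> class_C_dot_0 V P.S"
  shows "cyclic_op V P.S"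
proof -
  obtain v where v: "v \<in> V" "\<not> (\<lambda>n. \<Prod>i<n. lam ((par E ^^ i) v)) \<longlonglongrightarrow> 0"
    using P.not_C_dot_0_imp[OF con not] by blast
  obtain x where x: "x \<in> fork_V I J" "v = \<psi> x" using V_\<psi>[OF v(1)] by blast
  have fV: "(fpar ^^ i) x \<in> fork_V I J" for i using x(1) fpar_closed by (induction i) auto
  have "(par E ^^ i) v = \<psi> ((fpar ^^ i) x)" for i
    by (induction i) (auto simp: x(2) par_\<psi>[OF fV])
  then have lim: "\<not> (\<lambda>n. \<Prod>i<n. lam (\<psi> ((fpar ^^ i) x))) \<longlonglongrightarrow> 0" using v(2) by simp
  obtain \<delta> where \<delta>: "0 < \<delta>" "\<And>n. \<delta> \<le> (\<Prod>i<n. lam (\<psi> ((fpar ^^ i) x)))"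
    using decreasing_products_bounded_below[OF _ _ lim] weight_pos[OF \<psi>_V[OF fV]] weights_le_1[OF con \<psi>_V[OF fV]] by blast
  have "\<exists>\<delta>>0. \<forall>n. \<delta> \<le> (\<Prod>i<n. lam (\<psi> (Inl (- int i))))"
    by (rule bilateral_products_from_vertex[of J "\<lambda>x. lam (\<psi> x)", OF weight_pos[OF \<psi>_V, unfolded I]
        weights_le_1[OF con \<psi>_V, unfolded I] x(1)[unfolded I] J_pos fpar_closed[unfolded I] \<delta>])
  then obtain \<delta>' where \<delta>': "0 < \<delta>'" "\<And>n. \<delta>' \<le> (\<Prod>i<n. lam (\<psi> (Inl (- int i))))" by blast
  obtain h where h: "cyclic_vector UNIV (pshift UNIV (\<lambda>n :: int. n - 1) (\<lambda>_. 1)) h"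
    using bilateral_unweighted_cyclic by blast
  have "\<exists>h. cyclic_vector UNIV (pshift UNIV (\<lambda>n. n - 1) (\<lambda>n. lam (\<psi> (Inl n)))) h"
    by (rule bilateral_cyclic_if_backward_products[OF _ _ \<delta>' h])
      (auto simp: I weight_pos \<psi>_V weights_le_1[OF con])
  then have "cyclic_op I W" unfolding cyclic_op_def W_def unfolding I .
  then show ?thesis unfolding cyclic_iff cyclic_T_iff_cyclic_W[OF assms(2)] .
qed

lemma card_leaves: "card (leaves V E) = card {x \<in> fork_V I J. \<forall>y\<in>fork_V I J. fpar y \<noteq> x}"
  by (rule card_leaves_relabel[OF bij _ edge]) (use tree in \<open>auto simp: dtree_def\<close>)

end

theorem mainTheorem17:
  fixes V :: "'a set" and E :: "('a \<times> 'a) set" and lam :: "'a \<Rightarrow> real"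
  assumes "dtree V E" and "rootless V E" and "Br V E = 1"
    and "bounded_weights V E lam" and "positive_weights V E lam"
  shows "(card (leaves V E) = 2 \<longrightarrow> cyclic_op V (wshift V E lam))
    \<and> (card (leaves V E) = 1 \<longrightarrow>
         (\<exists>k0 \<ge> 1. \<exists>\<phi>. bij_betw \<phi> V (oneleaf_V k0)
             \<and> (\<forall>u\<in>V. \<forall>v\<in>V. (u, v) \<in> E \<longleftrightarrow> (\<phi> u, \<phi> v) \<in> oneleaf_E k0)
             \<and> (cyclic_op V (wshift V E lam) \<longleftrightarrow>
                cyclic_op (UNIV :: int set)
                  (wshift UNIV bilat_E (\<lambda>n. lam (inv_into V \<phi> (Inl n))))))
       \<and> (contraction_op V (wshift V E lam) \<and> \<not> class_C_dot_0 V (wshift V E lam)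
            \<longrightarrow> cyclic_op V (wshift V E lam)))
    \<and> (contraction_op V (wshift V E lam) \<and> class_C1_dot V (wshift V E lam)
         \<longrightarrow> \<not> cyclic_op V (wshift V E lam))
    \<and> (\<exists>mu. bounded_weights tildeT_V tildeT_E mu \<and> positive_weights tildeT_V tildeT_E mu
         \<and> cyclic_op tildeT_V (wshift tildeT_V tildeT_E mu))"
proof -
  obtain C where C: "\<And>u v. u \<in> V \<Longrightarrow> (u, v) \<in> E \<Longrightarrow> lam v \<le> C"
    using bounded_weights_le[OF assms(4)] by blast
  have E_V: "(u, v) \<in> E \<Longrightarrow> u \<in> V" for u v using assms(1) unfolding dtree_def by blast
  have lam_le: "lam v \<le> C" if "v \<in> V" for v
    using assms(2) that C E_V unfolding rootless_def has_parent_def by blast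
  have lam_pos: "0 < lam v" if "v \<in> V" for v
    using assms(2,5) that unfolding rootless_def positive_weights_def by blast
  show ?thesis
  proof (rule branching_one_is_fork[OF assms(1-3)])
    fix I J \<psi> assume \<psi>: "bij_betw \<psi> (fork_V I J) V"
      "\<And>x. x \<in> fork_V I J \<Longrightarrow> fpar x \<in> fork_V I J"
      "\<And>x y. x \<in> fork_V I J \<Longrightarrow> y \<in> fork_V I J \<Longrightarrow> (\<psi> x, \<psi> y) \<in> E \<longleftrightarrow> fpar y = x"
      "I = UNIV \<and> J = {1..} \<or> (\<exists>q\<ge>1. I = UNIV \<and> J = {1..q})
      \<or> (\<exists>p q. 1 \<le> q \<and> int q \<le> p \<and> I = {..p} \<and> J = {1..q})"
    interpret fork_tree V E lam C I J \<psi>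
      using assms(1,2) lam_pos lam_le \<psi> by unfold_locales
    have "cyclic_op V P.S" if two: "card (leaves V E) = 2"
      using shape
    proof (elim disjE exE conjE)
      fix p q assume "I = {..p}" "J = {1..q}"
      then show ?thesis by (intro cyclic_two_leaves) auto
    next
      \<comment> \<open>The remaining shapes have a different number of leaves and contradict the
        count.\<close>
      assume "I = UNIV" "J = {1..}"
      then show ?thesis using two unfolding card_leaves by (simp only: childless_fork) simp
    next
      fix q :: nat assume "1 \<le> q" "I = UNIV" "J = {1..q}"
      then show ?thesis using two unfolding card_leaves by (simp only: childless_fork) simp
    qed
    moreover have "(\<exists>k0\<ge>1. \<exists>\<phi>. bij_betw \<phi> V (oneleaf_V k0)
               \<and> (\<forall>u\<in>V. \<forall>v\<in>V. (u, v) \<in> E \<longleftrightarrow> (\<phi> u, \<phi> v) \<in> oneleaf_E k0)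
               \<and> (cyclic_op V P.S \<longleftrightarrow>
                  cyclic_op (UNIV :: int set)
                    (wshift UNIV bilat_E (\<lambda>n. lam (inv_into V \<phi> (Inl n))))))
         \<and> (contraction_op V P.S \<and> \<not> class_C_dot_0 V P.S \<longrightarrow> cyclic_op V P.S)"
      if one: "card (leaves V E) = 1"
      using shape
    proof (elim disjE exE conjE)
      assume "I = UNIV" "J = {1..}"
      then show ?thesis using one unfolding card_leaves by (simp only: childless_fork) simp
    next
      fix p q assume "1 \<le> q" "int q \<le> p" "I = {..p}" "J = {1..q}"
      then show ?thesis using one unfolding card_leaves by (simp only: childless_fork) simp
    next
      fix q :: nat assume q: "1 \<le> q" "I = UNIV" "J = {1..q}"
      \<comment> \<open>The statement relabels from the tree to the model, opposite to
        \<open>\<psi>\<close>; inverting \<open>\<phi>\<close> again recovers \<open>\<psi>\<close>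
        on the trunk.\<close>
      define \<phi> where "\<phi> = inv_into (fork_V I J) \<psi>"
      have inj: "inj_on \<psi> (fork_V I J)" using bij by (simp add: bij_betw_def)
      have V: "oneleaf_V q = fork_V I J" using oneleaf_fork(1)[OF q(1)] q by simp
      have bij': "bij_betw \<phi> V (oneleaf_V q)" unfolding V \<phi>_def by (rule bij_betw_inv_into[OF bij])
      have edges: "(u, v) \<in> E \<longleftrightarrow> (\<phi> u, \<phi> v) \<in> oneleaf_E q" if uv: "u \<in> V" "v \<in> V" for u v
      proof -
        obtain x y where xy: "x \<in> fork_V I J" "u = \<psi> x" "y \<in> fork_V I J" "v = \<psi> y"
          using V_\<psi> uv by metis
        then have "\<phi> u = x" "\<phi> v = y" using inj by (auto simp: \<phi>_def)
        then show ?thesis unfolding oneleaf_fork(2)[OF q(1)] V using xy edge[of x y] by auto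
      qed
      have inv: "inv_into V \<phi> (Inl n) = \<psi> (Inl n)" for n
      proof -
        have "Inl n \<in> fork_V I J" by (simp add: q)
        then show ?thesis unfolding \<phi>_def by (rule inv_into_inv_into_eq[OF bij])
      qed
      have "finite J" by (simp add: q)
      then have "cyclic_op V P.S \<longleftrightarrow> cyclic_op UNIV (wshift UNIV bilat_E (\<lambda>n. lam (inv_into V \<phi> (Inl n))))"
        unfolding cyclic_iff cyclic_T_iff_cyclic_W[OF \<open>finite J\<close>] bilat_wshift inv W_def
        by (simp only: q(2))
      moreover have "contraction_op V P.S \<and> \<not> class_C_dot_0 V P.S \<longrightarrow> cyclic_op V P.S"
        using cyclic_one_leaf_not_C_dot_0 q by auto
      ultimately show ?thesis using q(1) bij' edges by blast
    qed
    moreover have "contraction_op V P.S \<and> class_C1_dot V P.S \<longrightarrow> \<not> cyclic_op V P.S"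
      using not_cyclic_C1 by blast
    ultimately show ?thesis unfolding wshift_eq using exists_cyclic_tildeT by blast
  qed
qed

end
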